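(* Let $T$ be a locally finite thick semi-regular tree, and let $\mathcal{C}$ be the set of topologically simple closed subgroups of $\mathrm{Aut}(T)$ acting $2$-transitively on the set of ends $\partial T$. Then $\mathcal{C}$ is closed in $\mathbf{Sub}(\mathrm{Aut}(T))$ for the Chabauty topology. Moreover, the relation $\cong$ of topological isomorphism on $\mathcal{C}$ has closed classes, and the set $\mathcal{S}_T=\mathcal{C}/{\cong}$ of isomorphism classes of topologically simple groups acting continuously and properly on $T$ and $2$-transitively on $\partial T$, endowed with the quotient topology, is compact Hausdorff.
   Context: A tree is thick if all its vertices have degree $\geq 3$; it is semi-regular if $\mathrm{Aut}(T)$ is transitive on (geometric) edges. $\mathrm{Aut}(T)$ carries the topology of pointwise convergence on vertices; it is a second countable totally disconnected locally compact group. For a locally compact group $G$, $\mathbf{Sub}(G)$ is the set of closed subgroups of $G$ with the Chabauty topology, in which a base of neighborhoods of $H$ is given by the sets $\{J \in \mathbf{Sub}(G) \mid J\cap K\subseteq HU,\ H\cap K\subseteq JU\}$ with $K\subseteq G$ compact and $U$ an open identity neighborhood. A topological group is topologically simple if it is non-trivial and its only closed normal subgroups are the trivial group and the whole group. The topology on $\mathcal{S}_T$ is the quotient of the subspace topology on $\mathcal{C}\subseteq \mathbf{Sub}(\mathrm{Aut}(T))$. *)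

theory Defs
  imports "HOL-Analysis.Analysis" "HOL-Algebra.Coset"
begin

section \<open>Trees, their automorphisms and their ends\<close>

text \<open>
  A simple graph is an adjacency relation whose vertex set is the whole type \<open>'v\<close>;
  as \<open>'v\<close> is a type variable, this covers every non-empty vertex set. The trees of AFP
  Graph_Theory are not usable here: in the symmetric digraphs of that entry a path
  \<open>a, b, a\<close> already counts as a cycle.
\<close>

definition simple_graph :: "('v \<Rightarrow> 'v \<Rightarrow> bool) \<Rightarrow> bool" where
  "simple_graph adj \<longleftrightarrow> symp adj \<and> irreflp adj"

definition connected_graph :: "('v \<Rightarrow> 'v \<Rightarrow> bool) \<Rightarrow> bool" where
  "connected_graph adj \<longleftrightarrow> (\<forall>x y. adj\<^sup>*\<^sup>* x y)"

definition graph_cycle :: "('v \<Rightarrow> 'v \<Rightarrow> bool) \<Rightarrow> 'v list \<Rightarrow> bool" where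
  "graph_cycle adj c \<longleftrightarrow>
     3 \<le> length c \<and> distinct c \<and> successively adj c \<and> adj (last c) (hd c)"

definition tree :: "('v \<Rightarrow> 'v \<Rightarrow> bool) \<Rightarrow> bool" where
  "tree adj \<longleftrightarrow> simple_graph adj \<and> connected_graph adj \<and> (\<nexists>c. graph_cycle adj c)"

definition neighbours :: "('v \<Rightarrow> 'v \<Rightarrow> bool) \<Rightarrow> 'v \<Rightarrow> 'v set" where
  "neighbours adj x = {y. adj x y}"

definition locally_finite :: "('v \<Rightarrow> 'v \<Rightarrow> bool) \<Rightarrow> bool" where
  "locally_finite adj \<longleftrightarrow> (\<forall>x. finite (neighbours adj x))"

text \<open>The first disjunct is needed because \<open>card\<close> is \<open>0\<close> on infinite sets.\<close>

definition thick :: "('v \<Rightarrow> 'v \<Rightarrow> bool) \<Rightarrow> bool" where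
  "thick adj \<longleftrightarrow> (\<forall>x. infinite (neighbours adj x) \<or> 3 \<le> card (neighbours adj x))"

definition Aut :: "('v \<Rightarrow> 'v \<Rightarrow> bool) \<Rightarrow> ('v \<Rightarrow> 'v) set" where
  "Aut adj = {g. bij g \<and> (\<forall>x y. adj (g x) (g y) \<longleftrightarrow> adj x y)}"

definition semi_regular :: "('v \<Rightarrow> 'v \<Rightarrow> bool) \<Rightarrow> bool" where
  "semi_regular adj \<longleftrightarrow>
     (\<forall>x y x' y'. adj x y \<longrightarrow> adj x' y' \<longrightarrow> (\<exists>g\<in>Aut adj. g ` {x, y} = {x', y'}))"

definition aut_group :: "('v \<Rightarrow> 'v \<Rightarrow> bool) \<Rightarrow> ('v \<Rightarrow> 'v) monoid" where
  "aut_group adj = \<lparr>carrier = Aut adj, monoid.mult = (\<circ>), one = id\<rparr>"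

definition aut_topology :: "('v \<Rightarrow> 'v \<Rightarrow> bool) \<Rightarrow> ('v \<Rightarrow> 'v) topology" where
  "aut_topology adj =
     subtopology (product_topology (\<lambda>_. discrete_topology UNIV) UNIV) (Aut adj)"

definition rays :: "('v \<Rightarrow> 'v \<Rightarrow> bool) \<Rightarrow> (nat \<Rightarrow> 'v) set" where
  "rays adj = {r. inj r \<and> (\<forall>n. adj (r n) (r (Suc n)))}"

definition cofinal_rays :: "('v \<Rightarrow> 'v \<Rightarrow> bool) \<Rightarrow> ((nat \<Rightarrow> 'v) \<times> (nat \<Rightarrow> 'v)) set" where
  "cofinal_rays adj =
     {(r, s). r \<in> rays adj \<and> s \<in> rays adj \<and> (\<exists>m n. \<forall>k. r (m + k) = s (n + k))}"

definition ends :: "('v \<Rightarrow> 'v \<Rightarrow> bool) \<Rightarrow> (nat \<Rightarrow> 'v) set set" where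
  "ends adj = rays adj // cofinal_rays adj"

definition end_act :: "('v \<Rightarrow> 'v) \<Rightarrow> (nat \<Rightarrow> 'v) set \<Rightarrow> (nat \<Rightarrow> 'v) set" where
  "end_act g \<xi> = (\<lambda>r. g \<circ> r) ` \<xi>"

definition two_transitive_on_ends :: "('v \<Rightarrow> 'v \<Rightarrow> bool) \<Rightarrow> ('v \<Rightarrow> 'v) set \<Rightarrow> bool" where
  "two_transitive_on_ends adj H \<longleftrightarrow>
     (\<forall>\<xi>\<in>ends adj. \<forall>\<eta>\<in>ends adj. \<forall>\<xi>'\<in>ends adj. \<forall>\<eta>'\<in>ends adj.
        \<xi> \<noteq> \<eta> \<longrightarrow> \<xi>' \<noteq> \<eta>' \<longrightarrow> (\<exists>h\<in>H. end_act h \<xi> = \<xi>' \<and> end_act h \<eta> = \<eta>'))"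

section \<open>Topological groups\<close>

definition topological_group :: "('g, 'm) monoid_scheme \<Rightarrow> 'g topology \<Rightarrow> bool" where
  "topological_group G X \<longleftrightarrow> group G \<and> topspace X = carrier G \<and>
     continuous_map (prod_topology X X) X (\<lambda>(g, h). g \<otimes>\<^bsub>G\<^esub> h) \<and>
     continuous_map X X (\<lambda>g. inv\<^bsub>G\<^esub> g)"

definition topologically_simple :: "('g, 'm) monoid_scheme \<Rightarrow> 'g topology \<Rightarrow> bool" where
  "topologically_simple G X \<longleftrightarrow> carrier G \<noteq> {\<one>\<^bsub>G\<^esub>} \<and>
     (\<forall>N. N \<lhd> G \<longrightarrow> closedin X N \<longrightarrow> N = {\<one>\<^bsub>G\<^esub>} \<or> N = carrier G)"

definition topologically_isomorphic ::
  "('g, 'm) monoid_scheme \<Rightarrow> 'g topology \<Rightarrow> ('h, 'n) monoid_scheme \<Rightarrow> 'h topology \<Rightarrow> bool" where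
  "topologically_isomorphic G X H Y \<longleftrightarrow> (\<exists>f\<in>iso G H. homeomorphic_map X Y f)"

lemma group_aut_group: "group (aut_group adj)"
proof (rule groupI)
  fix g assume g: "g \<in> carrier (aut_group adj)"
  then have b: "bij g" and e: "adj (g x) (g y) \<longleftrightarrow> adj x y" for x y
    by (auto simp: aut_group_def Aut_def)
  have "adj ((inv_into UNIV g) x) ((inv_into UNIV g) y) \<longleftrightarrow> adj x y" for x y
    using e[of "(inv_into UNIV g) x" "(inv_into UNIV g) y"] b by (simp add: bij_is_surj surj_f_inv_f)
  moreover have "(inv_into UNIV g) \<circ> g = id"
    using b by (simp add: bij_is_inj)
  ultimately show "\<exists>h\<in>carrier (aut_group adj). h \<otimes>\<^bsub>aut_group adj\<^esub> g = \<one>\<^bsub>aut_group adj\<^esub>"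
    using b by (intro bexI[of _ "(inv_into UNIV g)"]) (auto simp: aut_group_def Aut_def bij_imp_bij_inv)
qed (auto simp: aut_group_def Aut_def intro: bij_comp)

lemma inv_aut_group:
  assumes "g \<in> Aut adj"
  shows "inv\<^bsub>aut_group adj\<^esub> g = (inv_into UNIV g)"
proof -
  let ?h = "inv\<^bsub>aut_group adj\<^esub> g"
  have "?h \<circ> g = id"
    using group.l_inv[OF group_aut_group, of g adj] assms by (simp add: aut_group_def)
  moreover have "g \<circ> (inv_into UNIV g) = id"
    using assms by (auto simp: Aut_def fun_eq_iff bij_is_surj surj_f_inv_f)
  ultimately show ?thesis
    by (metis comp_assoc id_comp comp_id)
qed

lemma topspace_aut_topology: "topspace (aut_topology adj) = Aut adj"
  by (simp add: aut_topology_def)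

lemma openin_aut_topology_eval: "openin (aut_topology adj) {g \<in> Aut adj. g x \<in> S}"
proof -
  have "continuous_map (aut_topology adj) (discrete_topology UNIV) (\<lambda>g. g x)"
    unfolding aut_topology_def
    by (intro continuous_map_from_subtopology continuous_map_product_projection) simp
  from openin_continuous_map_preimage[OF this, of S] show ?thesis
    by (simp add: topspace_aut_topology)
qed

lemma continuous_map_into_aut_topology:
  assumes "\<And>t. t \<in> topspace X \<Longrightarrow> f t \<in> Aut adj"
    and "\<And>x y. openin X {t \<in> topspace X. f t x = y}"
  shows "continuous_map X (aut_topology adj) f"
proof -
  have "continuous_map X (discrete_topology UNIV) (\<lambda>t. f t x)" for x
  proof -
    have "openin X {t \<in> topspace X. f t x \<in> S}" for S
    proof -
      have "{t \<in> topspace X. f t x \<in> S} = \<Union>((\<lambda>y. {t \<in> topspace X. f t x = y}) ` S)"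
        by blast
      moreover have "openin X (\<Union>((\<lambda>y. {t \<in> topspace X. f t x = y}) ` S))"
        using assms(2) by (intro openin_Union) blast
      ultimately show ?thesis by simp
    qed
    then show ?thesis by (simp add: continuous_map_def)
  qed
  then show ?thesis
    using assms(1) unfolding aut_topology_def
    by (simp add: continuous_map_in_subtopology continuous_map_componentwise_UNIV image_subset_iff)
qed

lemma topological_group_aut: "topological_group (aut_group adj) (aut_topology adj)"
  unfolding topological_group_def
proof (intro conjI)
  let ?A = "aut_topology adj"
  show "group (aut_group adj)" by (rule group_aut_group)
  show "topspace ?A = carrier (aut_group adj)"
    by (simp add: topspace_aut_topology aut_group_def)
  show "continuous_map (prod_topology ?A ?A) ?A (\<lambda>(g, h). g \<otimes>\<^bsub>aut_group adj\<^esub> h)"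
  proof (rule continuous_map_into_aut_topology)
    fix t assume "t \<in> topspace (prod_topology ?A ?A)"
    then show "(case t of (g, h) \<Rightarrow> g \<otimes>\<^bsub>aut_group adj\<^esub> h) \<in> Aut adj"
      by (auto simp: topspace_aut_topology aut_group_def Aut_def intro: bij_comp)
  next
    fix x y
    have "{t \<in> topspace (prod_topology ?A ?A). (case t of (g, h) \<Rightarrow> g \<otimes>\<^bsub>aut_group adj\<^esub> h) x = y} =
        \<Union>(range (\<lambda>z. {g \<in> Aut adj. g z \<in> {y}} \<times> {h \<in> Aut adj. h x \<in> {z}}))"
      by (auto simp: topspace_aut_topology aut_group_def)
    moreover have "openin (prod_topology ?A ?A)
        (\<Union>(range (\<lambda>z. {g \<in> Aut adj. g z \<in> {y}} \<times> {h \<in> Aut adj. h x \<in> {z}})))"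
    proof (rule openin_Union, elim imageE)
      fix S z assume "S = {g \<in> Aut adj. g z \<in> {y}} \<times> {h \<in> Aut adj. h x \<in> {z}}"
      moreover have "openin (prod_topology ?A ?A) ({g \<in> Aut adj. g z \<in> {y}} \<times> {h \<in> Aut adj. h x \<in> {z}})"
        by (simp only: openin_prod_Times_iff openin_aut_topology_eval simp_thms)
      ultimately show "openin (prod_topology ?A ?A) S" by simp
    qed
    ultimately show "openin (prod_topology ?A ?A)
        {t \<in> topspace (prod_topology ?A ?A). (case t of (g, h) \<Rightarrow> g \<otimes>\<^bsub>aut_group adj\<^esub> h) x = y}"
      by simp
  qed
  show "continuous_map ?A ?A (\<lambda>g. inv\<^bsub>aut_group adj\<^esub> g)"
  proof (rule continuous_map_into_aut_topology)
    fix g assume "g \<in> topspace ?A"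
    then show "inv\<^bsub>aut_group adj\<^esub> g \<in> Aut adj"
      using group.inv_closed[OF group_aut_group, of g adj]
      by (simp add: topspace_aut_topology aut_group_def)
  next
    fix x y
    have "(inv\<^bsub>aut_group adj\<^esub> g) x = y \<longleftrightarrow> g y \<in> {x}" if "g \<in> Aut adj" for g
      using that inv_aut_group[OF that] by (auto simp: Aut_def bij_is_inj bij_is_surj surj_f_inv_f)
    then have "{g \<in> topspace ?A. (inv\<^bsub>aut_group adj\<^esub> g) x = y} = {g \<in> Aut adj. g y \<in> {x}}"
      unfolding topspace_aut_topology by blast
    then show "openin ?A {g \<in> topspace ?A. (inv\<^bsub>aut_group adj\<^esub> g) x = y}"
      using openin_aut_topology_eval[of adj y "{x}"] by simp
  qed
qed
lemma topologically_isomorphic_refl: "topologically_isomorphic G X G X"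
proof -
  have "id \<in> iso G G" by (simp add: iso_def hom_def bij_betw_def)
  moreover have "homeomorphic_map X X id" by (simp add: homeomorphic_map_id)
  ultimately show ?thesis unfolding topologically_isomorphic_def by blast
qed

lemma topologically_isomorphic_trans:
  assumes "topologically_isomorphic G X H Y" and "topologically_isomorphic H Y K Z"
  shows "topologically_isomorphic G X K Z"
proof -
  obtain f g where fg: "f \<in> iso G H" "homeomorphic_map X Y f" "g \<in> iso H K" "homeomorphic_map Y Z g"
    using assms unfolding topologically_isomorphic_def by blast
  have "g \<circ> f \<in> iso G K" using iso_set_trans[OF fg(1,3)] by (simp add: comp_def)
  moreover have "homeomorphic_map X Z (g \<circ> f)" using homeomorphic_map_compose fg by blast
  ultimately show ?thesis
    unfolding topologically_isomorphic_def by blast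
qed

lemma topologically_isomorphic_sym:
  assumes "group G" "topspace X = carrier G" and "topologically_isomorphic G X H Y"
  shows "topologically_isomorphic H Y G X"
proof -
  obtain f where f: "f \<in> iso G H" "homeomorphic_map X Y f"
    using assms(3) unfolding topologically_isomorphic_def by blast
  obtain g where g: "homeomorphic_maps X Y f g"
    using f(2) homeomorphic_map_maps by blast
  let ?h = "inv_into (carrier G) f"
  have inj: "inj_on f (carrier G)"
    using f(1) by (simp add: iso_def bij_betw_def)
  have 1: "?h \<in> iso H G"
    using group.iso_set_sym[OF assms(1) f(1)] .
  have 2: "?h y = g y" if "y \<in> topspace Y" for y
  proof -
    have "g y \<in> carrier G" "f (g y) = y"
      using g that assms(2) by (auto simp: homeomorphic_maps_def continuous_map_def)
    then show ?thesis
      using inv_into_f_f[OF inj, of "g y"] by simp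
  qed
  have "homeomorphic_map Y X g"
    using g homeomorphic_map_maps homeomorphic_maps_sym by blast
  then have "homeomorphic_map Y X ?h"
    using 2 by (subst homeomorphic_map_eq[of Y X g ?h]) auto
  with 1 show ?thesis
    unfolding topologically_isomorphic_def by blast
qed

section \<open>The Chabauty topology\<close>

definition closed_subgroups :: "('g, 'm) monoid_scheme \<Rightarrow> 'g topology \<Rightarrow> 'g set set" where
  "closed_subgroups G X = {H. subgroup H G \<and> closedin X H}"

definition chabauty_nbhd ::
  "('g, 'm) monoid_scheme \<Rightarrow> 'g topology \<Rightarrow> 'g set \<Rightarrow> 'g set \<Rightarrow> 'g set \<Rightarrow> 'g set set" where
  "chabauty_nbhd G X H K U =
     {J \<in> closed_subgroups G X. J \<inter> K \<subseteq> H <#>\<^bsub>G\<^esub> U \<and> H \<inter> K \<subseteq> J <#>\<^bsub>G\<^esub> U}"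

definition chabauty_open :: "('g, 'm) monoid_scheme \<Rightarrow> 'g topology \<Rightarrow> 'g set set \<Rightarrow> bool" where
  "chabauty_open G X \<A> \<longleftrightarrow> \<A> \<subseteq> closed_subgroups G X \<and>
     (\<forall>H\<in>\<A>. \<exists>K U. compactin X K \<and> openin X U \<and> \<one>\<^bsub>G\<^esub> \<in> U \<and> chabauty_nbhd G X H K U \<subseteq> \<A>)"

definition chabauty :: "('g, 'm) monoid_scheme \<Rightarrow> 'g topology \<Rightarrow> 'g set topology" where
  "chabauty G X = topology (chabauty_open G X)"

lemma chabauty_nbhd_mono:
  assumes "K \<subseteq> K'" and "U' \<subseteq> U"
  shows "chabauty_nbhd G X H K' U' \<subseteq> chabauty_nbhd G X H K U"
proof
  fix J assume J: "J \<in> chabauty_nbhd G X H K' U'"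
  have "J' <#>\<^bsub>G\<^esub> U' \<subseteq> J' <#>\<^bsub>G\<^esub> U" for J'
    using mono_set_mult[OF subset_refl assms(2)] .
  moreover have "J \<inter> K \<subseteq> J \<inter> K'" "H \<inter> K \<subseteq> H \<inter> K'"
    using assms(1) by auto
  ultimately show "J \<in> chabauty_nbhd G X H K U"
    using J unfolding chabauty_nbhd_def mem_Collect_eq by (meson subset_trans)
qed

lemma istopology_chabauty_open: "istopology (chabauty_open G X)"
  unfolding istopology_def
proof (intro conjI allI impI)
  fix \<A> \<B> assume A: "chabauty_open G X \<A>" and B: "chabauty_open G X \<B>"
  show "chabauty_open G X (\<A> \<inter> \<B>)"
    unfolding chabauty_open_def
  proof (intro conjI ballI)
    show "\<A> \<inter> \<B> \<subseteq> closed_subgroups G X"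
      using A unfolding chabauty_open_def by blast
    fix H assume H: "H \<in> \<A> \<inter> \<B>"
    obtain K U where 1: "compactin X K" "openin X U" "\<one>\<^bsub>G\<^esub> \<in> U" "chabauty_nbhd G X H K U \<subseteq> \<A>"
      using A H unfolding chabauty_open_def by (metis IntD1)
    obtain L V where 2: "compactin X L" "openin X V" "\<one>\<^bsub>G\<^esub> \<in> V" "chabauty_nbhd G X H L V \<subseteq> \<B>"
      using B H unfolding chabauty_open_def by (metis IntD2)
    have "chabauty_nbhd G X H (K \<union> L) (U \<inter> V) \<subseteq> \<A>"
      using 1(4) chabauty_nbhd_mono[of K "K \<union> L" "U \<inter> V" U] by (metis Un_upper1 Int_lower1 subset_trans)
    moreover have "chabauty_nbhd G X H (K \<union> L) (U \<inter> V) \<subseteq> \<B>"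
      using 2(4) chabauty_nbhd_mono[of L "K \<union> L" "U \<inter> V" V] by (metis Un_upper2 Int_lower2 subset_trans)
    moreover have "compactin X (K \<union> L)" "openin X (U \<inter> V)" "\<one>\<^bsub>G\<^esub> \<in> U \<inter> V"
      using 1 2 by (simp_all add: compactin_Un openin_Int)
    ultimately show "\<exists>K U. compactin X K \<and> openin X U \<and> \<one>\<^bsub>G\<^esub> \<in> U \<and> chabauty_nbhd G X H K U \<subseteq> \<A> \<inter> \<B>"
      by (metis Int_greatest)
  qed
next
  fix \<K> assume K: "\<forall>\<A>\<in>\<K>. chabauty_open G X \<A>"
  show "chabauty_open G X (\<Union>\<K>)"
    unfolding chabauty_open_def
  proof (intro conjI ballI)
    show "\<Union>\<K> \<subseteq> closed_subgroups G X"
      using K unfolding chabauty_open_def by blast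
    fix H assume "H \<in> \<Union>\<K>"
    then obtain \<A> where \<A>: "\<A> \<in> \<K>" "H \<in> \<A>" by (rule UnionE)
    then have "chabauty_open G X \<A>"
      using K by simp
    then obtain L U where "compactin X L" "openin X U" "\<one>\<^bsub>G\<^esub> \<in> U" "chabauty_nbhd G X H L U \<subseteq> \<A>"
      using \<A>(2) unfolding chabauty_open_def by metis
    with Union_upper[OF \<A>(1)]
    show "\<exists>K U. compactin X K \<and> openin X U \<and> \<one>\<^bsub>G\<^esub> \<in> U \<and> chabauty_nbhd G X H K U \<subseteq> \<Union>\<K>"
      by (metis subset_trans)
  qed
qed

lemma openin_chabauty: "openin (chabauty G X) = chabauty_open G X"
  unfolding chabauty_def by (rule topology_inverse'[OF istopology_chabauty_open])

lemma topspace_chabauty: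
  assumes "topological_group G X"
  shows "topspace (chabauty G X) = closed_subgroups G X"
proof
  have "monoid G" "topspace X = carrier G"
    using assms by (simp_all add: topological_group_def group.is_monoid)
  then have 1: "\<one>\<^bsub>G\<^esub> \<in> topspace X"
    by (simp add: monoid.one_closed)
  have "chabauty_nbhd G X H {} (topspace X) \<subseteq> closed_subgroups G X" for H
    by (simp add: chabauty_nbhd_def)
  then have "chabauty_open G X (closed_subgroups G X)"
    using 1 unfolding chabauty_open_def
    by (metis compactin_empty openin_topspace subset_refl)
  then show "closed_subgroups G X \<subseteq> topspace (chabauty G X)"
    by (metis openin_chabauty openin_subset)
  show "topspace (chabauty G X) \<subseteq> closed_subgroups G X"
    using openin_topspace[of "chabauty G X"]
    unfolding openin_chabauty chabauty_open_def by (rule conjunct1)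
qed

section \<open>Quotient topologies\<close>

definition quotient_open :: "'a topology \<Rightarrow> ('a \<times> 'a) set \<Rightarrow> 'a set set \<Rightarrow> bool" where
  "quotient_open X R \<U> \<longleftrightarrow>
     \<U> \<subseteq> topspace X // R \<and> openin X {x \<in> topspace X. R `` {x} \<in> \<U>}"

definition quotient_topology :: "'a topology \<Rightarrow> ('a \<times> 'a) set \<Rightarrow> 'a set topology" where
  "quotient_topology X R = topology (quotient_open X R)"

lemma istopology_quotient_open: "istopology (quotient_open X R)"
  unfolding istopology_def
proof (intro conjI allI impI)
  fix \<U> \<V> assume UV: "quotient_open X R \<U>" "quotient_open X R \<V>"
  have "{x \<in> topspace X. R `` {x} \<in> \<U> \<inter> \<V>} =
      {x \<in> topspace X. R `` {x} \<in> \<U>} \<inter> {x \<in> topspace X. R `` {x} \<in> \<V>}"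
    by blast
  moreover have "\<U> \<inter> \<V> \<subseteq> topspace X // R"
    using UV unfolding quotient_open_def by blast
  moreover have "openin X ({x \<in> topspace X. R `` {x} \<in> \<U>} \<inter> {x \<in> topspace X. R `` {x} \<in> \<V>})"
    using UV unfolding quotient_open_def by (intro openin_Int) simp_all
  ultimately show "quotient_open X R (\<U> \<inter> \<V>)"
    unfolding quotient_open_def by simp
next
  fix \<K> assume K: "\<forall>\<U>\<in>\<K>. quotient_open X R \<U>"
  have "{x \<in> topspace X. R `` {x} \<in> \<Union>\<K>} = \<Union>((\<lambda>\<U>. {x \<in> topspace X. R `` {x} \<in> \<U>}) ` \<K>)"
    by blast
  moreover have "openin X (\<Union>((\<lambda>\<U>. {x \<in> topspace X. R `` {x} \<in> \<U>}) ` \<K>))"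
    using K unfolding quotient_open_def by (intro openin_Union) blast
  moreover have "\<Union>\<K> \<subseteq> topspace X // R"
    using K unfolding quotient_open_def by blast
  ultimately show "quotient_open X R (\<Union>\<K>)"
    unfolding quotient_open_def by simp
qed

lemma openin_quotient_topology: "openin (quotient_topology X R) = quotient_open X R"
  unfolding quotient_topology_def by (rule topology_inverse'[OF istopology_quotient_open])

lemma topspace_quotient_topology: "topspace (quotient_topology X R) = topspace X // R"
proof -
  have "{x \<in> topspace X. R `` {x} \<in> topspace X // R} = topspace X"
    by (blast intro: quotientI)
  then have "quotient_open X R (topspace X // R)"
    by (simp add: quotient_open_def)
  then show ?thesis
    unfolding topspace_def[of "quotient_topology X R"] openin_quotient_topology
    by (auto simp: quotient_open_def)
qed

lemma quotient_map_quotient_topology: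
  "quotient_map X (quotient_topology X R) (\<lambda>x. R `` {x})"
proof -
  have "(\<lambda>x. R `` {x}) ` topspace X = topspace X // R"
    unfolding quotient_def by blast
  then show ?thesis
    unfolding quotient_map_def openin_quotient_topology topspace_quotient_topology quotient_open_def
    by simp
qed

section \<open>Topologically simple groups acting on a tree\<close>

definition simple_boundary_2_transitive :: "('v \<Rightarrow> 'v \<Rightarrow> bool) \<Rightarrow> ('v \<Rightarrow> 'v) set set" where
  "simple_boundary_2_transitive adj =
     {H \<in> closed_subgroups (aut_group adj) (aut_topology adj).
        topologically_simple (aut_group adj\<lparr>carrier := H\<rparr>) (subtopology (aut_topology adj) H) \<and>
        two_transitive_on_ends adj H}"

definition top_iso_rel :: "('v \<Rightarrow> 'v \<Rightarrow> bool) \<Rightarrow> (('v \<Rightarrow> 'v) set \<times> ('v \<Rightarrow> 'v) set) set" where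
  "top_iso_rel adj =
     {(H, J). H \<in> simple_boundary_2_transitive adj \<and> J \<in> simple_boundary_2_transitive adj \<and>
        topologically_isomorphic
          (aut_group adj\<lparr>carrier := H\<rparr>) (subtopology (aut_topology adj) H)
          (aut_group adj\<lparr>carrier := J\<rparr>) (subtopology (aut_topology adj) J)}"

lemma equiv_top_iso_rel: "equiv (simple_boundary_2_transitive adj) (top_iso_rel adj)"
proof (rule equivI)
  have *: "group (aut_group adj\<lparr>carrier := H\<rparr>)" 
     "topspace (subtopology (aut_topology adj) H) = carrier (aut_group adj\<lparr>carrier := H\<rparr>)"
     if "H \<in> simple_boundary_2_transitive adj" for H
  proof -
    have H: "subgroup H (aut_group adj)" "closedin (aut_topology adj) H"
      using that by (simp_all add: simple_boundary_2_transitive_def closed_subgroups_def)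
    show "group (aut_group adj\<lparr>carrier := H\<rparr>)"
      by (rule subgroup.subgroup_is_group[OF H(1) group_aut_group])
    show "topspace (subtopology (aut_topology adj) H) = carrier (aut_group adj\<lparr>carrier := H\<rparr>)"
      using closedin_subset[OF H(2)] by (simp add: Int_absorb1)
  qed
  show "top_iso_rel adj \<subseteq> simple_boundary_2_transitive adj \<times> simple_boundary_2_transitive adj"
    by (simp add: top_iso_rel_def subset_iff)
  show "refl_on (simple_boundary_2_transitive adj) (top_iso_rel adj)"
    by (simp add: refl_on_def top_iso_rel_def topologically_isomorphic_refl)
  show "sym (top_iso_rel adj)"
    unfolding sym_def top_iso_rel_def mem_Collect_eq prod.case
    by (metis topologically_isomorphic_sym *)
  show "trans (top_iso_rel adj)"
    unfolding trans_def top_iso_rel_def mem_Collect_eq prod.case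
    by (metis topologically_isomorphic_trans)
qed

definition simple_boundary_2_transitive_topology ::
  "('v \<Rightarrow> 'v \<Rightarrow> bool) \<Rightarrow> ('v \<Rightarrow> 'v) set topology" where
  "simple_boundary_2_transitive_topology adj =
     subtopology (chabauty (aut_group adj) (aut_topology adj)) (simple_boundary_2_transitive adj)"

definition iso_class_topology :: "('v \<Rightarrow> 'v \<Rightarrow> bool) \<Rightarrow> ('v \<Rightarrow> 'v) set set topology" where
  "iso_class_topology adj =
     quotient_topology (simple_boundary_2_transitive_topology adj) (top_iso_rel adj)"

lemma topspace_simple_boundary_2_transitive_topology:
  "topspace (simple_boundary_2_transitive_topology adj) = simple_boundary_2_transitive adj"
  unfolding simple_boundary_2_transitive_topology_def topspace_subtopology
    topspace_chabauty[OF topological_group_aut]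
  by (auto simp: simple_boundary_2_transitive_def)

lemma topspace_iso_class_topology:
  "topspace (iso_class_topology adj) = simple_boundary_2_transitive adj // top_iso_rel adj"
  unfolding iso_class_topology_def topspace_quotient_topology
    topspace_simple_boundary_2_transitive_topology ..

text \<open>
  Actions of an abstract topological group on the tree by automorphisms. Continuity and
  properness refer to the discrete vertex set; properness means that the map
  \<open>(g, v) \<mapsto> (v, g v)\<close> is proper.
\<close>

definition acts_continuously_properly ::
  "('v \<Rightarrow> 'v \<Rightarrow> bool) \<Rightarrow> ('g, 'm) monoid_scheme \<Rightarrow> 'g topology \<Rightarrow> ('g \<Rightarrow> 'v \<Rightarrow> 'v) \<Rightarrow> bool" where
  "acts_continuously_properly adj G X \<phi> \<longleftrightarrow> \<phi> \<in> hom G (aut_group adj) \<and>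
     continuous_map (prod_topology X (discrete_topology UNIV)) (discrete_topology UNIV)
       (\<lambda>(g, v). \<phi> g v) \<and>
     proper_map (prod_topology X (discrete_topology UNIV))
       (prod_topology (discrete_topology UNIV) (discrete_topology UNIV))
       (\<lambda>(g, v). (v, \<phi> g v))"

end

theory Submission
  imports Defs
begin

text \<open>
  A closed group \<open>H\<close> is 2-transitive on the ends iff each vertex stabiliser \<open>H\<^sub>v\<close> is transitive on
  the spheres around \<open>v\<close>: by 2-transitivity some \<open>h\<close> fixes an end \<open>\<zeta>\<close> and maps \<open>\<xi>\<close> to \<open>\<eta>\<close>; if it
  translates along \<open>\<zeta>\<close>, it has a second fixed end, so that a conjugate of \<open>h\<close> with axis from \<open>\<zeta>\<close> to
  \<open>\<eta>\<close> corrects the translation, and the corrected element fixes the branching point.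

  A nontrivial closed normal subgroup \<open>N\<close> of such an \<open>H\<close> is cocompact. If \<open>N\<close> is proper, it is
  therefore contained in a proper open normal subgroup \<open>M\<close>, and \<open>H/M\<close> is determined by the action
  of two adjacent vertex stabilisers on a ball. Since a group \<open>J\<close> that is Chabauty close to \<open>H\<close> is
  the amalgam of its stabilisers, which act on that ball as those of \<open>H\<close> do, \<open>J\<close> inherits the
  quotient \<open>H/M\<close> and is not simple. Hence limits of simple groups are simple.

  A topological isomorphism between two of the simple groups permutes the maximal compact subgroups,
  which are the vertex stabilisers, and so is induced by an automorphism of the tree. That automorphism
  may be chosen in a fixed compact set, so the isomorphism relation is the orbit relation of a compact
  family of homeomorphisms, and the quotient map is closed.
\<close>

section \<open>The metric of a tree\<close>

text \<open>Failure of simplicity must be certified by finitely many finite partial maps, because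
  only such data pass from \<open>H\<close> to a nearby \<open>J\<close>
  (\<open>openin_Chab_iff\<close>). A closed normal subgroup \<open>N\<close> is not given by such
  data. It is replaced by \<open>M = N U\<close> with \<open>U\<close> the pointwise stabiliser of a
  ball about \<open>y\<close>: cocompactness in the form \<open>H = N H_y\<close> makes
  \<open>M\<close> normal, since \<open>H_y\<close> normalises \<open>U\<close>, and closedness of
  \<open>N\<close> keeps \<open>M\<close> proper once the ball is large. The amalgam is never built
  as a group. In place of a homomorphism from \<open>J\<close> to \<open>H/M\<close> the proof
  carries the relation \<open>\<Gamma>\<close>: that it is total on \<open>J\<close> says that two
  adjacent stabilisers generate \<open>J\<close>, and that it is single-valued modulo
  \<open>M\<close> is the ping-pong argument. Generation fails for groups that exchange the two
  classes of the bipartition. Simplicity excludes them (\<open>C_even\<close>): the type-preserving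
  elements form a nontrivial closed normal subgroup. The same parity makes compact subgroups fix a
  vertex instead of inverting an edge, so vertex stabilisers are recognised by an
  isomorphism.\<close>

definition gdist :: "('v \<Rightarrow> 'v \<Rightarrow> bool) \<Rightarrow> 'v \<Rightarrow> 'v \<Rightarrow> nat" where
  "gdist adj x y = (LEAST n. (adj ^^ n) x y)"

locale tree_graph =
  fixes adj :: "'v \<Rightarrow> 'v \<Rightarrow> bool"
  assumes tree: "tree adj"
begin

abbreviation d :: "'v \<Rightarrow> 'v \<Rightarrow> nat" where "d \<equiv> gdist adj"

abbreviation finv :: "('v \<Rightarrow> 'v) \<Rightarrow> 'v \<Rightarrow> 'v" where "finv \<equiv> inv_into UNIV"

abbreviation AutT :: "('v \<Rightarrow> 'v) topology" where "AutT \<equiv> aut_topology adj"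

lemma adj_sym: "adj x y \<Longrightarrow> adj y x"
  using tree by (auto simp: tree_def simple_graph_def symp_def)

lemma adj_irrefl: "\<not> adj x x"
  using tree by (auto simp: tree_def simple_graph_def irreflp_def)

lemma no_cycle: "\<not> graph_cycle adj c"
  using tree by (auto simp: tree_def)

lemma walk_ex: "\<exists>n. (adj ^^ n) x y"
  using tree by (auto simp: tree_def connected_graph_def rtranclp_power)

lemma dist_walk: "(adj ^^ d x y) x y"
  unfolding gdist_def using walk_ex by (rule LeastI_ex)

lemma dist_le: "(adj ^^ n) x y \<Longrightarrow> d x y \<le> n"
  unfolding gdist_def by (rule Least_le)

lemma walk_sym: "(adj ^^ n) x y \<Longrightarrow> (adj ^^ n) y x"
proof (induction n arbitrary: y)
  case (Suc n)
  then obtain z where "(adj ^^ n) x z" "adj z y" by auto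
  then have "(adj ^^ n) z x" "adj y z" using Suc.IH adj_sym by auto
  then show ?case by (metis relpowp_Suc_I2)
qed simp

lemma dist_sym: "d x y = d y x"
  by (meson dist_le dist_walk walk_sym le_antisym)

lemma dist_triangle: "d x z \<le> d x y + d y z"
proof -
  have "(adj ^^ (d x y + d y z)) x z"
    unfolding relpowp_add using dist_walk by blast
  then show ?thesis by (rule dist_le)
qed

lemma dist_self [simp]: "d x x = 0"
  using dist_le[of 0 x x] by simp

lemma dist_eq_0 [simp]: "d x y = 0 \<longleftrightarrow> x = y"
  using dist_walk[of x y] by auto

lemma dist_eq_1: "d x y = 1 \<longleftrightarrow> adj x y"
proof
  assume "d x y = 1"
  then show "adj x y" using dist_walk[of x y] by (simp add: relcompp_apply)
next
  assume a: "adj x y"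
  then have "d x y \<le> 1" by (intro dist_le) auto
  moreover have "d x y \<noteq> 0" using a adj_irrefl by auto
  ultimately show "d x y = 1" by linarith
qed

lemma dist_adj_le: "adj y z \<Longrightarrow> d x z \<le> Suc (d x y)"
  using dist_triangle[of x z y] dist_eq_1[of y z] by simp

lemma parent_ex:
  assumes "x \<noteq> v"
  shows "\<exists>p. adj p v \<and> d x v = Suc (d x p)"
proof -
  obtain n where n: "d x v = Suc n" using assms by (metis dist_eq_0 not0_implies_Suc)
  then obtain p where p: "(adj ^^ n) x p" "adj p v" using dist_walk[of x v] by auto
  then have "d x p \<le> n" using dist_le by blast
  then show ?thesis using p n dist_adj_le[of p v x] by auto
qed

text \<open>Descend from both vertices towards \<open>x\<close> until the parents coincide. The two
  vertices added at each stage lie on a higher level than the path between their parents, so the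
  path stays simple. Closing it by an edge or by a vertex further out gives the forbidden cycles
  below.\<close>

lemma level_path:
  assumes "d x y = n" "d x z = n" "y \<noteq> z"
  shows "\<exists>P. distinct P \<and> successively adj P \<and> P \<noteq> [] \<and> hd P = y \<and> last P = z \<and> 3 \<le> length P
    \<and> (\<forall>w\<in>set P. d x w \<le> n)"
  using assms
proof (induction n arbitrary: y z)
  case 0
  then show ?case by simp
next
  case (Suc n)
  then have ne: "x \<noteq> y" "x \<noteq> z" by auto
  obtain p where p: "adj p y" "d x y = Suc (d x p)" using parent_ex[OF ne(1)] by blast
  obtain q where q: "adj q z" "d x z = Suc (d x q)" using parent_ex[OF ne(2)] by blast
  have pn: "d x p = n" "d x q = n" using p q Suc.prems by auto
  show ?case
  proof (cases "p = q")
    case True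
    have "distinct [y, p, z]" using pn True Suc.prems by auto
    moreover have "successively adj [y, p, z]" using p q True adj_sym by auto
    ultimately show ?thesis using Suc.prems pn by (intro exI[of _ "[y, p, z]"]) auto
  next
    case False
    then obtain P where P: "distinct P" "successively adj P" "P \<noteq> []" "hd P = p" "last P = q"
        "3 \<le> length P" "\<forall>w\<in>set P. d x w \<le> n"
      using Suc.IH[OF pn] by blast
    have "y \<notin> set P" "z \<notin> set P" using P(7) Suc.prems by auto
    moreover have "successively adj (y # P @ [z])"
      using P p(1) adj_sym[OF p(1)] q(1) by (auto simp: successively_append_iff successively_Cons)
    ultimately show ?thesis using P Suc.prems
      by (intro exI[of _ "y # P @ [z]"]) (auto simp: le_Suc_eq)
  qed
qed

text \<open>An edge inside a level would close the path of \<open>level_path\<close> to a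
  cycle.\<close>

lemma dist_adj_neq: 
  assumes "adj y z" shows "d x y \<noteq> d x z"
proof
  assume e: "d x y = d x z"
  have "y \<noteq> z" using assms adj_irrefl by auto
  then obtain P where "distinct P" "successively adj P" "hd P = y" "last P = z" "3 \<le> length P"
    using level_path[OF e refl] by blast
  then have "graph_cycle adj P" using assms adj_sym by (auto simp: graph_cycle_def)
  then show False using no_cycle by blast
qed

lemma dist_adj_cases:
  assumes "adj y z"
  obtains "d x z = Suc (d x y)" | "d x y = Suc (d x z)"
  using dist_adj_le[OF assms, of x] dist_adj_le[OF adj_sym[OF assms], of x] dist_adj_neq[OF assms, of x]
  by linarith

text \<open>Two parents would be joined by a path on lower levels than \<open>v\<close>, which
  \<open>v\<close> closes to a cycle.\<close>

lemma parent_unique: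
  assumes "adj p v" "adj q v" "d x v = Suc (d x p)" "d x v = Suc (d x q)"
  shows "p = q"
proof (rule ccontr)
  assume "p \<noteq> q"
  moreover have "d x p = d x q" using assms by simp
  ultimately obtain P where P: "distinct P" "successively adj P" "P \<noteq> []" "hd P = p" "last P = q"
      "3 \<le> length P" "\<forall>w\<in>set P. d x w \<le> d x q"
    using level_path[of x p "d x q" q] by auto
  have "v \<notin> set P" using P(7) assms by auto
  then have "graph_cycle adj (v # P)"
    using P assms adj_sym by (cases P) (auto simp: graph_cycle_def successively_Cons)
  then show False using no_cycle by blast
qed

text \<open>A path without backtracking is geodesic: the edge from \<open>z\<close> to
  \<open>a\<close> leads away from \<open>f\<close>, and the next step towards \<open>c\<close>
  could approach \<open>f\<close> only by returning to \<open>z\<close>, the unique parent of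
  \<open>a\<close> as seen from \<open>f\<close>.\<close>

lemma dist_beyond:
  assumes "adj z a" "d f a = Suc (d f z)" "d z c = Suc (d a c)"
  shows "d f c = d f z + d z c"
  using assms
proof (induction "d a c" arbitrary: z a)
  case 0
  then show ?case by simp
next
  case (Suc n)
  then have "a \<noteq> c" by auto
  then obtain b where b: "adj b a" "d c a = Suc (d c b)" using parent_ex[of c a] by blast
  have zb: "z \<noteq> b"
    using Suc.prems(3) b dist_sym by (metis n_not_Suc_n Suc_inject n_not_Suc_n dist_sym less_irrefl Suc_n_not_le_n le_Suc_eq)
  have "d f b = Suc (d f a)"
    using dist_adj_cases[OF b(1)] parent_unique[OF Suc.prems(1) b(1)] zb Suc.prems(2) by metis
  moreover have "adj a b" using b adj_sym by blast
  moreover have "d a c = Suc (d b c)" using b dist_sym by metis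
  ultimately have "d f c = d f a + d a c" using Suc.hyps by (metis Suc_inject)
  then show ?case using Suc.prems by simp
qed

text \<open>Uniqueness of geodesics, by induction from the far end: the successors of
  \<open>z\<close> and \<open>z'\<close> towards \<open>y\<close> agree, and both vertices are the
  parent of that successor as seen from \<open>x\<close>.\<close>

lemma between_unique:
  assumes "d x z + d z y = d x y" "d x z' + d z' y = d x y" "d x z = d x z'"
  shows "z = z'"
  using assms
proof (induction "d z y" arbitrary: z z')
  case 0
  then show ?case by simp
next
  case (Suc n)
  then have n': "d z' y = Suc n" by simp
  have "y \<noteq> z" "y \<noteq> z'" using Suc.hyps n' by auto
  then obtain p p' where p: "adj p z" "d y z = Suc (d y p)" and p': "adj p' z'" "d y z' = Suc (d y p')"
    using parent_ex by metis
  have py: "d p y = n" "d p' y = n" using p p' Suc.hyps n' by (simp_all add: dist_sym)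
  have 1: "d x p = Suc (d x z)"
    using dist_adj_cases[OF p(1)] dist_triangle[of x y p] py Suc.prems Suc.hyps by (metis add_Suc_right add_Suc add_le_cancel_right not_less_eq_eq order_refl le_SucI)
  have 2: "d x p' = Suc (d x z')"
    using dist_adj_cases[OF p'(1)] dist_triangle[of x y p'] py Suc.prems n' by (metis add_Suc_right add_Suc add_le_cancel_right not_less_eq_eq order_refl le_SucI)
  have "p = p'"
    using Suc.hyps(1)[of p p'] py 1 2 Suc.prems Suc.hyps(2) n' by simp
  then show ?case using parent_unique[of z p z' x] p p' 1 2 adj_sym by auto
qed

lemma geodesic_ex:
  "\<exists>p. p 0 = x \<and> p (d x y) = y \<and> (\<forall>i<d x y. adj (p i) (p (Suc i))) \<and> (\<forall>i\<le>d x y. d x (p i) = i \<and> d (p i) y = d x y - i)"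
proof -
  obtain p where p: "p 0 = x" "p (d x y) = y" "\<forall>i<d x y. adj (p i) (p (Suc i))"
    using dist_walk[of x y] unfolding relpowp_fun_conv by blast
  have 1: "d x (p i) \<le> i" if "i \<le> d x y" for i
    using that
  proof (induction i)
    case (Suc i)
    then show ?case using dist_adj_le[of "p i" "p (Suc i)" x] p(3) by fastforce
  qed (simp add: p)
  have 2: "d (p (d x y - i)) y \<le> i" if "i \<le> d x y" for i
    using that
  proof (induction i)
    case 0 then show ?case by (simp add: p)
  next
    case (Suc i)
    have "adj (p (d x y - Suc i)) (p (Suc (d x y - Suc i)))" using p(3) Suc.prems by auto
    moreover have "Suc (d x y - Suc i) = d x y - i" using Suc.prems by simp
    ultimately show ?case using dist_adj_le[of "p (d x y - i)" "p (d x y - Suc i)" y] Suc adj_sym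
      by (fastforce simp: dist_sym)
  qed
  have "d x (p i) = i \<and> d (p i) y = d x y - i" if i: "i \<le> d x y" for i
    using 1[OF i] 2[of "d x y - i"] i dist_triangle[of x y "p i"] by auto
  then show ?thesis using p by blast
qed

lemma between_ex: "i \<le> d x y \<Longrightarrow> \<exists>z. d x z = i \<and> d z y = d x y - i"
  using geodesic_ex[of x y] by blast

lemma Aut_dist:
  assumes "g \<in> Aut adj" shows "d (g x) (g y) = d x y"
proof -
  have *: "(adj ^^ n) (g x) (g y)" if "g \<in> Aut adj" "(adj ^^ n) x y" for g n x y
    using that(2)
  proof (induction n arbitrary: y)
    case (Suc n)
    then obtain z where "(adj ^^ n) x z" "adj z y" by auto
    then show ?case using Suc.IH[of z] that(1) by (auto simp: Aut_def)
  qed simp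
  have "finv g \<in> Aut adj"
    using group.inv_closed[OF group_aut_group, of g adj] inv_aut_group[OF assms] assms by (simp add: aut_group_def)
  moreover have "finv g (g x) = x" for x using assms by (simp add: Aut_def bij_is_inj)
  ultimately have "d x y \<le> d (g x) (g y)"
    using *[of "finv g" "d (g x) (g y)" "g x" "g y"] dist_walk by (simp add: dist_le)
  moreover have "d (g x) (g y) \<le> d x y"
    using *[OF assms dist_walk] by (rule dist_le)
  ultimately show ?thesis by simp
qed

text \<open>Bipartiteness: each edge changes the distance to a fixed vertex by exactly one.\<close>

lemma dist_parity: "even (d x y + d y z) \<longleftrightarrow> even (d x z)"
proof (induction "d y z" arbitrary: z)
  case 0 then show ?case by simp
next
  case (Suc n)
  then have "y \<noteq> z" by auto
  then obtain p where p: "adj p z" "d y z = Suc (d y p)" using parent_ex by blast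
  then have "even (d x y + d y p) \<longleftrightarrow> even (d x p)" using Suc.hyps by simp
  then show ?case using p(2) dist_adj_cases[OF p(1), of x] by (metis add_Suc_right even_Suc)
qed

section \<open>Rays, ends and thickness\<close>

lemma ray_adj: "r \<in> rays adj \<Longrightarrow> adj (r n) (r (Suc n))"
  by (simp add: rays_def)

lemma ray_eqD: "r \<in> rays adj \<Longrightarrow> r i = r j \<Longrightarrow> i = j"
  by (simp add: rays_def inj_def)

text \<open>A step towards \<open>r m\<close> would lead back to the preceding vertex by
  \<open>parent_unique\<close>, against injectivity of the ray.\<close>

lemma ray_dist_add:
  assumes "r \<in> rays adj"
  shows "d (r m) (r (m + k)) = k"
proof (induction k rule: less_induct)
  case (less k)
  show ?case
  proof (cases k)
    case (Suc l)
    have l: "d (r m) (r (m + l)) = l" using less Suc by simp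
    have a: "adj (r (m + l)) (r (m + k))" using ray_adj[OF assms] Suc by simp
    then show ?thesis
    proof (cases rule: dist_adj_cases[where x = "r m"])
      case 2
      then have l0: "l \<noteq> 0" using l by auto
      then have "d (r m) (r (m + (l - 1))) = l - 1" "adj (r (m + (l - 1))) (r (m + l))"
        using less[of "l - 1"] Suc ray_adj[OF assms, of "m + (l - 1)"] l0 by auto
      then have "r (m + (l - 1)) = r (m + k)"
        using parent_unique[of "r (m + (l - 1))" "r (m + l)" "r (m + k)" "r m"] a adj_sym 2 l l0 by auto
      then show ?thesis using ray_eqD[OF assms] Suc by fastforce
    qed (use l Suc in simp)
  qed simp
qed

lemma ray_dist: "r \<in> rays adj \<Longrightarrow> i \<le> j \<Longrightarrow> d (r i) (r j) = j - i"
  using ray_dist_add[of r i "j - i"] by simp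

lemma ray_shift: "r \<in> rays adj \<Longrightarrow> (\<lambda>k. r (m + k)) \<in> rays adj"
  by (auto simp: rays_def inj_def) (metis add_left_cancel)

lemma rayI_dist:
  assumes "\<And>n. adj (r n) (r (Suc n))" "\<And>n. d v (r n) = m + n"
  shows "r \<in> rays adj"
  using assms by (auto simp: rays_def inj_def) (metis add_left_cancel)

text \<open>A bi-infinite geodesic, cut at a base vertex into two rays that leave it along different
  edges.\<close>

definition line :: "(nat \<Rightarrow> 'v) \<Rightarrow> (nat \<Rightarrow> 'v) \<Rightarrow> bool" where
  "line r s \<longleftrightarrow> r \<in> rays adj \<and> s \<in> rays adj \<and> r 0 = s 0 \<and> r 1 \<noteq> s 1"

lemma line_dist:
  assumes "line r s"
  shows "d (r i) (s j) = i + j"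
proof (cases j)
  case 0
  then show ?thesis using assms ray_dist[of r 0 i] by (simp add: line_def dist_sym)
next
  case (Suc k)
  have r: "r \<in> rays adj" and s: "s \<in> rays adj" and 0: "r 0 = s 0" and 1: "r 1 \<noteq> s 1"
    using assms by (auto simp: line_def)
  have a: "adj (s 0) (s 1)" using ray_adj[OF s, of 0] by simp
  have i0: "d (r i) (s 0) = i" using ray_dist[OF r, of 0 i] 0 by (simp add: dist_sym)
  have "d (r i) (s 1) = Suc (d (r i) (s 0))"
    using a
  proof (cases rule: dist_adj_cases[where x = "r i"])
    case 2
    then have "i \<noteq> 0" using i0 by auto
    then have "d (r i) (r 0) = Suc (d (r i) (r 1))"
      using ray_dist[OF r, of 0 i] ray_dist[OF r, of 1 i] by (simp add: dist_sym)
    then have "r 1 = s 1"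
      using 2 parent_unique[of "r 1" "r 0" "s 1" "r i"] ray_adj[OF r, of 0] a adj_sym 0 by auto
    then show ?thesis using 1 by simp
  qed simp
  then have "d (r i) (s j) = d (r i) (s 0) + d (s 0) (s j)"
    by (rule dist_beyond[OF a]) (use ray_dist[OF s, of 0 j] ray_dist[OF s, of 1 j] Suc in simp)
  then show ?thesis using i0 ray_dist[OF s, of 0 j] by simp
qed

section \<open>Ends as classes of cofinal rays\<close>

lemma cofinal_equiv: "equiv (rays adj) (cofinal_rays adj)"
proof (rule equivI)
  show "cofinal_rays adj \<subseteq> rays adj \<times> rays adj" by (auto simp: cofinal_rays_def)
  show "refl_on (rays adj) (cofinal_rays adj)" by (auto simp: refl_on_def cofinal_rays_def)
  show "sym (cofinal_rays adj)"
    unfolding sym_def cofinal_rays_def by (auto, metis)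
  show "trans (cofinal_rays adj)"
    unfolding trans_def cofinal_rays_def
  proof (clarsimp)
    fix r s t :: "nat \<Rightarrow> 'v" and m n m' n' :: nat
    assume 1: "\<forall>k. r (m + k) = s (n + k)" and 2: "\<forall>k. s (m' + k) = t (n' + k)"
    have "r ((m + m') + k) = t ((n + n') + k)" for k
    proof -
      have e: "m + m' + k = m + (m' + k)" "n + (m' + k) = m' + (n + k)" "n' + (n + k) = n + n' + k" by simp_all
      have "r (m + m' + k) = s (n + (m' + k))" unfolding e(1) by (rule 1[rule_format])
      also have "\<dots> = t (n' + (n + k))" unfolding e(2) by (rule 2[rule_format])
      finally show ?thesis unfolding e(3) .
    qed
    then show "\<exists>m n. \<forall>k. r (m + k) = t (n + k)" by blast
  qed
qed

abbreviation end_of :: "(nat \<Rightarrow> 'v) \<Rightarrow> (nat \<Rightarrow> 'v) set" where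
  "end_of r \<equiv> cofinal_rays adj `` {r}"

lemma end_of_in: "r \<in> rays adj \<Longrightarrow> end_of r \<in> ends adj"
  unfolding ends_def by (rule quotientI)

lemma endE:
  assumes "\<xi> \<in> ends adj" obtains r where "r \<in> rays adj" "\<xi> = end_of r"
  using assms unfolding ends_def by (auto elim: quotientE)

lemma end_of_eq_iff:
  "r \<in> rays adj \<Longrightarrow> s \<in> rays adj \<Longrightarrow> end_of r = end_of s \<longleftrightarrow> (\<exists>m n. \<forall>k. r (m + k) = s (n + k))"
  using eq_equiv_class_iff[OF cofinal_equiv, of r s] by (auto simp: cofinal_rays_def)

lemma Aut_inv: "g \<in> Aut adj \<Longrightarrow> finv g \<in> Aut adj"
  using group.inv_closed[OF group_aut_group, of g adj] inv_aut_group[of g adj] by (simp add: aut_group_def)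

lemma Aut_comp: "g \<in> Aut adj \<Longrightarrow> h \<in> Aut adj \<Longrightarrow> g \<circ> h \<in> Aut adj"
  by (auto simp: Aut_def intro: bij_comp)

lemma Aut_id: "id \<in> Aut adj" "(\<lambda>x. x) \<in> Aut adj"
  by (auto simp: Aut_def bij_def)

lemma Aut_inv_f [simp]: "g \<in> Aut adj \<Longrightarrow> finv g (g x) = x"
  by (simp add: Aut_def bij_is_inj)

lemma Aut_f_inv [simp]: "g \<in> Aut adj \<Longrightarrow> g (finv g x) = x"
  by (simp add: Aut_def bij_is_surj surj_f_inv_f)

lemma Aut_eq_iff [simp]: "g \<in> Aut adj \<Longrightarrow> g x = g y \<longleftrightarrow> x = y"
  by (auto simp: Aut_def bij_def inj_def)

lemma Aut_adj [simp]: "g \<in> Aut adj \<Longrightarrow> adj (g x) (g y) \<longleftrightarrow> adj x y"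
  by (auto simp: Aut_def)

lemma Aut_inv_eq: "g \<in> Aut adj \<Longrightarrow> g x = y \<longleftrightarrow> finv g y = x"
  by auto

lemma Aut_ray: "g \<in> Aut adj \<Longrightarrow> r \<in> rays adj \<Longrightarrow> g \<circ> r \<in> rays adj"
  by (auto simp: rays_def inj_def)

lemma end_act_end_of:
  assumes g: "g \<in> Aut adj" and r: "r \<in> rays adj"
  shows "end_act g (end_of r) = end_of (g \<circ> r)"
proof
  show "end_act g (end_of r) \<subseteq> end_of (g \<circ> r)"
  proof
    fix t assume "t \<in> end_act g (end_of r)"
    then obtain s where s: "s \<in> rays adj" "t = g \<circ> s" "(r, s) \<in> cofinal_rays adj"
      by (auto simp: end_act_def cofinal_rays_def)
    then obtain m n where "\<And>k. r (m + k) = s (n + k)" by (auto simp: cofinal_rays_def)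
    then have "\<forall>k. (g \<circ> r) (m + k) = t (n + k)" using s by simp
    then show "t \<in> end_of (g \<circ> r)" using s Aut_ray[OF g] r unfolding cofinal_rays_def by blast
  qed
  show "end_of (g \<circ> r) \<subseteq> end_act g (end_of r)"
  proof
    fix s assume s: "s \<in> end_of (g \<circ> r)"
    let ?t = "finv g \<circ> s"
    have "s \<in> rays adj" using s by (auto simp: cofinal_rays_def)
    then have "?t \<in> rays adj" using Aut_ray[OF Aut_inv[OF g]] by blast
    moreover have "s = g \<circ> ?t" using g by (auto simp: fun_eq_iff)
    moreover have "\<exists>m n. \<forall>k. r (m + k) = ?t (n + k)"
    proof -
      obtain m n where "\<forall>k. g (r (m + k)) = s (n + k)" using s by (auto simp: cofinal_rays_def)
      then show ?thesis using g by (metis Aut_inv_f comp_apply)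
    qed
    ultimately show "s \<in> end_act g (end_of r)"
      using r by (auto simp: end_act_def cofinal_rays_def)
  qed
qed

lemma line_ends_neq:
  assumes "line r s" shows "end_of r \<noteq> end_of s"
proof
  assume "end_of r = end_of s"
  then obtain m n where *: "\<And>k. r (m + k) = s (n + k)"
    using assms end_of_eq_iff by (auto simp: line_def)
  have "d (r (m + 1)) (s (n + 1)) = 0" unfolding * by simp
  then show False using line_dist[OF assms, of "m + 1" "n + 1"] by simp
qed

text \<open>The distance to \<open>v\<close> cannot decrease forever, and after the first increase
  \<open>dist_beyond\<close> makes every later step an increase.\<close>

lemma eventually_away:
  assumes "r \<in> rays adj"
  shows "\<exists>N. \<forall>k. d v (r (N + k)) = d v (r N) + k"
proof -
  have *: "\<forall>k. d v (r (N + k)) = d v (r N) + k" if N: "d v (r (Suc N)) = Suc (d v (r N))" for N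
  proof
    fix k show "d v (r (N + k)) = d v (r N) + k"
    proof (cases k)
      case (Suc l)
      have "d v (r (N + k)) = d v (r N) + d (r N) (r (N + k))"
        using N ray_dist[OF assms, of N "N + k"] ray_dist[OF assms, of "Suc N" "N + k"] Suc
        by (intro dist_beyond[OF ray_adj[OF assms]]) auto
      then show ?thesis using ray_dist[OF assms, of N "N + k"] by simp
    qed simp
  qed
  have "\<exists>N. d v (r (Suc N)) = Suc (d v (r N))"
  proof (rule ccontr)
    assume "\<not> ?thesis"
    then have dec: "d v (r N) = Suc (d v (r (Suc N)))" for N
      using dist_adj_cases[OF ray_adj[OF assms]] by metis
    have "d v (r N) + N = d v (r 0)" for N
    proof (induction N)
      case (Suc N) then show ?case using dec[of N] by linarith
    qed simp
    from this[of "Suc (d v (r 0))"] show False by simp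
  qed
  then show ?thesis using * by blast
qed

text \<open>The geodesic from \<open>v\<close> to a vertex \<open>r N\<close>, from which the ray
  only moves away from \<open>v\<close>, is continued by the tail of \<open>r\<close>; growing
  distance from \<open>v\<close> makes the result a ray.\<close>

lemma ray_from:
  assumes r: "r \<in> rays adj"
  shows "\<exists>s\<in>rays adj. s 0 = v \<and> end_of s = end_of r"
proof -
  obtain N where N: "\<And>k. d v (r (N + k)) = d v (r N) + k" using eventually_away[OF r] by blast
  define D where "D = d v (r N)"
  obtain p where p: "p 0 = v" "p D = r N" "\<forall>i<D. adj (p i) (p (Suc i))" "\<forall>i\<le>D. d v (p i) = i"
    using geodesic_ex[of v "r N"] unfolding D_def by auto
  define s where "s i = (if i \<le> D then p i else r (N + (i - D)))" for i
  have s': "s (D + k) = r (N + k)" for k by (cases k) (auto simp: s_def p)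
  have "s \<in> rays adj"
  proof (rule rayI_dist[where v = v and m = 0])
    fix n
    show "adj (s n) (s (Suc n))"
    proof (cases "n < D")
      case True then show ?thesis using p by (simp add: s_def)
    next
      case False
      then show ?thesis using s'[of "n - D"] s'[of "Suc n - D"] ray_adj[OF r, of "N + (n - D)"]
        by (simp add: Suc_diff_le)
    qed
    show "d v (s n) = 0 + n"
    proof (cases "n < D")
      case True then show ?thesis using p by (simp add: s_def)
    next
      case False then show ?thesis using s'[of "n - D"] N[of "n - D"] by (simp add: D_def)
    qed
  qed
  moreover have "s 0 = v" using p by (simp add: s_def)
  moreover have "end_of s = end_of r"
    unfolding end_of_eq_iff[OF \<open>s \<in> rays adj\<close> r] using s' by blast
  ultimately show ?thesis by blast
qed

lemma line_ex:
  assumes "\<xi> \<in> ends adj" "\<eta> \<in> ends adj" "\<xi> \<noteq> \<eta>"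
  shows "\<exists>r s. line r s \<and> end_of r = \<xi> \<and> end_of s = \<eta>"
proof -
  obtain r where r: "r \<in> rays adj" "\<xi> = end_of r" using assms(1) by (rule endE)
  obtain s' where s': "s' \<in> rays adj" "\<eta> = end_of s'" using assms(2) by (rule endE)
  obtain s where s: "s \<in> rays adj" "s 0 = r 0" "end_of s = \<eta>" using ray_from[OF s'(1)] s'(2) by metis
  have "\<exists>n. r n \<noteq> s n"
  proof (rule ccontr)
    assume "\<not> ?thesis" then have "r = s" by auto
    then show False using r s assms(3) by simp
  qed
  \<comment> \<open>The rays start together and separate first at index \<open>n\<close>, so the
    line joining the two ends is based at index \<open>n - 1\<close>.\<close>
  then obtain n where n: "r n \<noteq> s n" "\<And>m. m < n \<Longrightarrow> r m = s m"
    unfolding exists_least_iff[of "\<lambda>n. r n \<noteq> s n"] by blast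
  have n0: "n \<noteq> 0" using n(1) s(2) by (intro notI) simp
  let ?r = "\<lambda>k. r (n - 1 + k)" and ?s = "\<lambda>k. s (n - 1 + k)"
  have "?r 0 = ?s 0" "?r 1 \<noteq> ?s 1" using n(1) n(2)[of "n - 1"] n0 by simp_all
  then have "line ?r ?s" using ray_shift[OF r(1)] ray_shift[OF s(1)] unfolding line_def by blast
  moreover have "end_of ?r = end_of r"
    unfolding end_of_eq_iff[OF ray_shift[OF r(1)] r(1)] by (rule exI[of _ 0], rule exI[of _ "n - 1"]) simp
  moreover have "end_of ?s = end_of s"
    unfolding end_of_eq_iff[OF ray_shift[OF s(1)] s(1)] by (rule exI[of _ 0], rule exI[of _ "n - 1"]) simp
  ultimately show ?thesis using r s by metis
qed

text \<open>Slides the base vertex by one edge without changing the ends. This is how the parity of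
  the base vertex is corrected later.\<close>

lemma line_rebase:
  assumes "line r s"
  shows "line (\<lambda>k. r (Suc k)) (\<lambda>k. if k = 0 then r 1 else s (k - 1))"
    and "end_of (\<lambda>k. r (Suc k)) = end_of r"
    and "end_of (\<lambda>k. if k = 0 then r 1 else s (k - 1)) = end_of s"
proof -
  let ?r = "\<lambda>k. r (Suc k)" and ?s = "\<lambda>k. if k = 0 then r 1 else s (k - 1)"
  have r: "r \<in> rays adj" and s: "s \<in> rays adj" and 0: "r 0 = s 0" using assms by (auto simp: line_def)
  have r': "?r \<in> rays adj" using ray_shift[OF r, of 1] by simp
  have s': "?s \<in> rays adj"
  proof (rule rayI_dist[where v = "r 1" and m = 0])
    fix n show "adj (?s n) (?s (Suc n))"
      using ray_adj[OF s, of "n - 1"] ray_adj[OF r, of 0] 0 adj_sym by (cases n) auto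
    show "d (r 1) (?s n) = 0 + n"
      using line_dist[OF assms, of 1 "n - 1"] by auto
  qed
  have "r 2 \<noteq> s 0" using line_dist[OF assms, of 2 0] by auto
  then show "line ?r ?s" using r' s' by (simp add: line_def numeral_2_eq_2)
  show "end_of ?r = end_of r"
    unfolding end_of_eq_iff[OF r' r] by (rule exI[of _ 0], rule exI[of _ 1]) simp
  show "end_of ?s = end_of s"
    unfolding end_of_eq_iff[OF s' s] by (rule exI[of _ 1], rule exI[of _ 0]) simp
qed

end

lemma even_ge2: "(n::nat) \<noteq> 0 \<Longrightarrow> even n \<Longrightarrow> 2 \<le> n"
  by presburger

lemma choice_pair: "\<forall>z. \<exists>a b. P z a b \<Longrightarrow> \<exists>f g. \<forall>z. P z (f z) (g z)"
  by metis

section \<open>Branching, sphere sizes and centres in a thick locally finite tree\<close>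

locale thick_tree = tree_graph adj for adj :: "'v \<Rightarrow> 'v \<Rightarrow> bool" +
  assumes lf: "locally_finite adj" and thick: "thick adj"
begin

lemma finite_nbrs: "finite {y. adj x y}"
  using lf by (simp add: locally_finite_def neighbours_def)

lemma third_nbr: "\<exists>c. adj v c \<and> c \<noteq> a \<and> c \<noteq> b"
proof (rule ccontr)
  assume "\<not> ?thesis"
  then have "{y. adj v y} \<subseteq> {a, b}" by auto
  then have "card {y. adj v y} \<le> card {a, b}" by (intro card_mono) auto
  moreover have "card {a, b} \<le> 2" by (simp add: card_insert_if)
  moreover have "3 \<le> card {y. adj v y}"
    using thick finite_nbrs[of v] by (auto simp: thick_def neighbours_def)
  ultimately show False by linarith
qed

lemma two_children: "\<exists>a b. adj z a \<and> adj z b \<and> a \<noteq> b \<and> d v a = Suc (d v z) \<and> d v b = Suc (d v z)"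
proof -
  \<comment> \<open>For \<open>z = v\<close> no neighbour is nearer to \<open>v\<close>, and
    \<open>p\<close> is an arbitrary vertex.\<close>
  obtain p where p: "\<And>q. adj z q \<Longrightarrow> d v z = Suc (d v q) \<Longrightarrow> q = p"
    using parent_unique adj_sym by metis
  obtain a where a: "adj z a" "a \<noteq> p" using third_nbr by metis
  obtain b where b: "adj z b" "b \<noteq> p" "b \<noteq> a" using third_nbr by metis
  have "d v q = Suc (d v z)" if "adj z q" "q \<noteq> p" for q
    using that p dist_adj_cases[OF that(1)] by metis
  then show ?thesis using a b by blast
qed

text \<open>Past \<open>s\<close> the geodesic is continued by always passing to a chosen child, as
  seen from \<open>v\<close>.\<close>

lemma ray_through:
  assumes "d v s = n" shows "\<exists>r\<in>rays adj. r 0 = v \<and> r n = s"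
proof -
  obtain p where p: "p 0 = v" "p n = s" "\<forall>i<n. adj (p i) (p (Suc i))" "\<forall>i\<le>n. d v (p i) = i"
    using geodesic_ex[of v s] assms by auto
  obtain c where c: "\<And>z. adj z (c z) \<and> d v (c z) = Suc (d v z)"
    using choice[of "\<lambda>z c. adj z c \<and> d v c = Suc (d v z)"] two_children by blast
  define r where "r i = (if i \<le> n then p i else (c ^^ (i - n)) s)" for i
  have r': "r (n + k) = (c ^^ k) s" for k by (cases k) (auto simp: r_def p)
  have dk: "d v ((c ^^ k) s) = n + k" for k by (induction k) (use assms c in auto)
  have "r \<in> rays adj"
  proof (rule rayI_dist[where v = v and m = 0])
    fix i
    show "adj (r i) (r (Suc i))"
    proof (cases "i < n")
      case True then show ?thesis using p by (simp add: r_def)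
    next
      case False
      then show ?thesis using r'[of "i - n"] r'[of "Suc (i - n)"] c by simp
    qed
    show "d v (r i) = 0 + i"
    proof (cases "i < n")
      case True then show ?thesis using p by (simp add: r_def)
    next
      case False then show ?thesis using r'[of "i - n"] dk[of "i - n"] by simp
    qed
  qed
  moreover have "r 0 = v" "r n = s" using p by (auto simp: r_def)
  ultimately show ?thesis by blast
qed

lemma finite_sphere: "finite {s. d v s = n}"
proof (induction n)
  case 0
  have "{s. d v s = 0} = {v}" by auto
  then show ?case by simp
next
  case (Suc n)
  have "{s. d v s = Suc n} \<subseteq> (\<Union>p\<in>{s. d v s = n}. {y. adj p y})"
  proof
    fix s assume "s \<in> {s. d v s = Suc n}"
    then have s: "d v s = Suc n" by simp
    then have "v \<noteq> s" by auto
    then obtain p where "adj p s" "d v s = Suc (d v p)" using parent_ex by blast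
    then show "s \<in> (\<Union>p\<in>{s. d v s = n}. {y. adj p y})" using s by auto
  qed
  then show ?case using Suc finite_nbrs by (meson finite_UN_I finite_subset)
qed

lemma finite_ball: "finite {s. d v s \<le> n}"
proof -
  have "{s. d v s \<le> n} = (\<Union>i\<in>{..n}. {s. d v s = i})" by auto
  then show ?thesis using finite_sphere by simp
qed

text \<open>Choosing one child for each vertex is injective, because parents are unique, and misses
  the second child of any vertex. Strict growth later makes stabilisers infinite and lets sphere
  sizes detect adjacency.\<close>

lemma card_sphere_less: "card {s. d v s = n} < card {s. d v s = Suc n}"
proof -
  obtain c c' where c: "\<And>z. adj z (c z) \<and> adj z (c' z) \<and> c z \<noteq> c' z
      \<and> d v (c z) = Suc (d v z) \<and> d v (c' z) = Suc (d v z)"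
    by (atomize_elim, rule choice_pair, rule allI, rule two_children)
  have inj: "inj_on c {s. d v s = n}"
    by (rule inj_onI) (metis c parent_unique)
  obtain r where r: "r \<in> rays adj" "r 0 = v" using ray_through[of v v 0] by auto
  let ?z = "r n"
  have z: "d v ?z = n" using ray_dist[OF r(1), of 0 n] r by simp
  have "c' ?z \<notin> c ` {s. d v s = n}"
  proof
    assume "c' ?z \<in> c ` {s. d v s = n}"
    then obtain y where y: "d v y = n" "c' ?z = c y" by auto
    then have "y = ?z" using parent_unique[of y "c y" ?z v] c z by metis
    then show False using y c by metis
  qed
  moreover have "c' ?z \<in> {s. d v s = Suc n}" "c ` {s. d v s = n} \<subseteq> {s. d v s = Suc n}"
    using c z by auto
  ultimately have "card (c ` {s. d v s = n}) < card {s. d v s = Suc n}"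
    by (intro psubset_card_mono finite_sphere) blast
  then show ?thesis using card_image[OF inj] by simp
qed

lemma card_sphere_mono: "m < n \<Longrightarrow> card {s. d v s = m} < card {s. d v s = n}"
  by (rule lift_Suc_mono_less) (rule card_sphere_less)

text \<open>The radius function of a bounded set is strictly convex along geodesics, so any two centres
  of the set are at distance at most one.\<close>

lemma fixed_vertex:
  assumes K: "K \<subseteq> Aut adj" and fin: "finite F" and F: "F \<noteq> {}"
    and inv: "\<And>g. g \<in> K \<Longrightarrow> g ` F = F" and even: "\<And>g v. g \<in> K \<Longrightarrow> even (d v (g v))"
  shows "\<exists>c. \<forall>g\<in>K. g c = c"
proof -
  define \<rho> where "\<rho> c = Max (d c ` F)" for c
  have \<rho>_le: "\<rho> c \<le> m \<longleftrightarrow> (\<forall>f\<in>F. d c f \<le> m)" for c m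
    unfolding \<rho>_def using fin F by (subst Max_le_iff) auto
  obtain c where c: "\<And>c'. \<rho> c \<le> \<rho> c'" using exists_least_iff[of "\<lambda>n. \<exists>c. n = \<rho> c"]
    by (metis linorder_not_less)
  have "g c = c" if g: "g \<in> K" for g
  proof (rule ccontr)
    assume ne: "g c \<noteq> c"
    define c' where "c' = g c"
    have gA: "g \<in> Aut adj" using g K by auto
    have "d c' f \<le> \<rho> c" if "f \<in> F" for f
    proof -
      obtain f' where "f' \<in> F" "f = g f'" using inv[OF g] \<open>f \<in> F\<close> by blast
      then show ?thesis using Aut_dist[OF gA, of c f'] \<rho>_le[of c "\<rho> c"] by (simp add: c'_def)
    qed
    then have \<rho>c': "\<forall>f\<in>F. d c' f \<le> \<rho> c" by blast
    have \<rho>c: "\<forall>f\<in>F. d c f \<le> \<rho> c" using \<rho>_le by blast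
    have "d c c' \<noteq> 0" using ne by (auto simp: c'_def)
    moreover have "even (d c c')" using even[OF g] by (simp add: c'_def)
    ultimately have ge2: "2 \<le> d c c'" by (rule even_ge2)
    obtain p where p: "p 0 = c" "p (d c c') = c'" "\<forall>i<d c c'. adj (p i) (p (Suc i))"
        "\<forall>i\<le>d c c'. d c (p i) = i \<and> d (p i) c' = d c c' - i"
      using geodesic_ex[of c c'] by blast
    \<comment> \<open>\<open>z\<close> has the distinct neighbours \<open>c\<close> and
      \<open>p 2\<close>. Only one of them can lie nearer to a given \<open>f\<close>, so the other
      lies beyond \<open>z\<close>, and with it the centre \<open>c\<close> or \<open>c'\<close>.
      Hence \<open>z\<close> would have smaller radius.\<close>
    define z where "z = p 1"
    have a: "adj z c" "adj z (p 2)" using p(1) p(3)[rule_format, of 0] p(3)[rule_format, of 1] ge2 adj_sym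
      by (auto simp: z_def numeral_2_eq_2)
    have ne2: "c \<noteq> p 2" using p(4) ge2 by auto
    have z1: "d z c = 1" "d z c' = Suc (d (p 2) c')" using p(4) ge2 a dist_eq_1 by (auto simp: z_def)
    have "d z f < \<rho> c" if f: "f \<in> F" for f
    proof -
      have "d f c = Suc (d f z) \<or> d f (p 2) = Suc (d f z)"
        using dist_adj_cases[OF a(1), of f] dist_adj_cases[OF a(2), of f] parent_unique[of c z "p 2" f] a adj_sym ne2
        by metis
      then show ?thesis
      proof
        assume "d f c = Suc (d f z)" then show ?thesis using \<rho>c f by (metis Suc_le_eq dist_sym)
      next
        assume "d f (p 2) = Suc (d f z)"
        then have "d f c' = d f z + d z c'" using dist_beyond[OF a(2)] z1 by blast
        then show ?thesis using \<rho>c' f z1 by (fastforce simp: dist_sym)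
      qed
    qed
    moreover have "\<rho> z \<in> d z ` F" unfolding \<rho>_def using fin F by (intro Max_in) auto
    ultimately show False using c[of z] by (metis imageE linorder_not_less)
  qed
  then show ?thesis by blast
qed

end

section \<open>Topology of the automorphism group\<close>

context tree_graph
begin

lemma open_aut_agree: "finite A \<Longrightarrow> openin AutT {g \<in> Aut adj. \<forall>a\<in>A. g a = f a}"
proof (induction A rule: finite_induct)
  case empty
  then show ?case using openin_topspace[of "AutT"] by (simp add: topspace_aut_topology)
next
  case (insert x A)
  have "{g \<in> Aut adj. \<forall>a\<in>insert x A. g a = f a} =
      {g \<in> Aut adj. g x \<in> {f x}} \<inter> {g \<in> Aut adj. \<forall>a\<in>A. g a = f a}" by auto
  then show ?case using insert.IH openin_aut_topology_eval[of adj x "{f x}"] by (simp only: openin_Int)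
qed

lemma openin_aut_iff:
  "openin AutT U \<longleftrightarrow> U \<subseteq> Aut adj \<and>
     (\<forall>f\<in>U. \<exists>A. finite A \<and> (\<forall>g\<in>Aut adj. (\<forall>a\<in>A. g a = f a) \<longrightarrow> g \<in> U))" (is "?L \<longleftrightarrow> ?R")
proof
  assume L: ?L
  then obtain W where W: "openin (product_topology (\<lambda>_. discrete_topology UNIV) UNIV) W" "U = W \<inter> Aut adj"
    unfolding aut_topology_def openin_subtopology by blast
  have "\<exists>A. finite A \<and> (\<forall>g\<in>Aut adj. (\<forall>a\<in>A. g a = f a) \<longrightarrow> g \<in> U)" if f: "f \<in> U" for f
  proof -
    obtain B where B: "finite {i. B i \<noteq> (UNIV::'v set)}" "f \<in> Pi\<^sub>E UNIV B" "Pi\<^sub>E UNIV B \<subseteq> W"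
      using W f unfolding openin_product_topology_alt by (auto simp del: PiE_UNIV_domain)
    have "g \<in> U" if "g \<in> Aut adj" "\<forall>a\<in>{i. B i \<noteq> UNIV}. g a = f a" for g
    proof -
      have "g i \<in> B i" for i using that(2) B(2) by (cases "B i = UNIV") (auto simp: PiE_iff)
      then show ?thesis using B(3) that(1) W(2) by (auto simp: PiE_iff)
    qed
    then show ?thesis using B(1) by blast
  qed
  moreover have "U \<subseteq> Aut adj" using W by blast
  ultimately show ?R by blast
next
  assume R: ?R
  show ?L
  proof (subst openin_subopen, intro ballI)
    fix f assume f: "f \<in> U"
    then obtain A where A: "finite A" "\<forall>g\<in>Aut adj. (\<forall>a\<in>A. g a = f a) \<longrightarrow> g \<in> U" using R by blast
    show "\<exists>T. openin AutT T \<and> f \<in> T \<and> T \<subseteq> U"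
      using open_aut_agree[OF A(1), of f] A(2) f R
      by (intro exI[of _ "{g \<in> Aut adj. \<forall>a\<in>A. g a = f a}"]) auto
  qed
qed

lemma closedin_aut_iff:
  "closedin AutT H \<longleftrightarrow> H \<subseteq> Aut adj \<and>
     (\<forall>g\<in>Aut adj. (\<forall>A. finite A \<longrightarrow> (\<exists>h\<in>H. \<forall>a\<in>A. h a = g a)) \<longrightarrow> g \<in> H)"
proof -
  have "(\<forall>f\<in>Aut adj - H. \<exists>A. finite A \<and> (\<forall>g\<in>Aut adj. (\<forall>a\<in>A. g a = f a) \<longrightarrow> g \<in> Aut adj - H)) \<longleftrightarrow>
      (\<forall>g\<in>Aut adj. (\<forall>A. finite A \<longrightarrow> (\<exists>h\<in>H. \<forall>a\<in>A. h a = g a)) \<longrightarrow> g \<in> H)" if "H \<subseteq> Aut adj"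
  proof -
    have *: "(\<forall>g\<in>Aut adj. (\<forall>a\<in>A. g a = f a) \<longrightarrow> g \<in> Aut adj - H) \<longleftrightarrow> \<not> (\<exists>h\<in>H. \<forall>a\<in>A. h a = f a)" for A f
      using that by blast
    show ?thesis unfolding * by blast
  qed
  then show ?thesis
    unfolding closedin_def openin_aut_iff topspace_aut_topology by (simp only: Diff_subset simp_thms cong: conj_cong)
qed

lemma Hausdorff_aut: "Hausdorff_space AutT"
  unfolding aut_topology_def
  by (intro Hausdorff_space_subtopology) (simp add: Hausdorff_space_product_topology)

lemma subgroup_aut_iff:
  "subgroup H (aut_group adj) \<longleftrightarrow> H \<subseteq> Aut adj \<and> id \<in> H \<and> (\<forall>g\<in>H. \<forall>h\<in>H. g \<circ> h \<in> H) \<and>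
     (\<forall>g\<in>H. finv g \<in> H)"
proof -
  have "inv\<^bsub>aut_group adj\<^esub> g = finv g" if "H \<subseteq> Aut adj" "g \<in> H" for g
    using inv_aut_group[of g adj] that by auto
  then show ?thesis unfolding subgroup_def by (auto simp: aut_group_def)
qed

lemma normal_aut_iff:
  assumes "subgroup H (aut_group adj)"
  shows "N \<lhd> aut_group adj\<lparr>carrier := H\<rparr> \<longleftrightarrow>
    subgroup N (aut_group adj) \<and> N \<subseteq> H \<and> (\<forall>h\<in>H. \<forall>n\<in>N. h \<circ> n \<circ> finv h \<in> N)"
proof -
  interpret G: group "aut_group adj" by (rule group_aut_group)
  have g: "group (aut_group adj\<lparr>carrier := H\<rparr>)" using subgroup.subgroup_is_group[OF assms G.is_group] .
  have HA: "H \<subseteq> Aut adj" using subgroup.subset[OF assms] by (simp add: aut_group_def)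
  have inv: "inv\<^bsub>aut_group adj\<lparr>carrier := H\<rparr>\<^esub> h = finv h" if "h \<in> H" for h
    using G.m_inv_consistent[OF assms that] inv_aut_group[of h adj] that HA by auto
  have sg: "subgroup N (aut_group adj\<lparr>carrier := H\<rparr>) \<longleftrightarrow> subgroup N (aut_group adj) \<and> N \<subseteq> H"
  proof
    assume "subgroup N (aut_group adj\<lparr>carrier := H\<rparr>)"
    then show "subgroup N (aut_group adj) \<and> N \<subseteq> H"
      using G.incl_subgroup[OF assms] subgroup.subset by fastforce
  next
    assume "subgroup N (aut_group adj) \<and> N \<subseteq> H"
    then show "subgroup N (aut_group adj\<lparr>carrier := H\<rparr>)" using G.subgroup_incl[OF _ assms] by blast
  qed
  have "(\<forall>h\<in>H. \<forall>n\<in>N. h \<otimes>\<^bsub>aut_group adj\<^esub> n \<otimes>\<^bsub>aut_group adj\<^esub> inv\<^bsub>aut_group adj\<lparr>carrier := H\<rparr>\<^esub> h \<in> N) \<longleftrightarrow>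
      (\<forall>h\<in>H. \<forall>n\<in>N. h \<circ> n \<circ> finv h \<in> N)"
  proof (rule ball_cong[OF refl], rule ball_cong[OF refl])
    fix h n assume "h \<in> H" "n \<in> N"
    then show "h \<otimes>\<^bsub>aut_group adj\<^esub> n \<otimes>\<^bsub>aut_group adj\<^esub> inv\<^bsub>aut_group adj\<lparr>carrier := H\<rparr>\<^esub> h \<in> N \<longleftrightarrow>
        h \<circ> n \<circ> finv h \<in> N"
      using inv by (simp add: aut_group_def)
  qed
  then show ?thesis
    unfolding group.normal_inv_iff[OF g] sg by simp
qed

end

text \<open>Equivalent to 2-transitivity on ends for closed subgroups, but each instance is a
  condition on two vertices and therefore passes to Chabauty limits.\<close>

definition sphere_transitive :: "('v \<Rightarrow> 'v \<Rightarrow> bool) \<Rightarrow> ('v \<Rightarrow> 'v) set \<Rightarrow> bool" where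
  "sphere_transitive adj H \<longleftrightarrow>
     (\<forall>v a b. gdist adj v a = gdist adj v b \<longrightarrow> (\<exists>h\<in>H. h v = v \<and> h a = b))"

section \<open>Compactness in the automorphism group, and shifts along rays\<close>

context thick_tree
begin

text \<open>Each \<open>x\<close> can only go to the finite sphere of radius \<open>d v x\<close>
  about \<open>w\<close>, so the set lies in a compact product; it remains to see that limits are
  again automorphisms.\<close>

lemma compact_aut_coset: "compactin AutT {g \<in> Aut adj. g v = w}"
proof -
  let ?P = "product_topology (\<lambda>_. discrete_topology UNIV) UNIV :: ('v \<Rightarrow> 'v) topology"
  define B where "B x = {y. d w y = d v x}" for x
  define S where "S = {g \<in> Aut adj. g v = w}"
  have cB: "compactin ?P (Pi\<^sub>E UNIV B)"
    unfolding compactin_PiE by (auto simp: compactin_discrete_topology B_def finite_sphere)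
  have SB: "S \<subseteq> Pi\<^sub>E UNIV B" using Aut_dist by (auto simp: S_def B_def)
  have "closedin ?P S"
    unfolding closedin_def
  proof
    show "S \<subseteq> topspace ?P" by simp
    show "openin ?P (topspace ?P - S)"
    proof (subst openin_subopen, intro ballI)
      fix f assume f: "f \<in> topspace ?P - S"
      have "\<exists>A. finite A \<and> (\<forall>g. (\<forall>a\<in>A. g a = f a) \<longrightarrow> g \<notin> S)"
      proof (rule ccontr)
        assume "\<not> ?thesis"
        then have A: "\<exists>g\<in>S. \<forall>a\<in>A. g a = f a" if "finite A" for A using that by blast
        have "adj (f x) (f y) \<longleftrightarrow> adj x y" for x y
        proof -
          obtain g where "g \<in> Aut adj" "g x = f x" "g y = f y" using A[of "{x, y}"] by (auto simp: S_def)
          then show ?thesis using Aut_adj[of g x y] by simp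
        qed
        moreover have "inj f"
        proof (rule injI)
          fix x y assume e: "f x = f y"
          obtain g where "g \<in> Aut adj" "g x = f x" "g y = f y" using A[of "{x, y}"] by (auto simp: S_def)
          then show "x = y" using e Aut_eq_iff[of g x y] by simp
        qed
        \<comment> \<open>Surjectivity is not a condition on finitely many values. The preimage of
          \<open>y\<close> under any \<open>g\<close> with \<open>g v = w\<close> lies in a fixed
          finite ball about \<open>v\<close>, so agreement of \<open>f\<close> with one such
          \<open>g\<close> on that ball suffices.\<close>
        moreover have "surj f"
          unfolding surj_def
        proof
          fix y
          obtain g where g: "g \<in> S" "\<forall>a\<in>{x. d v x \<le> d w y}. g a = f a"
            using A[OF finite_ball[of v "d w y"]] by blast
          have gA: "g \<in> Aut adj" "g v = w" using g by (auto simp: S_def)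
          let ?x = "finv g y"
          have "d v ?x = d w y" using Aut_dist[OF gA(1), of v ?x] gA by simp
          then have "f ?x = y" using g(2) gA(1) by (metis Aut_f_inv mem_Collect_eq order_refl)
          then show "\<exists>x. y = f x" by metis
        qed
        moreover have "f v = w" using A[of "{v}"] by (auto simp: S_def)
        ultimately have "f \<in> S" unfolding S_def Aut_def bij_def by blast
        then show False using f by blast
      qed
      then obtain A where A: "finite A" "\<And>g. (\<forall>a\<in>A. g a = f a) \<Longrightarrow> g \<notin> S" by blast
      let ?T = "Pi\<^sub>E UNIV (\<lambda>a. if a \<in> A then {f a} else UNIV)"
      have "openin ?P ?T"
        by (rule product_topology_basis)
          (auto intro: finite_subset[OF _ A(1)])
      moreover have "f \<in> ?T" by auto
      moreover have "?T \<subseteq> topspace ?P - S"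
      proof
        fix g assume g: "g \<in> ?T"
        then have "\<forall>a\<in>A. g a = f a" by (auto simp: PiE_iff split: if_splits)
        then show "g \<in> topspace ?P - S" using A(2) by simp
      qed
      ultimately show "\<exists>T. openin ?P T \<and> f \<in> T \<and> T \<subseteq> topspace ?P - S" by blast
    qed
  qed
  then have "compactin ?P (Pi\<^sub>E UNIV B \<inter> S)" by (metis closed_Int_compactin cB inf_commute)
  then have "compactin ?P S" using SB by (simp add: Int_absorb1)
  then show ?thesis unfolding aut_topology_def S_def
    by (subst compactin_subtopology) auto
qed

text \<open>The finite intersection property, ready for use: \<open>loc\<close> makes every
  condition closed, and \<open>mono\<close> lets a solution for a union of finite sets solve all of
  them at once. Fixing the value at \<open>v\<close> supplies the compact set.\<close>

lemma aut_compactness: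
  assumes ex: "\<And>A. finite A \<Longrightarrow> \<exists>g\<in>Aut adj. g v = w \<and> \<phi> A g"
    and mono: "\<And>A B g. A \<subseteq> B \<Longrightarrow> \<phi> B g \<Longrightarrow> \<phi> A g"
    and loc: "\<And>A g g'. finite A \<Longrightarrow> \<phi> A g \<Longrightarrow> (\<And>a. a \<in> A \<Longrightarrow> g a = g' a) \<Longrightarrow> \<phi> A g'"
  shows "\<exists>g\<in>Aut adj. g v = w \<and> (\<forall>A. finite A \<longrightarrow> \<phi> A g)"
proof -
  let ?C = "\<lambda>A. {g \<in> Aut adj. \<phi> A g}"
  have cl: "closedin AutT (?C A)" if "finite A" for A
    unfolding closedin_aut_iff
  proof (intro conjI ballI impI)
    fix g assume g: "g \<in> Aut adj" "\<forall>B. finite B \<longrightarrow> (\<exists>h\<in>?C A. \<forall>b\<in>B. h b = g b)"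
    then obtain h where "\<phi> A h" "\<forall>a\<in>A. h a = g a" using \<open>finite A\<close> by blast
    then show "g \<in> ?C A" using loc[OF that, of h g] g(1) by simp
  qed auto
  have "{g \<in> Aut adj. g v = w} \<inter> \<Inter>(?C ` {A. finite A}) \<noteq> {}"
  proof -
    have "{g \<in> Aut adj. g v = w} \<inter> \<Inter>\<F> \<noteq> {}" if \<F>: "finite \<F>" "\<F> \<subseteq> ?C ` {A. finite A}" for \<F>
    proof -
      obtain \<A> where \<A>: "\<A> \<subseteq> {A. finite A}" "finite \<A>" "\<F> = ?C ` \<A>"
        using finite_subset_image[OF \<F>] by blast
      have "finite (\<Union>\<A>)" using \<A> by blast
      then obtain g where g: "g \<in> Aut adj" "g v = w" "\<phi> (\<Union>\<A>) g" using ex by blast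
      have "g \<in> \<Inter>\<F>" using g mono[of _ "\<Union>\<A>"] \<A>(3) by blast
      then show ?thesis using g by blast
    qed
    moreover have "\<forall>C\<in>?C ` {A. finite A}. closedin AutT C" using cl by blast
    ultimately show ?thesis
      using compact_aut_coset[of v w, unfolded compactin_fip, THEN conjunct2, rule_format] by simp
  qed
  then show ?thesis by blast
qed

text \<open>Translation length towards the end of \<open>r\<close>, with sign. \<open>t\<close> is
  an integer so that inverses are covered, and the inequality keeps \<open>nat\<close> from
  truncating.\<close>

definition shifts :: "('v \<Rightarrow> 'v) \<Rightarrow> (nat \<Rightarrow> 'v) \<Rightarrow> int \<Rightarrow> bool" where
  "shifts h r t \<longleftrightarrow> (\<exists>b. \<forall>k\<ge>b. 0 \<le> int k + t \<and> h (r k) = r (nat (int k + t)))"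

lemma shifts_comp:
  assumes "shifts h r t" "shifts g r s" shows "shifts (g \<circ> h) r (t + s)"
proof -
  obtain a where a: "\<And>k. k \<ge> a \<Longrightarrow> 0 \<le> int k + t \<and> h (r k) = r (nat (int k + t))" using assms(1) by (auto simp: shifts_def)
  obtain b where b: "\<And>k. k \<ge> b \<Longrightarrow> 0 \<le> int k + s \<and> g (r k) = r (nat (int k + s))" using assms(2) by (auto simp: shifts_def)
  have "0 \<le> int k + (t + s) \<and> (g \<circ> h) (r k) = r (nat (int k + (t + s)))" if k: "k \<ge> a + b + nat \<bar>t\<bar>" for k
  proof -
    have ka: "k \<ge> a" and kb: "nat (int k + t) \<ge> b" using k by linarith+
    show ?thesis using a[OF ka] b[OF kb] by (auto simp: algebra_simps)
  qed
  then show ?thesis unfolding shifts_def by blast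
qed

lemma shifts_inv:
  assumes "h \<in> Aut adj" "shifts h r t" shows "shifts (finv h) r (- t)"
proof -
  obtain a where a: "\<And>k. k \<ge> a \<Longrightarrow> 0 \<le> int k + t \<and> h (r k) = r (nat (int k + t))" using assms(2) by (auto simp: shifts_def)
  have "0 \<le> int k - t \<and> finv h (r k) = r (nat (int k - t))" if k: "k \<ge> a + nat \<bar>t\<bar>" for k
  proof -
    have ka: "nat (int k - t) \<ge> a" "0 \<le> int k - t" using k by linarith+
    then have "h (r (nat (int k - t))) = r k" using a[OF ka(1)] by simp
    then show ?thesis using ka(2) assms(1) by (metis Aut_inv_f)
  qed
  then show ?thesis unfolding shifts_def by auto
qed

lemma shifts_of_fix:
  assumes "h \<in> Aut adj" "r \<in> rays adj" "end_act h (end_of r) = end_of r"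
  shows "\<exists>t. shifts h r t"
proof -
  have "end_of (h \<circ> r) = end_of r" using assms end_act_end_of by metis
  then obtain m n where mn: "\<And>k. h (r (m + k)) = r (n + k)"
    using end_of_eq_iff[OF Aut_ray[OF assms(1,2)] assms(2)] by auto
  have "0 \<le> int k + (int n - int m) \<and> h (r k) = r (nat (int k + (int n - int m)))" if "k \<ge> m" for k
  proof -
    have "nat (int k + (int n - int m)) = n + (k - m)" using that by linarith
    then show ?thesis using mn[of "k - m"] that by simp
  qed
  then show ?thesis unfolding shifts_def by blast
qed

section \<open>Two-transitivity on ends\<close>

text \<open>The second fixed end is the limit of the backward orbit of a vertex.\<close>

lemma repelling_end:
  assumes h: "h \<in> Aut adj" and r: "r \<in> rays adj" and t: "shifts h r t" "t > 0"
  shows "\<exists>\<theta>\<in>rays adj. end_act h (end_of \<theta>) = end_of \<theta> \<and> end_of \<theta> \<noteq> end_of r"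
proof -
  obtain n where n: "\<And>k. k \<ge> n \<Longrightarrow> 0 \<le> int k + t \<and> h (r k) = r (nat (int k + t))" using t(1) by (auto simp: shifts_def)
  define u where "u = nat t"
  have u: "u > 0" "\<And>k. k \<ge> n \<Longrightarrow> h (r k) = r (k + u)" using n t(2) by (auto simp: u_def nat_add_distrib)
  define g where "g = finv h"
  have g: "g \<in> Aut adj" and gh: "\<And>x. g (h x) = x" "\<And>x. h (g x) = x"
    using h Aut_inv by (auto simp: g_def)
  have gr: "g (r (k + u)) = r k" if "k \<ge> n" for k using u(2)[OF that] gh by metis
  have gp: "(g ^^ N) \<in> Aut adj" for N
  proof (induction N)
    case (Suc N) then show ?case unfolding funpow.simps by (rule Aut_comp[OF g])
  qed (simp add: Aut_id)
  have grp: "(g ^^ N) (r (k + u * N)) = r k" if "k \<ge> n" for k N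
  proof (induction N)
    case (Suc N)
    have "(g ^^ Suc N) (r (k + u * Suc N)) = (g ^^ N) (g (r ((k + u * N) + u)))"
      by (simp add: funpow_swap1 add_ac)
    also have "\<dots> = (g ^^ N) (r (k + u * N))" using gr[of "k + u * N"] that by simp
    finally show ?case using Suc by simp
  qed simp
  \<comment> \<open>Beyond \<open>n\<close> the shift relation holds. The summand \<open>u\<close>
    makes \<open>m\<close> positive, which the final contradiction needs.\<close>
  define m where "m = n + u"
  \<comment> \<open>\<open>\<theta> i\<close> is the missing vertex at position \<open>m - i\<close>
    on the axis of \<open>h\<close>: go \<open>u * i\<close> steps further out, where the ray is
    available, and return by \<open>g ^^ i\<close>. The index never drops below \<open>m\<close>
    because \<open>u\<close> is at least 1.\<close>
  define \<theta> where "\<theta> i = (g ^^ i) (r (m + u * i - i))" for i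
  have ui: "i \<le> u * i" for i using u(1) by simp
  have \<theta>: "\<theta> i = (g ^^ N) (r (m + u * N - i))" if "i \<le> N" for i N
  proof -
    have e: "(m + u * i - i) + u * (N - i) = m + u * N - i"
    proof -
      have "u * i + u * (N - i) = u * N" using that by (metis add_mult_distrib2 le_add_diff_inverse)
      then show ?thesis using ui[of i] by linarith
    qed
    have "n \<le> m + u * i - i" using ui[of i] unfolding m_def by linarith
    from grp[OF this, of "N - i"] have "(g ^^ (N - i)) (r (m + u * N - i)) = r (m + u * i - i)"
      unfolding e .
    moreover have "(g ^^ N) x = (g ^^ i) ((g ^^ (N - i)) x)" for x
      using that by (metis comp_apply funpow_add le_add_diff_inverse)
    ultimately show ?thesis by (simp add: \<theta>_def)
  qed
  have inj\<theta>: "i = j" if e: "\<theta> i = \<theta> j" for i j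
  proof -
    let ?N = "max i j"
    have "(g ^^ ?N) (r (m + u * ?N - i)) = (g ^^ ?N) (r (m + u * ?N - j))" using e \<theta>[of i ?N] \<theta>[of j ?N] by simp
    then have "m + u * ?N - i = m + u * ?N - j" using gp ray_eqD[OF r] by simp
    then show ?thesis using ui[of ?N] by linarith
  qed
  have "adj (\<theta> i) (\<theta> (Suc i))" for i
  proof -
    have "m + u * Suc i - i = Suc (m + u * Suc i - Suc i)" using ui[of "Suc i"] by linarith
    then have "adj (r (m + u * Suc i - i)) (r (m + u * Suc i - Suc i))"
      using ray_adj[OF r, of "m + u * Suc i - Suc i"] adj_sym by metis
    then show ?thesis using \<theta>[of i "Suc i"] \<theta>[of "Suc i" "Suc i"] gp[of "Suc i"] by (metis Aut_adj le_SucI order_refl)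
  qed
  then have \<theta>r: "\<theta> \<in> rays adj" using inj\<theta> by (auto simp: rays_def inj_def)
  have h\<theta>: "h (\<theta> (u + i)) = \<theta> (0 + i)" for i
  proof -
    let ?N = "u + i"
    have e: "m + u * Suc ?N - (u + i) = m + u * ?N - i" by simp
    have "\<theta> (u + i) = g ((g ^^ ?N) (r (m + u * Suc ?N - (u + i))))" using \<theta>[of "u + i" "Suc ?N"] by simp
    then have "h (\<theta> (u + i)) = (g ^^ ?N) (r (m + u * ?N - i))" unfolding e by (simp add: gh)
    then show ?thesis using \<theta>[of i ?N] by simp
  qed
  have "end_act h (end_of \<theta>) = end_of \<theta>"
    unfolding end_act_end_of[OF h \<theta>r] end_of_eq_iff[OF Aut_ray[OF h \<theta>r] \<theta>r]
    by (rule exI[of _ u], rule exI[of _ 0]) (simp only: comp_apply h\<theta> simp_thms)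
  moreover have "end_of \<theta> \<noteq> end_of r"
  proof
    assume "end_of \<theta> = end_of r"
    then obtain p q where pq: "\<And>k. \<theta> (p + k) = r (q + k)" using end_of_eq_iff[OF \<theta>r r] by auto
    \<comment> \<open>On the axis these two points lie on opposite sides of \<open>r m\<close>, each
      at distance \<open>i\<close>. If the rays were cofinal, their distance would stay
      bounded.\<close>
    have "2 * i = d (\<theta> i) (r (m + i))" for i
    proof -
      have "r (m + i) = (g ^^ i) (r (m + i + u * i))" using grp[of "m + i" i] by (simp add: m_def)
      then have "d (\<theta> i) (r (m + i)) = d (r (m + u * i - i)) (r (m + i + u * i))"
        unfolding \<theta>_def using Aut_dist[OF gp] by metis
      then show ?thesis using ray_dist[OF r, of "m + u * i - i" "m + i + u * i"] ui[of i] by simp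
    qed
    from this[of "p + (p + q + m)"] have "2 * (p + (p + q + m)) = d (r (q + (p + q + m))) (r (m + (p + (p + q + m))))"
      using pq by metis
    moreover have "d (r (q + (p + q + m))) (r (m + (p + (p + q + m)))) \<le> p + q + m"
      using ray_dist[OF r, of "q + (p + q + m)" "m + (p + (p + q + m))"]
        ray_dist[OF r, of "m + (p + (p + q + m))" "q + (p + q + m)"]
      by (cases "q \<le> m + p") (auto simp: dist_sym)
    ultimately show False using u(1) by (simp add: m_def)
  qed
  ultimately show ?thesis using \<theta>r by blast
qed

definition is_subgroup :: "('v \<Rightarrow> 'v) set \<Rightarrow> bool" where
  "is_subgroup H \<longleftrightarrow> H \<subseteq> Aut adj \<and> id \<in> H \<and> (\<forall>g\<in>H. \<forall>h\<in>H. g \<circ> h \<in> H) \<and>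
     (\<forall>g\<in>H. finv g \<in> H)"

lemma is_subgroupD:
  assumes "is_subgroup H"
  shows "H \<subseteq> Aut adj" "id \<in> H" "g \<in> H \<Longrightarrow> h \<in> H \<Longrightarrow> g \<circ> h \<in> H" "g \<in> H \<Longrightarrow> finv g \<in> H"
    "g \<in> H \<Longrightarrow> g \<in> Aut adj"
  using assms by (auto simp: is_subgroup_def)

text \<open>Once the shift along \<open>z\<close> is corrected to 0, the element fixes a tail of
  \<open>z\<close> pointwise. Distances from a vertex of that tail match positions on
  \<open>x\<close> with positions on \<open>y\<close>, and uniqueness of geodesics propagates this
  back to the branching vertex.\<close>

lemma tripod_swap:
  assumes H: "is_subgroup H" and two: "two_transitive_on_ends adj H"
    and l: "line z x" "line z y" "line x y"
  shows "\<exists>h\<in>H. h (z 0) = z 0 \<and> (\<forall>n. h (x n) = y n)"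
proof -
  note HD = is_subgroupD[OF H]
  have R: "z \<in> rays adj" "x \<in> rays adj" "y \<in> rays adj" and 0: "z 0 = x 0" "z 0 = y 0"
    using l by (auto simp: line_def)
  note E = R[THEN end_of_in]
  have ne: "end_of z \<noteq> end_of x" "end_of z \<noteq> end_of y" using line_ends_neq l by auto
  obtain h where h: "h \<in> H" "end_act h (end_of z) = end_of z" "end_act h (end_of x) = end_of y"
    using two E ne unfolding two_transitive_on_ends_def by metis
  note hA = HD(5)[OF h(1)]
  obtain t where t: "shifts h z t" using shifts_of_fix[OF hA R(1) h(2)] by blast
  have "\<exists>h'\<in>H. shifts h' z 0 \<and> end_act h' (end_of x) = end_of y"
  proof (cases "t = 0")
    case True then show ?thesis using h t by blast
  next
    case False
    have "\<exists>\<theta>\<in>rays adj. end_act h (end_of \<theta>) = end_of \<theta> \<and> end_of \<theta> \<noteq> end_of z"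
    proof (cases "t > 0")
      case True then show ?thesis using repelling_end[OF hA R(1) t] by blast
    next
      case F: False
      \<comment> \<open>\<open>repelling_end\<close> requires a positive shift; the inverse of
        \<open>h\<close> has one, and the end it yields is fixed by \<open>h\<close> as
        well.\<close>
      let ?g = "finv h"
      have "shifts ?g z (- t)" "?g \<in> Aut adj" using shifts_inv[OF hA t] Aut_inv[OF hA] by auto
      then obtain \<theta> where \<theta>: "\<theta> \<in> rays adj" "end_act ?g (end_of \<theta>) = end_of \<theta>" "end_of \<theta> \<noteq> end_of z"
        using repelling_end[of ?g z "- t"] R(1) F False by auto
      have "end_act h (end_act ?g (end_of \<theta>)) = end_of \<theta>"
        using hA unfolding end_act_def by (force simp: image_iff comp_def)
      then show ?thesis using \<theta> by metis
    qed
    then obtain \<theta> where \<theta>: "\<theta> \<in> rays adj" "end_act h (end_of \<theta>) = end_of \<theta>" "end_of \<theta> \<noteq> end_of z" by blast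
    obtain u where u: "u \<in> H" "end_act u (end_of z) = end_of z" "end_act u (end_of \<theta>) = end_of y"
      using two E end_of_in[OF \<theta>(1)] \<theta>(3) ne unfolding two_transitive_on_ends_def by metis
    note uA = HD(5)[OF u(1)]
    obtain s where s: "shifts u z s" using shifts_of_fix[OF uA R(1) u(2)] by blast
    \<comment> \<open>\<open>u\<close> carries the ends of \<open>z\<close> and
      \<open>\<theta>\<close> to those of \<open>z\<close> and \<open>y\<close>. So
      \<open>g\<close>, a conjugate of the inverse of \<open>h\<close>, fixes the ends of
      \<open>z\<close> and \<open>y\<close>; its shift along \<open>z\<close> is \<open>- t\<close>,
      since the shifts of \<open>u\<close> and its inverse cancel.\<close>
    define ui hi g where "ui = finv u" and "hi = finv h" and "g = u \<circ> (hi \<circ> ui)"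
    have uiH: "ui \<in> H" "hi \<in> H" "g \<in> H" using HD u h by (auto simp: ui_def hi_def g_def)
    have comp: "end_act (a \<circ> b) \<xi> = end_act a (end_act b \<xi>)" for a b \<xi>
      unfolding end_act_def by (auto simp: image_image comp_assoc)
    have invact: "end_act (finv a) \<eta> = \<xi>" if "a \<in> Aut adj" "end_act a \<xi> = \<eta>" for a \<xi> \<eta>
      using that unfolding end_act_def by (force simp: image_image comp_def)
    have "shifts g z (- t)"
      using shifts_comp[OF shifts_comp[OF shifts_inv[OF uA s] shifts_inv[OF hA t]] s] by (simp add: g_def ui_def hi_def)
    moreover have "end_act g (end_of y) = end_of y"
      using invact[OF uA u(3)] invact[OF hA \<theta>(2)] u(3) by (simp add: g_def comp ui_def hi_def)
    ultimately have "shifts (g \<circ> h) z 0" "end_act (g \<circ> h) (end_of x) = end_of y"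
      using shifts_comp[OF t] h(3) by (force, simp add: comp)
    then show ?thesis using HD(3) uiH h(1) by blast
  qed
  then obtain g where g: "g \<in> H" "shifts g z 0" "end_act g (end_of x) = end_of y" by blast
  note gA = HD(5)[OF g(1)]
  obtain a where a: "\<And>k. k \<ge> a \<Longrightarrow> g (z k) = z k" using g(2) by (auto simp: shifts_def)
  have "end_of (g \<circ> x) = end_of y" using end_act_end_of[OF gA R(2)] g(3) by metis
  then obtain m n where mn: "\<And>k. g (x (m + k)) = y (n + k)"
    using end_of_eq_iff[OF Aut_ray[OF gA R(2)] R(3)] by auto
  \<comment> \<open>Both sides are distances from \<open>z a\<close>, which \<open>g\<close>
    fixes.\<close>
  have "a + m = a + n"
    using Aut_dist[OF gA, of "z a" "x m"] a[of a] mn[of 0] line_dist[OF l(1), of a m] line_dist[OF l(2), of a n] by simp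
  then have mn: "\<And>k. g (x (m + k)) = y (m + k)" using mn by simp
  have big: "g (x k) = y k" if "k \<ge> m" for k using mn[of "k - m"] that by simp
  have "g (x k) = y k" for k
  proof (rule between_unique[of "z a" _ "y (m + k)"])
    have "d (z a) (g (x k)) = a + k" "d (g (x k)) (y (m + k)) = m"
      using Aut_dist[OF gA, of "z a" "x k"] Aut_dist[OF gA, of "x k" "x (m + k)"] a[of a] big[of "m + k"]
        line_dist[OF l(1), of a k] ray_dist[OF R(2), of k "m + k"] by simp_all
    then show "d (z a) (g (x k)) + d (g (x k)) (y (m + k)) = d (z a) (y (m + k))"
      "d (z a) (g (x k)) = d (z a) (y k)"
      using line_dist[OF l(2), of a "m + k"] line_dist[OF l(2), of a k] by simp_all
    show "d (z a) (y k) + d (y k) (y (m + k)) = d (z a) (y (m + k))"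
      using line_dist[OF l(2), of a "m + k"] line_dist[OF l(2), of a k] ray_dist[OF R(3), of k "m + k"] by simp
  qed
  then show ?thesis using g(1) 0 by metis
qed

lemma sphere_transitive_of_two_transitive:
  assumes H: "is_subgroup H" and two: "two_transitive_on_ends adj H"
  shows "sphere_transitive adj H"
  unfolding sphere_transitive_def
proof (intro allI impI)
  note HD = is_subgroupD[OF H]
  fix v a b assume ab: "d v a = d v b"
  define n where "n = d v a"
  show "\<exists>h\<in>H. h v = v \<and> h a = b"
  proof (cases "n = 0")
    case True
    then have "a = v" "b = v" using ab by (auto simp: n_def)
    then show ?thesis using HD(2) by (intro bexI[of _ id]) auto
  next
    case False
    have key: "\<exists>h\<in>H. h v = v \<and> h (x n) = y n"
      if x: "x \<in> rays adj" "x 0 = v" and y: "y \<in> rays adj" "y 0 = v" and xy: "x 1 \<noteq> y 1" for x y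
    proof -
      obtain c where c: "adj v c" "c \<noteq> x 1" "c \<noteq> y 1" using third_nbr by blast
      obtain z where z: "z \<in> rays adj" "z 0 = v" "z 1 = c"
        using ray_through[of v c 1] c dist_eq_1 by auto
      have "line z x" "line z y" "line x y" using x y z c xy by (auto simp: line_def)
      from tripod_swap[OF H two this] show ?thesis using z(2) by metis
    qed
    obtain x where x: "x \<in> rays adj" "x 0 = v" "x n = a" using ray_through[of v a n] n_def by auto
    obtain y where y: "y \<in> rays adj" "y 0 = v" "y n = b" using ray_through[of v b n] n_def ab by auto
    \<comment> \<open>The rays to \<open>a\<close> and \<open>b\<close> may share their first edge,
      where \<open>key\<close> does not apply. A ray \<open>z\<close> leaving through a third
      neighbour differs from both, and two swaps through it suffice.\<close>
    obtain c where c: "adj v c" "c \<noteq> x 1" "c \<noteq> y 1" using third_nbr by blast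
    obtain z where z: "z \<in> rays adj" "z 0 = v" "z 1 = c"
      using ray_through[of v c 1] c dist_eq_1 by auto
    obtain h where h: "h \<in> H" "h v = v" "h a = z n" using key[OF x(1,2) z(1,2)] c z x by auto
    obtain g where g: "g \<in> H" "g v = v" "g (z n) = b" using key[OF z(1,2) y(1,2)] c z y by auto
    show ?thesis using HD(3)[OF g(1) h(1)] g h by (intro bexI[of _ "g \<circ> h"]) auto
  qed
qed

lemma sphere_transitiveD:
  "sphere_transitive adj H \<Longrightarrow> d v a = d v b \<Longrightarrow> \<exists>h\<in>H. h v = v \<and> h a = b"
  by (simp add: sphere_transitive_def)

text \<open>The stabiliser of the midpoint of \<open>v\<close> and \<open>w\<close> moves one to the
  other.\<close>

lemma sphere_transitive_even:
  assumes "sphere_transitive adj H" "even (d v w)"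
  shows "\<exists>h\<in>H. h v = w"
proof -
  obtain k where k: "d v w = 2 * k" using assms(2) by (rule evenE)
  then obtain u where "d v u = k" "d u w = k" using between_ex[of k v w] by auto
  then show ?thesis using sphere_transitiveD[OF assms(1), of u v w] by (auto simp: dist_sym)
qed

text \<open>A segment of the first line is matched with one of the second by moving one endpoint and
  then, with that endpoint fixed, the other. Compactness turns these approximations into one
  automorphism, and closedness of \<open>H\<close> puts it in \<open>H\<close>.\<close>

lemma two_transitive_of_sphere_transitive:
  assumes H: "is_subgroup H" and cl: "closedin AutT H" and st: "sphere_transitive adj H"
  shows "two_transitive_on_ends adj H"
  unfolding two_transitive_on_ends_def
proof (intro ballI impI)
  note HD = is_subgroupD[OF H]
  fix \<xi> \<eta> \<xi>' \<eta>' assume E: "\<xi> \<in> ends adj" "\<eta> \<in> ends adj" "\<xi>' \<in> ends adj" "\<eta>' \<in> ends adj" "\<xi> \<noteq> \<eta>" "\<xi>' \<noteq> \<eta>'"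
  obtain r s where rs: "line r s" "end_of r = \<xi>" "end_of s = \<eta>" using line_ex E by meson
  obtain r0 s0 where rs0: "line r0 s0" "end_of r0 = \<xi>'" "end_of s0 = \<eta>'" using line_ex E by meson
  \<comment> \<open>Elements are available only for even displacements, so the base of the target
    line may have to slide by one edge.\<close>
  have "\<exists>r' s'. line r' s' \<and> end_of r' = \<xi>' \<and> end_of s' = \<eta>' \<and> even (d (r 0) (r' 0))"
  proof (cases "even (d (r 0) (r0 0))")
    case True then show ?thesis using rs0 by blast
  next
    case False
    have "odd (d (r0 0) (r0 (Suc 0)))" using rs0(1) ray_dist[of r0 0 1] by (simp add: line_def)
    then have "even (d (r 0) (r0 (Suc 0)))" using False dist_parity[of "r 0" "r0 0" "r0 (Suc 0)"] by simp
    then show ?thesis using line_rebase[OF rs0(1)] rs0(2,3) by auto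
  qed
  then obtain r' s' where rs': "line r' s'" "end_of r' = \<xi>'" "end_of s' = \<eta>'" and ev: "even (d (r 0) (r' 0))" by blast
  have R: "r \<in> rays adj" "s \<in> rays adj" "r' \<in> rays adj" "s' \<in> rays adj" "r 0 = s 0" "r' 0 = s' 0"
    using rs rs' by (auto simp: line_def)
  have step: "\<exists>h\<in>H. (\<forall>i\<le>n. h (r i) = r' i) \<and> (\<forall>i\<le>n. h (s i) = s' i)" for n
  proof -
    have "even (d (r n) (r' n))"
      using dist_parity[of "r n" "r 0" "r' n"] dist_parity[of "r 0" "r' 0" "r' n"] ev
        ray_dist[OF R(1), of 0 n] ray_dist[OF R(3), of 0 n] by (simp add: dist_sym)
    then obtain g where g: "g \<in> H" "g (r n) = r' n" using sphere_transitive_even[OF st] by blast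
    have "d (r' n) (g (s n)) = d (r' n) (s' n)"
      using Aut_dist[OF HD(5)[OF g(1)], of "r n" "s n"] g(2) line_dist[OF rs(1), of n n] line_dist[OF rs'(1), of n n] by simp
    then obtain k where k: "k \<in> H" "k (r' n) = r' n" "k (g (s n)) = s' n"
      using sphere_transitiveD[OF st] by blast
    define h where "h = k \<circ> g"
    have h: "h \<in> H" "h (r n) = r' n" "h (s n) = s' n" using g k HD(3) by (auto simp: h_def)
    note hA = HD(5)[OF h(1)]
    have "h (r i) = r' i" if "i \<le> n" for i
    proof (rule between_unique[of "r' n" _ "s' n"])
      have 1: "d (r' n) (h (r i)) = n - i" "d (h (r i)) (s' n) = i + n"
        using Aut_dist[OF hA, of "r n" "r i"] Aut_dist[OF hA, of "r i" "s n"] h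
          ray_dist[OF R(1) that] line_dist[OF rs(1), of i n] by (simp_all add: dist_sym)
      have 2: "d (r' n) (r' i) = n - i" "d (r' i) (s' n) = i + n"
        using ray_dist[OF R(3) that] line_dist[OF rs'(1), of i n] by (simp_all add: dist_sym)
      show "d (r' n) (h (r i)) + d (h (r i)) (s' n) = d (r' n) (s' n)"
        "d (r' n) (r' i) + d (r' i) (s' n) = d (r' n) (s' n)" "d (r' n) (h (r i)) = d (r' n) (r' i)"
        using 1 2 that line_dist[OF rs'(1), of n n] by auto
    qed
    moreover have "h (s i) = s' i" if "i \<le> n" for i
    proof (rule between_unique[of "r' n" _ "s' n"])
      have 1: "d (h (s i)) (s' n) = n - i" "d (r' n) (h (s i)) = n + i"
        using Aut_dist[OF hA, of "s i" "s n"] Aut_dist[OF hA, of "r n" "s i"] h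
          ray_dist[OF R(2) that] line_dist[OF rs(1), of n i] by (simp_all add: dist_sym)
      have 2: "d (s' i) (s' n) = n - i" "d (r' n) (s' i) = n + i"
        using ray_dist[OF R(4) that] line_dist[OF rs'(1), of n i] by (simp_all add: dist_sym)
      show "d (r' n) (h (s i)) + d (h (s i)) (s' n) = d (r' n) (s' n)"
        "d (r' n) (s' i) + d (s' i) (s' n) = d (r' n) (s' n)" "d (r' n) (h (s i)) = d (r' n) (s' i)"
        using 1 2 that line_dist[OF rs'(1), of n n] by auto
    qed
    ultimately show ?thesis using h(1) by blast
  qed
  \<comment> \<open>The first conjunct brings the limit into the closed group \<open>H\<close>; the
    other two make it match the lines.\<close>
  define \<phi> where "\<phi> A g \<longleftrightarrow> (\<exists>h\<in>H. \<forall>a\<in>A. h a = g a) \<and> (\<forall>i. r i \<in> A \<longrightarrow> g (r i) = r' i) \<and> (\<forall>i. s i \<in> A \<longrightarrow> g (s i) = s' i)" for A g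
  have "\<exists>g\<in>Aut adj. g (r 0) = r' 0 \<and> (\<forall>A. finite A \<longrightarrow> \<phi> A g)"
  proof (rule aut_compactness)
    fix A :: "'v set" assume "finite A"
    then have "finite (r -` A \<union> s -` A)"
      using R(1,2) by (auto intro!: finite_vimageI simp: rays_def)
    then obtain n where n: "\<forall>i\<in>r -` A \<union> s -` A. i \<le> n" by (metis finite_nat_set_iff_bounded_le)
    obtain h where h: "h \<in> H" "\<forall>i\<le>n. h (r i) = r' i" "\<forall>i\<le>n. h (s i) = s' i" using step by blast
    have "\<phi> A h" unfolding \<phi>_def using h n by auto
    then show "\<exists>g\<in>Aut adj. g (r 0) = r' 0 \<and> \<phi> A g" using h HD(5) by blast
  next
    fix A B g assume "A \<subseteq> B" "\<phi> B g" then show "\<phi> A g" unfolding \<phi>_def by blast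
  next
    fix A g g' assume "\<phi> A g" "\<And>a. a \<in> A \<Longrightarrow> g a = g' a" then show "\<phi> A g'" unfolding \<phi>_def by metis
  qed
  then obtain g where g: "g \<in> Aut adj" "\<And>A. finite A \<Longrightarrow> \<phi> A g" by blast
  have gH: "g \<in> H" using cl[unfolded closedin_aut_iff] g unfolding \<phi>_def by blast
  have "g (r i) = r' i" "g (s i) = s' i" for i using g(2)[of "{r i}"] g(2)[of "{s i}"] by (auto simp: \<phi>_def)
  then have "g \<circ> r = r'" "g \<circ> s = s'" by auto
  then have "end_act g \<xi> = \<xi>'" "end_act g \<eta> = \<eta>'"
    using end_act_end_of[OF g(1) R(1)] end_act_end_of[OF g(1) R(2)] rs rs' by auto
  then show "\<exists>h\<in>H. end_act h \<xi> = \<xi>' \<and> end_act h \<eta> = \<eta>'" using gH by blast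
qed

section \<open>Closed normal subgroups\<close>

text \<open>The type-preserving groups: no element exchanges the two classes of the bipartition, so
  none inverts an edge.\<close>

definition even_moving :: "('v \<Rightarrow> 'v) set \<Rightarrow> bool" where
  "even_moving H \<longleftrightarrow> (\<forall>h\<in>H. \<forall>v. even (d v (h v)))"

lemma Aut_parity:
  assumes "g \<in> Aut adj" "even (d v (g v))" shows "even (d w (g w))"
proof -
  have "even (d w (g w)) \<longleftrightarrow> even (d w v + d v (g w))" using dist_parity by blast
  also have "\<dots> \<longleftrightarrow> even (d w v + d v (g v) + d (g v) (g w))" using dist_parity[of v "g v" "g w"] by auto
  finally show ?thesis using assms(2) Aut_dist[OF assms(1), of v w] by (simp add: dist_sym)
qed

lemma Aut_bij: "g \<in> Aut adj \<Longrightarrow> bij g"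
  unfolding Aut_def by blast

lemma inv_comp_apply:
  assumes "g \<in> Aut adj" "h \<in> Aut adj"
  shows "finv (g \<circ> h) x = finv h (finv g x)"
proof -
  have "finv (g \<circ> h) = finv h \<circ> finv g"
    using assms by (intro o_inv_distrib Aut_bij)
  then show ?thesis by simp
qed

lemma inv_inv_Aut: "g \<in> Aut adj \<Longrightarrow> finv (finv g) = g"
  by (rule inv_inv_eq) (rule Aut_bij)

definition normal_in :: "('v \<Rightarrow> 'v) set \<Rightarrow> ('v \<Rightarrow> 'v) set \<Rightarrow> bool" where
  "normal_in N H \<longleftrightarrow> is_subgroup N \<and> N \<subseteq> H \<and> (\<forall>h\<in>H. \<forall>n\<in>N. h \<circ> n \<circ> finv h \<in> N)"

lemma dist_two_nbrs: "adj v a \<Longrightarrow> adj v b \<Longrightarrow> a \<noteq> b \<Longrightarrow> d a b = 2"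
  using dist_adj_cases[of v b a] dist_eq_1[of v a] dist_sym[of a v] by force

text \<open>An element that fixes \<open>x\<close> and takes \<open>c\<close> to \<open>c'\<close>
  takes the parent of \<open>c\<close> to the parent of \<open>c'\<close>, and both are
  \<open>v\<close>.\<close>

lemma move_child:
  assumes H: "H \<subseteq> Aut adj" "sphere_transitive adj H"
    and c: "adj v c" "adj v c'" "d x c = Suc (d x v)" "d x c' = Suc (d x v)"
  shows "\<exists>h\<in>H. h x = x \<and> h v = v \<and> h c = c'"
proof -
  have "d x c = d x c'" using c by simp
  then obtain h where h: "h \<in> H" "h x = x" "h c = c'" using sphere_transitiveD[OF H(2), of x c c'] by blast
  then have hA: "h \<in> Aut adj" using H by auto
  have "d x (h v) = d x v" using Aut_dist[OF hA, of x v] h by simp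
  moreover have "adj (h v) c'" using Aut_adj[OF hA, of v c] h c by simp
  ultimately have "h v = v" using parent_unique[of "h v" c' v x] c by simp
  then show ?thesis using h by blast
qed

lemma fix_nbrs_imp_id:
  assumes g: "g v = v" and *: "\<And>w a. g w = w \<Longrightarrow> adj w a \<Longrightarrow> g a = a"
  shows "g = id"
proof -
  have "g w = w" for w
  proof (induction "d v w" arbitrary: w)
    case 0 then show ?case using g by simp
  next
    case (Suc n)
    then have "v \<noteq> w" by auto
    then obtain p where p: "adj p w" "d v w = Suc (d v p)" using parent_ex by blast
    then have "g p = p" using Suc by simp
    then show ?case using * p by blast
  qed
  then show ?thesis by auto
qed

text \<open>Otherwise an element of \<open>N\<close> fixing a vertex fixes its neighbours, hence
  everything, and \<open>N\<close> acts freely. This is contradicted by a commutator of an element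
  \<open>g\<close> of \<open>N\<close> with some \<open>h\<close> in \<open>H\<close> that fixes a
  segment from \<open>x\<close> to \<open>g x\<close>, where \<open>x\<close> has minimal
  displacement under \<open>g\<close>.\<close>

lemma normal_acts_locally:
  assumes H: "is_subgroup H" and st: "sphere_transitive adj H" and ev: "even_moving H"
    and N: "normal_in N H" and nt: "N \<noteq> {id}"
  shows "\<exists>v a. \<exists>n\<in>N. n v = v \<and> adj v a \<and> n a \<noteq> a"
proof (rule ccontr)
  assume "\<not> ?thesis"
  then have triv: "n a = a" if "n \<in> N" "n v = v" "adj v a" for n v a using that by blast
  note HD = is_subgroupD[OF H]
  have NS: "is_subgroup N" and NH: "N \<subseteq> H" and conj: "\<And>h n. h \<in> H \<Longrightarrow> n \<in> N \<Longrightarrow> h \<circ> n \<circ> finv h \<in> N"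
    using N by (auto simp: normal_in_def)
  note ND = is_subgroupD[OF NS]
  have free: "n = id" if "n \<in> N" "n v = v" for n v
    using fix_nbrs_imp_id[of n v, OF that(2)] triv[OF that(1)] by blast
  obtain g where g: "g \<in> N" "g \<noteq> id" using nt ND(2) by blast
  note gA = ND(5)[OF g(1)]
  obtain x where x: "\<And>y. d x (g x) \<le> d y (g y)"
    using ex_has_least_nat[of "\<lambda>_. True" undefined "\<lambda>x. d x (g x)"] by blast
  define m where "m = d x (g x)"
  have "m \<noteq> 0" using free[OF g(1), of x] g(2) by (auto simp: m_def)
  moreover have "even m" using ev g(1) NH by (auto simp: m_def even_moving_def)
  ultimately have m2: "2 \<le> m" by (rule even_ge2)
  obtain p where p: "d x p = 1" "d p (g x) = m - 1" using between_ex[of 1 x "g x"] m2 by (auto simp: m_def)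
  have xp: "adj x p" using p(1) dist_eq_1 by blast
  have a: "adj (g x) (g p)" using xp gA by simp
  from a show False
  proof (cases rule: dist_adj_cases[where x = x])
    \<comment> \<open>The step from \<open>g x\<close> to \<open>g p\<close> runs back towards
      \<open>x\<close>, so \<open>p\<close> is displaced by only \<open>m - 2\<close>, against
      minimality.\<close>
    case 2
    obtain z where z: "d p z = m - 2" "d z (g x) = 1"
    proof -
      have "m - 2 \<le> d p (g x)" "d p (g x) - (m - 2) = 1" using p(2) m2 by linarith+
      then show ?thesis using between_ex[of "m - 2" p "g x"] that by auto
    qed
    have "d x z = m - 1"
      using dist_triangle[of x z p] dist_triangle[of x "g x" z] z p m2 by (auto simp: m_def)
    moreover have "d x (g p) = m - 1" using 2 by (simp add: m_def)
    moreover have "adj z (g x)" using z(2) dist_eq_1 by blast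
    ultimately have "z = g p"
    proof -
      have "d x (g x) = Suc (m - 1)" using m2 unfolding m_def by linarith
      then show ?thesis
        using parent_unique[of z "g x" "g p" x] \<open>d x z = m - 1\<close> \<open>d x (g p) = m - 1\<close> \<open>adj z (g x)\<close> adj_sym[OF a]
        by metis
    qed
    then have "d p (g p) = m - 2" using z(1) by metis
    then have "d p (g p) < m" using m2 by linarith
    then show False using x[of p] by (simp add: m_def)
  next
    case 1
    obtain b where b: "adj (g x) b" "d x b = Suc (d x (g x))" "b \<noteq> g p"
      using two_children[of "g x" x] by metis
    obtain h where h: "h \<in> H" "h x = x" "h (g x) = g x" "h (g p) = b"
      using move_child[OF HD(1) st a b(1) 1 b(2)] by blast
    note hA = HD(5)[OF h(1)]
    \<comment> \<open>Since \<open>h\<close> fixes \<open>x\<close>, \<open>p\<close> and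
      \<open>g x\<close>, this commutator fixes \<open>g x\<close> and is trivial by freeness. Yet
      it takes \<open>g p\<close> to \<open>h (g p) = b\<close>.\<close>
    define k where "k = (h \<circ> g \<circ> finv h) \<circ> finv g"
    have kN: "k \<in> N" unfolding k_def using ND(3) conj[OF h(1) g(1)] ND(4)[OF g(1)] by blast
    have "finv h x = x" using h(2) hA by (metis Aut_inv_f)
    then have "k (g x) = g x" using gA h by (simp add: k_def)
    then have kid: "k = id" using free[OF kN] by blast
    have "h p = p"
    proof (rule between_unique[of x _ "g x"])
      show "d x (h p) + d (h p) (g x) = d x (g x)" "d x (h p) = d x p"
        using Aut_dist[OF hA, of x p] Aut_dist[OF hA, of p "g x"] h p m2 by (simp_all add: m_def)
      show "d x p + d p (g x) = d x (g x)" using p m2 by (simp add: m_def)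
    qed
    then have "finv h p = p" using hA by (metis Aut_inv_f)
    then have "k (g p) = h (g p)" using gA by (simp add: k_def)
    then show False using kid h(4) b(3) by simp
  qed
qed

text \<open>If \<open>h\<close> fixes \<open>v\<close> and \<open>a\<close> and takes
  \<open>n a\<close> to \<open>b\<close>, then the conjugate of \<open>n\<close> by \<open>h\<close>
  takes \<open>a\<close> to \<open>b\<close>. Such \<open>h\<close> exist because \<open>n a\<close>
  and \<open>b\<close> are both children of \<open>v\<close> as seen from \<open>a\<close>.
  Conjugation then transports the statement from \<open>v\<close> to \<open>w\<close>.\<close>

lemma normal_nbrs_transitive:
  assumes H: "is_subgroup H" and st: "sphere_transitive adj H" and N: "normal_in N H"
    and n: "n \<in> N" "n v = v" "adj v a" "n a \<noteq> a" and w: "even (d v w)" and bc: "adj w b" "adj w c"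
  shows "\<exists>k\<in>N. k w = w \<and> k b = c"
proof -
  note HD = is_subgroupD[OF H]
  have NS: "is_subgroup N" and NH: "N \<subseteq> H" and conj: "\<And>h n. h \<in> H \<Longrightarrow> n \<in> N \<Longrightarrow> h \<circ> n \<circ> finv h \<in> N"
    using N by (auto simp: normal_in_def)
  note ND = is_subgroupD[OF NS]
  have inv_fix: "finv h y = z" if "h \<in> Aut adj" "h z = y" for h y z
    using that Aut_inv_f by metis
  have from_a: "\<exists>k\<in>N. k v = v \<and> k a = b" if b: "adj v b" for b
  proof (cases "b = a")
    case True then show ?thesis using ND(2) by (intro bexI[of _ id]) auto
  next
    case False
    have na: "adj v (n a)" using Aut_adj[OF ND(5)[OF n(1)], of v a] n by simp
    have "d a v = 1" using n(3) dist_eq_1 dist_sym by metis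
    then obtain h where h: "h \<in> H" "h a = a" "h v = v" "h (n a) = b"
      using move_child[OF HD(1) st na b, of a] dist_two_nbrs[OF n(3) na] dist_two_nbrs[OF n(3) b] n(4) False
      by fastforce
    note hA = HD(5)[OF h(1)]
    have "(h \<circ> n \<circ> finv h) a = b" "(h \<circ> n \<circ> finv h) v = v"
      using inv_fix[OF hA h(2)] inv_fix[OF hA h(3)] h n(2) by simp_all
    then show ?thesis using conj[OF h(1) n(1)] by blast
  qed
  obtain h where h: "h \<in> H" "h v = w" using sphere_transitive_even[OF st w] by blast
  note hA = HD(5)[OF h(1)]
  let ?i = "finv h"
  have iw: "?i w = v" using inv_fix[OF hA h(2)] .
  have "adj v (?i b)" "adj v (?i c)" using Aut_adj[OF Aut_inv[OF hA]] bc iw by metis+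
  then obtain k1 k2 where k1: "k1 \<in> N" "k1 v = v" "k1 a = ?i b" and k2: "k2 \<in> N" "k2 v = v" "k2 a = ?i c"
    using from_a by meson
  define k where "k = k2 \<circ> finv k1"
  have k: "k \<in> N" "k v = v" "k (?i b) = ?i c"
    using ND k1 k2 inv_fix[OF ND(5)[OF k1(1)] k1(2)] inv_fix[OF ND(5)[OF k1(1)] k1(3)] by (auto simp: k_def)
  have "(h \<circ> k \<circ> ?i) w = w" "(h \<circ> k \<circ> ?i) b = c" using k iw h(2) hA by simp_all
  then show ?thesis using conj[OF h(1) k(1)] by blast
qed

text \<open>\<open>N\<close> permutes transitively the neighbours of every vertex at even distance
  from \<open>v\<close>. Chaining these moves makes it transitive on the vertices at odd distance,
  so any such vertex, for example \<open>a\<close>, can serve as \<open>y\<close>.\<close>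

lemma normal_cocompact:
  assumes H: "is_subgroup H" and st: "sphere_transitive adj H" and ev: "even_moving H"
    and N: "normal_in N H" and nt: "N \<noteq> {id}"
  shows "\<exists>y. \<forall>h\<in>H. \<exists>n\<in>N. \<exists>k\<in>H. k y = y \<and> h = n \<circ> k"
proof -
  note HD = is_subgroupD[OF H]
  have NS: "is_subgroup N" and NH: "N \<subseteq> H" using N by (auto simp: normal_in_def)
  note ND = is_subgroupD[OF NS]
  obtain v a n where n: "n \<in> N" "n v = v" "adj v a" "n a \<noteq> a"
    using normal_acts_locally[OF assms] by blast
  have trans: "\<exists>n\<in>N. n y = y'" if "odd (d v y)" "d y y' = 2 * k" for y y' k
    using that
  proof (induction k arbitrary: y)
    case 0
    then show ?case using ND(2) by (intro bexI[of _ id]) auto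
  next
    case (Suc k)
    obtain y2 where y2: "d y y2 = 2" "d y2 y' = 2 * k" using between_ex[of 2 y y'] Suc.prems by auto
    obtain w where w: "d y w = 1" "d w y2 = 1" using between_ex[of 1 y y2] y2 by auto
    have "even (d v w)" using dist_parity[of v y w] Suc.prems(1) w by simp
    moreover have "adj w y" "adj w y2" using w dist_eq_1 adj_sym by blast+
    ultimately obtain k1 where k1: "k1 \<in> N" "k1 y = y2"
      using normal_nbrs_transitive[OF H st N n] by blast
    have "odd (d v y2)" using dist_parity[of v y y2] Suc.prems(1) y2 by simp
    then obtain k2 where k2: "k2 \<in> N" "k2 y2 = y'" using Suc.IH y2 by blast
    then show ?case using ND(3)[OF k2(1) k1(1)] k1 by (intro bexI[of _ "k2 \<circ> k1"]) auto
  qed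
  have oa: "odd (d v a)" using n(3) dist_eq_1 by (metis odd_one)
  have "\<exists>n\<in>N. \<exists>k\<in>H. k a = a \<and> h = n \<circ> k" if h: "h \<in> H" for h
  proof -
    have "even (d a (h a))" using ev h by (auto simp: even_moving_def)
    then obtain k where "d a (h a) = 2 * k" by (rule evenE)
    then obtain m where m: "m \<in> N" "m a = h a" using trans[OF oa] by blast
    note mA = ND(5)[OF m(1)]
    let ?k = "finv m \<circ> h"
    have "?k \<in> H" using HD(3) ND(4)[OF m(1)] NH h by blast
    moreover have "?k a = a" using m(2) mA Aut_inv_f by (metis comp_apply)
    moreover have "h = m \<circ> ?k" using mA by auto
    ultimately show ?thesis using m(1) by blast
  qed
  then show ?thesis by blast
qed

text \<open>\<open>M\<close> is \<open>N U\<close>, with \<open>U\<close> the pointwise stabiliser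
  in \<open>H\<close> of a ball about \<open>y\<close>. The ball contains a finite set
  \<open>A\<close> on which no element of \<open>N\<close> agrees with a certain \<open>h\<close>
  fixing \<open>y\<close>; this keeps \<open>h\<close> out of \<open>M\<close>.\<close>

lemma open_normal_proper:
  assumes H: "is_subgroup H" and st: "sphere_transitive adj H" and ev: "even_moving H"
    and N: "normal_in N H" and nt: "N \<noteq> {id}" and cl: "closedin AutT N" and ne: "N \<noteq> H"
  shows "\<exists>M y r. normal_in M H \<and> M \<noteq> H \<and> (\<forall>u\<in>H. (\<forall>a. d y a \<le> r \<longrightarrow> u a = a) \<longrightarrow> u \<in> M)
    \<and> (\<exists>h\<in>H. h y = y \<and> h \<notin> M)"
proof -
  note HD = is_subgroupD[OF H]
  have NS: "is_subgroup N" and NH: "N \<subseteq> H" and conj: "\<And>h n. h \<in> H \<Longrightarrow> n \<in> N \<Longrightarrow> h \<circ> n \<circ> finv h \<in> N"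
    using N by (auto simp: normal_in_def)
  note ND = is_subgroupD[OF NS]
  obtain y where y: "\<And>h. h \<in> H \<Longrightarrow> \<exists>n\<in>N. \<exists>k\<in>H. k y = y \<and> h = n \<circ> k"
    using normal_cocompact[OF H st ev N nt] by blast
  obtain h0 where h0: "h0 \<in> H" "h0 \<notin> N" using ne NH by blast
  obtain n0 h where nh: "n0 \<in> N" "h \<in> H" "h y = y" "h0 = n0 \<circ> h" using y[OF h0(1)] by blast
  have hN: "h \<notin> N" using nh h0(2) ND(3) by blast
  obtain A where A: "finite A" "\<And>n. n \<in> N \<Longrightarrow> \<exists>a\<in>A. n a \<noteq> h a"
  proof -
    have "\<not> (\<forall>A. finite A \<longrightarrow> (\<exists>n\<in>N. \<forall>a\<in>A. n a = h a))"
      using cl[unfolded closedin_aut_iff, THEN conjunct2, rule_format, OF HD(5)[OF nh(2)]] hN by metis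
    then show ?thesis using that by blast
  qed
  \<comment> \<open>The sum is merely an upper bound for all distances from \<open>y\<close> to
    \<open>A\<close>.\<close>
  define r where "r = (\<Sum>a\<in>A. d y a)"
  have Ar: "d y a \<le> r" if "a \<in> A" for a unfolding r_def using A(1) that by (simp add: member_le_sum)
  define U where "U = {u \<in> H. \<forall>a. d y a \<le> r \<longrightarrow> u a = a}"
  define M where "M = {n \<circ> u | n u. n \<in> N \<and> u \<in> U}"
  have UH: "u \<in> H" "u \<in> Aut adj" if "u \<in> U" for u using that HD(5) by (auto simp: U_def)
  have NA: "n \<in> Aut adj" "n \<in> H" if "n \<in> N" for n using that ND(5) NH by auto
  have U1: "u \<circ> u' \<in> U" if "u \<in> U" "u' \<in> U" for u u' using that HD(3) by (auto simp: U_def)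
  have U2: "finv u \<in> U" if "u \<in> U" for u
    using that HD(4) HD(5) by (auto simp: U_def) (metis Aut_inv_f)
  have U3: "k \<circ> u \<circ> finv k \<in> U" if u: "u \<in> U" and k: "k \<in> H" "k y = y" for k u
  proof -
    note kA = HD(5)[OF k(1)]
    have "u (finv k a) = finv k a" if "d y a \<le> r" for a
    proof -
      have "d y (finv k a) = d y a" using Aut_dist[OF kA, of y "finv k a"] k(2) kA by simp
      then show ?thesis using u that by (simp add: U_def)
    qed
    then show ?thesis using HD(3) HD(4) k u kA by (auto simp: U_def)
  qed
  have idU: "id \<in> U" using HD(2) by (auto simp: U_def)
  have MS: "is_subgroup M"
    unfolding is_subgroup_def
  proof (intro conjI ballI)
    show "M \<subseteq> Aut adj" unfolding M_def using UH NA Aut_comp by blast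
    show "id \<in> M" unfolding M_def using idU ND(2) comp_id[of id, symmetric] by blast
  next
    fix g g' assume "g \<in> M" "g' \<in> M"
    then obtain n u n' u' where g: "n \<in> N" "u \<in> U" "g = n \<circ> u" "n' \<in> N" "u' \<in> U" "g' = n' \<circ> u'" unfolding M_def by blast
    have "g \<circ> g' = (n \<circ> (u \<circ> n' \<circ> finv u)) \<circ> (u \<circ> u')"
      using UH(2)[OF g(2)] unfolding g by (auto simp: fun_eq_iff)
    then show "g \<circ> g' \<in> M" unfolding M_def using ND(3) conj UH(1) U1 g by blast
  next
    fix g assume "g \<in> M"
    then obtain n u where g: "n \<in> N" "u \<in> U" "g = n \<circ> u" unfolding M_def by blast
    let ?u = "finv u"
    have "finv g = (?u \<circ> finv n \<circ> finv ?u) \<circ> ?u"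
      using UH(2)[OF g(2)] NA(1)[OF g(1)] unfolding g by (auto simp: fun_eq_iff inv_comp_apply inv_inv_Aut)
    then show "finv g \<in> M" unfolding M_def using ND(4) conj UH(1) U2 g by blast
  qed
  have MH: "M \<subseteq> H" unfolding M_def using UH NA HD(3) by blast
  have "normal_in M H"
    unfolding normal_in_def
  proof (intro conjI ballI MS MH)
    fix g m assume g: "g \<in> H" and "m \<in> M"
    then obtain n u where m: "n \<in> N" "u \<in> U" "m = n \<circ> u" unfolding M_def by blast
    obtain p k where pk: "p \<in> N" "k \<in> H" "k y = y" "g = p \<circ> k" using y[OF g] by blast
    define u' where "u' = k \<circ> u \<circ> finv k"
    have u': "u' \<in> U" unfolding u'_def by (rule U3[OF m(2) pk(2,3)])
    \<comment> \<open>With \<open>g = p \<circ> k\<close>, conjugating \<open>u\<close> by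
      \<open>g\<close> gives \<open>p u' p^-1\<close>, which equals
      \<open>p (u' p^-1 u'^-1) u'\<close>. Everything before the last \<open>u'\<close> lies in
      \<open>N\<close>.\<close>
    define q where "q = (g \<circ> n \<circ> finv g) \<circ> (p \<circ> (u' \<circ> finv p \<circ> finv u'))"
    have "q \<in> N" unfolding q_def using conj[OF g m(1)] conj[OF UH(1)[OF u'] ND(4)[OF pk(1)]] pk(1) ND(3) by blast
    moreover have "g \<circ> m \<circ> finv g = q \<circ> u'"
      using NA(1)[OF pk(1)] HD(5)[OF pk(2)] UH(2)[OF u'] HD(5)[OF g] unfolding q_def m(3)
      by (auto simp: fun_eq_iff) (simp add: u'_def pk(4) inv_comp_apply)
    ultimately show "g \<circ> m \<circ> finv g \<in> M" unfolding M_def using u' by blast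
  qed
  moreover have hM: "h \<notin> M"
  proof
    assume "h \<in> M"
    then obtain n u where m: "n \<in> N" "u \<in> U" "h = n \<circ> u" unfolding M_def by blast
    have "\<forall>a\<in>A. n a = h a" using m Ar by (auto simp: U_def)
    then show False using A(2)[OF m(1)] by auto
  qed
  moreover have "u \<in> M" if "u \<in> H" "\<forall>a. d y a \<le> r \<longrightarrow> u a = a" for u
  proof -
    have "u \<in> U" "u = id \<circ> u" using that by (simp_all add: U_def)
    then show ?thesis unfolding M_def using ND(2) by blast
  qed
  ultimately show ?thesis using nh by blast
qed

section \<open>Groups that agree locally\<close>

text \<open>The stabiliser is transitive on spheres of unbounded size.\<close>

lemma stabilizer_infinite:
  assumes "sphere_transitive adj J"
  shows "infinite {j \<in> J. j x = x}"
proof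
  assume fin: "finite {j \<in> J. j x = x}"
  have "card {s. d x s = k} \<le> card {j \<in> J. j x = x}" for k
  proof -
    obtain r where r: "r \<in> rays adj" "r 0 = x" using ray_through[of x x 0] by auto
    have "d x (r k) = k" using ray_dist[OF r(1), of 0 k] r(2) by simp
    then have "{s. d x s = k} \<subseteq> (\<lambda>j. j (r k)) ` {j \<in> J. j x = x}"
      using sphere_transitiveD[OF assms, of x "r k"] by (force simp: image_iff)
    then show ?thesis using fin by (meson card_image_le card_mono finite_imageI le_trans)
  qed
  then have bound: "card {s. d x s = k} \<le> card {j \<in> J. j x = x}" for k .
  have grow: "k \<le> card {s. d x s = k}" for k
  proof (induction k)
    case (Suc k) then show ?case using card_sphere_less[of x k] by linarith
  qed simp
  show False
    using bound[of "Suc (card {j \<in> J. j x = x})"] grow[of "Suc (card {j \<in> J. j x = x})"] by linarith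
qed

text \<open>Pigeonhole: infinitely many stabiliser elements have finitely many restrictions to the
  ball, and two with the same restriction differ by the required element.\<close>

lemma fix_ball_nontrivial:
  assumes J: "is_subgroup J" and st: "sphere_transitive adj J"
  shows "\<exists>j\<in>J. j \<noteq> id \<and> (\<forall>a. d x a \<le> n \<longrightarrow> j a = a)"
proof -
  note JD = is_subgroupD[OF J]
  let ?B = "{a. d x a \<le> n}" and ?S = "{j \<in> J. j x = x}"
  have "(\<lambda>j. restrict j ?B) ` ?S \<subseteq> ?B \<rightarrow>\<^sub>E ?B"
  proof (rule image_subsetI, rule PiE_I)
    fix j a assume "j \<in> ?S" "a \<in> ?B"
    then show "restrict j ?B a \<in> ?B" using Aut_dist[OF JD(5), of j x a] by auto
  qed auto
  then have "finite ((\<lambda>j. restrict j ?B) ` ?S)"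
    using finite_PiE[OF finite_ball, of x n "\<lambda>_. ?B"] finite_ball finite_subset by blast
  then have "\<not> inj_on (\<lambda>j. restrict j ?B) ?S" using stabilizer_infinite[OF st, of x] finite_imageD by blast
  then obtain j k where jk: "j \<in> J" "k \<in> J" "j \<noteq> k" "restrict j ?B = restrict k ?B"
    unfolding inj_on_def by blast
  note kA = JD(5)[OF jk(2)]
  let ?h = "finv k \<circ> j"
  have "?h \<in> J" using JD(3) JD(4) jk by blast
  moreover have "?h \<noteq> id"
  proof
    assume "?h = id"
    then have "j a = k a" for a using kA by (metis Aut_f_inv comp_apply id_apply)
    then show False using jk(3) by auto
  qed
  moreover have "?h a = a" if "d x a \<le> n" for a
    using fun_cong[OF jk(4), of a] that kA by simp
  ultimately show ?thesis by blast
qed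

end

text \<open>Two groups \<open>H\<close> and \<open>J\<close> inducing the same permutations on large balls around the ends of an
  edge \<open>{x, y}\<close>. The quotient map from \<open>H\<close> to \<open>H/M\<close> is transported to \<open>J\<close> along the amalgam
  decomposition of \<open>J\<close>; the set \<open>\<Gamma>\<close> of words in pairs of local elements is the preimage in \<open>J \<times> H\<close>
  of the graph of the transported map.\<close>

locale close_groups = thick_tree adj for adj :: "'v \<Rightarrow> 'v \<Rightarrow> bool" +
  fixes H J M :: "('v \<Rightarrow> 'v) set" and x y :: 'v and n :: nat
  assumes H: "is_subgroup H" and J: "is_subgroup J" and M: "normal_in M H"
    and xy: "adj x y"
    and fixM: "\<And>u. u \<in> H \<Longrightarrow> (\<And>a. d x a \<le> n \<Longrightarrow> d y a \<le> n \<Longrightarrow> u a = a) \<Longrightarrow> u \<in> M"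
    and close: "\<And>j z. j \<in> J \<Longrightarrow> z \<in> {x, y} \<Longrightarrow> j z = z \<Longrightarrow> \<exists>h\<in>H. \<forall>a. d z a \<le> n \<longrightarrow> h a = j a"
begin

lemmas HD = is_subgroupD[OF H]
lemmas JD = is_subgroupD[OF J]

lemma MS: "is_subgroup M" and MH: "M \<subseteq> H" and Mconj: "\<And>h m. h \<in> H \<Longrightarrow> m \<in> M \<Longrightarrow> h \<circ> m \<circ> finv h \<in> M"
  using M by (auto simp: normal_in_def)

lemmas MD = is_subgroupD[OF MS]

lemma Mconj': "h \<in> H \<Longrightarrow> m \<in> M \<Longrightarrow> finv h \<circ> m \<circ> h \<in> M"
  using Mconj[OF HD(4), of h m] inv_inv_Aut[OF HD(5), of h] by simp

text \<open>The graph of a map from the stabiliser of \<open>z\<close> in \<open>J\<close> to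
  \<open>H/M\<close>, pulled back to \<open>H\<close>: \<open>j\<close> goes to the class of any
  \<open>h\<close> that agrees with it near \<open>z\<close>. The factor \<open>m\<close> makes the
  relation depend only on that class.\<close>

definition P :: "'v \<Rightarrow> (('v \<Rightarrow> 'v) \<times> ('v \<Rightarrow> 'v)) set" where
  "P z = {(j, h). j \<in> J \<and> j z = z \<and> h \<in> H \<and> (\<exists>m\<in>M. \<forall>a. d z a \<le> n \<longrightarrow> h (m a) = j a)}"

definition pair_mult :: "(('v \<Rightarrow> 'v) \<times> ('v \<Rightarrow> 'v)) \<Rightarrow> (('v \<Rightarrow> 'v) \<times> ('v \<Rightarrow> 'v)) \<Rightarrow> (('v \<Rightarrow> 'v) \<times> ('v \<Rightarrow> 'v))"
    (infixl "\<odot>" 70) where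
  "p \<odot> q = (fst p \<circ> fst q, snd p \<circ> snd q)"

definition pair_inv :: "(('v \<Rightarrow> 'v) \<times> ('v \<Rightarrow> 'v)) \<Rightarrow> (('v \<Rightarrow> 'v) \<times> ('v \<Rightarrow> 'v))" where
  "pair_inv p = (finv (fst p), finv (snd p))"

lemma pair_mult_assoc: "p \<odot> q \<odot> r = p \<odot> (q \<odot> r)"
  by (simp add: pair_mult_def comp_assoc)

definition other :: "'v \<Rightarrow> 'v" where "other z = (if z = x then y else x)"

lemma xny: "x \<noteq> y" using xy adj_irrefl by auto

lemma other [simp]: "other x = y" "other y = x" using xny by (auto simp: other_def)

lemma other_in: "z \<in> {x, y} \<Longrightarrow> other z \<in> {x, y}" "z \<in> {x, y} \<Longrightarrow> other (other z) = z"
  "z \<in> {x, y} \<Longrightarrow> adj z (other z)" "z \<in> {x, y} \<Longrightarrow> adj (other z) z"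
  using xy adj_sym by auto

lemma PD: "p \<in> P z \<Longrightarrow> fst p \<in> J" "p \<in> P z \<Longrightarrow> fst p z = z" "p \<in> P z \<Longrightarrow> snd p \<in> H"
  "p \<in> P z \<Longrightarrow> fst p \<in> Aut adj" "p \<in> P z \<Longrightarrow> snd p \<in> Aut adj"
  by (auto simp: P_def JD(5) HD(5))

lemma P_mult:
  assumes "p \<in> P z" "q \<in> P z" shows "p \<odot> q \<in> P z"
proof -
  obtain j h where p: "p = (j, h)" by (cases p)
  obtain k g where q: "q = (k, g)" by (cases q)
  obtain m where m: "m \<in> M" "\<And>a. d z a \<le> n \<Longrightarrow> h (m a) = j a" using assms p by (auto simp: P_def)
  obtain l where l: "l \<in> M" "\<And>a. d z a \<le> n \<Longrightarrow> g (l a) = k a" using assms q by (auto simp: P_def)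
  have J': "j \<in> J" "k \<in> J" "j z = z" "k z = z" "h \<in> H" "g \<in> H" using PD assms p q by force+
  let ?m = "(finv g \<circ> m \<circ> g) \<circ> l"
  have "?m \<in> M" using MD(3) Mconj'[OF J'(6) m(1)] l(1) by blast
  moreover have "(h \<circ> g) (?m a) = (j \<circ> k) a" if a: "d z a \<le> n" for a
  proof -
    have "d z (k a) \<le> n" using Aut_dist[OF JD(5)[OF J'(2)], of z a] J'(4) a by simp
    then show ?thesis using m(2)[of "k a"] l(2)[OF a] HD(5)[OF J'(6)] by simp
  qed
  moreover have "j \<circ> k \<in> J" "h \<circ> g \<in> H" "(j \<circ> k) z = z" using J' JD(3) HD(3) by auto
  ultimately have "(j \<circ> k, h \<circ> g) \<in> P z" unfolding P_def mem_Collect_eq prod.case by blast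
  then show ?thesis by (simp add: pair_mult_def p q)
qed

lemma P_inv:
  assumes "p \<in> P z" shows "pair_inv p \<in> P z"
proof -
  obtain j h where p: "p = (j, h)" by (cases p)
  obtain m where m: "m \<in> M" "\<And>a. d z a \<le> n \<Longrightarrow> h (m a) = j a" using assms p by (auto simp: P_def)
  have J': "j \<in> J" "j z = z" "h \<in> H" using PD assms p by force+
  note jA = JD(5)[OF J'(1)] and hA = HD(5)[OF J'(3)] and mA = MD(5)[OF m(1)]
  let ?m = "h \<circ> finv m \<circ> finv h"
  have "?m \<in> M" using Mconj[OF J'(3) MD(4)[OF m(1)]] .
  moreover have jz: "finv j z = z" using J'(2) jA by (metis Aut_inv_f)
  moreover have "finv h (?m a) = finv j a" if a: "d z a \<le> n" for a
  proof -
    have "d z (finv j a) \<le> n" using Aut_dist[OF Aut_inv[OF jA], of z a] jz a by simp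
    then have "h (m (finv j a)) = a" using m(2)[of "finv j a"] jA by simp
    then have "finv m (finv h a) = finv j a" using hA mA by (metis Aut_inv_f)
    then show ?thesis using hA by simp
  qed
  moreover have "finv j \<in> J" "finv h \<in> H" using J' JD(4) HD(4) by auto
  ultimately have "(finv j, finv h) \<in> P z" unfolding P_def mem_Collect_eq prod.case by blast
  then show ?thesis by (simp add: pair_inv_def p)
qed

text \<open>The amalgam condition: the local maps at \<open>x\<close> and \<open>y\<close> agree on
  the edge stabiliser. The two elements of \<open>H\<close> compared with \<open>j\<close> coincide,
  up to \<open>M\<close>, on the intersection of the two balls, and \<open>fixM\<close> puts their
  quotient in \<open>M\<close>.\<close>

lemma P_edge:
  assumes z: "z \<in> {x, y}" and p: "p \<in> P z" "fst p (other z) = other z"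
  shows "p \<in> P (other z)"
proof -
  obtain j h where p': "p = (j, h)" by (cases p)
  obtain m where m: "m \<in> M" "\<And>a. d z a \<le> n \<Longrightarrow> h (m a) = j a" using p p' by (auto simp: P_def)
  have J': "j \<in> J" "j z = z" "h \<in> H" "j (other z) = other z" using PD p p' by force+
  obtain g where g: "g \<in> H" "\<And>a. d (other z) a \<le> n \<Longrightarrow> g a = j a"
    using close[OF J'(1) other_in(1)[OF z] J'(4)] by blast
  note hA = HD(5)[OF J'(3)] and mA = MD(5)[OF m(1)]
  let ?u = "finv m \<circ> finv h \<circ> g"
  have "m \<in> H" using m(1) MH by blast
  then have "?u \<in> H" using HD(3)[OF HD(3)[OF HD(4) HD(4)[OF J'(3)]] g(1)] by blast
  moreover have "?u a = a" if "d x a \<le> n" "d y a \<le> n" for a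
  proof -
    have "d z a \<le> n" "d (other z) a \<le> n" using that z by auto
    then have "g a = h (m a)" using g m by simp
    then show ?thesis using hA mA by simp
  qed
  ultimately have "?u \<in> M" by (rule fixM)
  then have "m \<circ> ?u \<in> M" using MD(3) m(1) by blast
  moreover have "h ((m \<circ> ?u) a) = j a" if "d (other z) a \<le> n" for a using g(2)[OF that] hA mA by simp
  ultimately show ?thesis unfolding P_def p' mem_Collect_eq prod.case using J' by blast
qed

lemma P_id: "(id, h) \<in> P x \<Longrightarrow> h \<in> M"
proof -
  assume "(id, h) \<in> P x"
  then obtain m where m: "m \<in> M" "\<And>a. d x a \<le> n \<Longrightarrow> h (m a) = a" and h: "h \<in> H" by (auto simp: P_def)
  have "h \<circ> m \<in> M" using fixM[of "h \<circ> m"] m HD(3)[OF h] MH by auto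
  then have "(h \<circ> m) \<circ> finv m \<in> M" using MD m(1) by blast
  moreover have "(h \<circ> m) \<circ> finv m = h" using MD(5)[OF m(1)] by auto
  ultimately show "h \<in> M" by simp
qed

lemma P_ex:
  assumes z: "z \<in> {x, y}" and j: "j \<in> J" "j z = z"
  shows "\<exists>h. (j, h) \<in> P z"
proof -
  obtain h where "h \<in> H" "\<forall>a. d z a \<le> n \<longrightarrow> h a = j a" using close[OF j(1) z j(2)] by blast
  then have "(j, h) \<in> P z" using j MD(2) by (auto simp: P_def intro!: bexI[of _ id])
  then show ?thesis by blast
qed

text \<open>\<open>red z\<close> consists of the reduced words ending with a letter from \<open>P z\<close>. Acting on the two
  half-trees of the edge \<open>{x, y}\<close>, they play ping-pong and so are nontrivial.\<close>

inductive red :: "'v \<Rightarrow> (('v \<Rightarrow> 'v) \<times> ('v \<Rightarrow> 'v)) \<Rightarrow> bool" where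
  base: "z \<in> {x, y} \<Longrightarrow> p \<in> P z \<Longrightarrow> fst p (other z) \<noteq> other z \<Longrightarrow> red z p"
| step: "z \<in> {x, y} \<Longrightarrow> red (other z) q \<Longrightarrow> p \<in> P z \<Longrightarrow> fst p (other z) \<noteq> other z \<Longrightarrow> red z (q \<odot> p)"

lemma red_side: "red z t \<Longrightarrow> z \<in> {x, y}"
  by (induction rule: red.induct) auto

text \<open>The letters over the edge stabiliser, the amalgamated part. By \<open>P_edge\<close> the
  choice of \<open>x\<close> over \<open>y\<close> makes no difference.\<close>

definition Pe where "Pe = {p \<in> P x. fst p y = y}"

definition \<Gamma> where "\<Gamma> = {t. t \<in> Pe \<or> red x t \<or> red y t}"

lemma PeI: "z \<in> {x, y} \<Longrightarrow> p \<in> P z \<Longrightarrow> fst p (other z) = other z \<Longrightarrow> p \<in> Pe"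
  using P_edge[of z p] PD(2)[of p z] by (auto simp: Pe_def)

lemma PeD: "z \<in> {x, y} \<Longrightarrow> p \<in> Pe \<Longrightarrow> p \<in> P z \<and> fst p z = z \<and> fst p (other z) = other z"
  using P_edge[of x p] PD(2)[of p x] by (auto simp: Pe_def)

lemma fst_pair_mult [simp]: "fst (p \<odot> q) = fst p \<circ> fst q" by (simp add: pair_mult_def)

lemma red_Pe:
  assumes "red z t" "e \<in> Pe" shows "red z (t \<odot> e)"
  using assms(1)
proof (cases rule: red.cases)
  case base
  then show ?thesis using PeD[OF base(1) assms(2)] P_mult by (intro red.base) auto
next
  case (step q p)
  then show ?thesis unfolding step(1) pair_mult_assoc
    using PeD[OF step(2) assms(2)] P_mult by (intro red.step) auto
qed

lemma Pe_mult: "p \<in> Pe \<Longrightarrow> q \<in> Pe \<Longrightarrow> p \<odot> q \<in> Pe"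
  by (auto simp: Pe_def P_mult)

lemma \<Gamma>_side: "red z t \<Longrightarrow> t \<in> \<Gamma>"
  using red_side[of z t] by (auto simp: \<Gamma>_def)

lemma P_in_\<Gamma>: "z \<in> {x, y} \<Longrightarrow> p \<in> P z \<Longrightarrow> p \<in> \<Gamma>"
  using PeI[of z p] red.base[of z p] \<Gamma>_side by (cases "fst p (other z) = other z") (auto simp: \<Gamma>_def)

text \<open>Reduction of a word after appending a letter: letters over the edge stabiliser are
  absorbed, a letter from the side of the last one merges with it, any other lengthens the
  word.\<close>

lemma \<Gamma>_mult_P:
  assumes t: "t \<in> \<Gamma>" and z: "z \<in> {x, y}" and s: "s \<in> P z"
  shows "t \<odot> s \<in> \<Gamma>"
proof (cases "fst s (other z) = other z")
  case True
  then have s': "s \<in> Pe" using PeI[OF z s] by blast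
  show ?thesis using t red_Pe[OF _ s'] Pe_mult[OF _ s'] unfolding \<Gamma>_def by blast
next
  case False
  consider "t \<in> Pe" | "red (other z) t" | "red z t" using t z by (auto simp: \<Gamma>_def)
  then show ?thesis
  proof cases
    case 1
    then show ?thesis using PeD[OF z 1] P_mult[OF _ s] P_in_\<Gamma>[OF z] by blast
  next
    case 2
    then show ?thesis using red.step[OF z 2 s False] \<Gamma>_side by blast
  next
    case 3
    then show ?thesis
    proof (cases rule: red.cases)
      case base
      then show ?thesis using P_mult[OF _ s] P_in_\<Gamma>[OF z] by blast
    next
      case (step q p)
      have ps: "p \<odot> s \<in> P z" using P_mult step(4) s by blast
      show ?thesis
      proof (cases "fst (p \<odot> s) (other z) = other z")
        case True
        then show ?thesis unfolding step(1) pair_mult_assoc using red_Pe[OF step(3)] PeI[OF z ps] \<Gamma>_side by blast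
      next
        case False
        then show ?thesis unfolding step(1) pair_mult_assoc using red.step[OF z step(3) ps] \<Gamma>_side by blast
      qed
    qed
  qed
qed

lemma \<Gamma>_mult: assumes "s \<in> \<Gamma>" "t \<in> \<Gamma>" shows "s \<odot> t \<in> \<Gamma>"
proof -
  have "red z t \<Longrightarrow> s \<odot> t \<in> \<Gamma>" for z
  proof (induction rule: red.induct)
    case (base z p) then show ?case using \<Gamma>_mult_P assms(1) by blast
  next
    case (step z q p) then show ?case using \<Gamma>_mult_P by (simp add: pair_mult_assoc[symmetric])
  qed
  moreover have "t \<in> Pe \<Longrightarrow> s \<odot> t \<in> \<Gamma>" using \<Gamma>_mult_P[OF assms(1), of x t] by (auto simp: Pe_def)
  ultimately show ?thesis using assms(2) by (auto simp: \<Gamma>_def)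
qed

lemma \<Gamma>_sub: "t \<in> \<Gamma> \<Longrightarrow> fst t \<in> J \<and> snd t \<in> H"
proof -
  have "red z t \<Longrightarrow> fst t \<in> J \<and> snd t \<in> H" for z
  proof (induction rule: red.induct)
    case (base z p) then show ?case using PD by blast
  next
    case (step z q p)
    then show ?case using JD(3)[OF _ PD(1)[OF step(3)]] HD(3)[OF _ PD(3)[OF step(3)]]
      unfolding pair_mult_def fst_conv snd_conv by blast
  qed
  moreover have "t \<in> Pe \<Longrightarrow> fst t \<in> J \<and> snd t \<in> H" by (auto simp: Pe_def PD)
  ultimately show "t \<in> \<Gamma> \<Longrightarrow> fst t \<in> J \<and> snd t \<in> H" by (auto simp: \<Gamma>_def)
qed

lemma pair_inv_mult:
  assumes "p \<in> \<Gamma>" "q \<in> \<Gamma>" shows "pair_inv (p \<odot> q) = pair_inv q \<odot> pair_inv p"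
  using \<Gamma>_sub[OF assms(1)] \<Gamma>_sub[OF assms(2)] JD(5) HD(5)
  by (simp add: pair_inv_def pair_mult_def fun_eq_iff inv_comp_apply)

lemma \<Gamma>_inv: assumes "t \<in> \<Gamma>" shows "pair_inv t \<in> \<Gamma>"
proof -
  have "red z t \<Longrightarrow> pair_inv t \<in> \<Gamma>" for z
  proof (induction rule: red.induct)
    case (base z p) then show ?case using P_inv P_in_\<Gamma> by blast
  next
    case (step z q p)
    have "pair_inv (q \<odot> p) = pair_inv p \<odot> pair_inv q" using pair_inv_mult \<Gamma>_side[OF step(2)] P_in_\<Gamma>[OF step(1,3)] by blast
    then show ?case using \<Gamma>_mult P_in_\<Gamma>[OF step(1) P_inv[OF step(3)]] step(5) by simp
  qed
  moreover have "t \<in> Pe \<Longrightarrow> pair_inv t \<in> \<Gamma>" using P_inv[of t x] P_in_\<Gamma>[of x] by (auto simp: Pe_def)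
  ultimately show ?thesis using assms by (auto simp: \<Gamma>_def)
qed

text \<open>The half-tree containing \<open>z\<close> that remains when the edge is removed.\<close>

definition X where "X z = {v. d v z < d v (other z)}"

text \<open>The image of \<open>u\<close> reaches the fixed vertex \<open>z\<close> through the
  image of \<open>other z\<close>. As this differs from \<open>other z\<close>, the latter lies on
  the far side of \<open>z\<close>.\<close>

lemma ping:
  assumes z: "z \<in> {x, y}" and p: "p \<in> P z" "fst p (other z) \<noteq> other z" and u: "u \<in> X (other z)"
  shows "fst p u \<in> X z - {z}"
proof -
  let ?o = "other z" and ?j = "fst p"
  note jA = PD(4)[OF p(1)] and jz = PD(2)[OF p(1)]
  note zo = other_in(3,4)[OF z]
  have u': "d u z = Suc (d u ?o)"
    using u dist_adj_cases[OF zo(1), of u] other_in(2)[OF z] by (auto simp: X_def)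
  have w: "adj (?j ?o) z" using Aut_adj[OF jA, of ?o z] jz zo by simp
  have du: "d (?j u) z = Suc (d (?j u) (?j ?o))"
    using Aut_dist[OF jA, of u z] Aut_dist[OF jA, of u ?o] jz u' by simp
  have "d (?j u) ?o = Suc (d (?j u) z)"
    using dist_adj_cases[OF zo(1), of "?j u"] parent_unique[OF w zo(2) du] p(2) by metis
  then show ?thesis using du by (auto simp: X_def)
qed

text \<open>Letters alternate between the two sides, so each sends the half-tree produced by the
  previous one into the opposite one. Omitting the root \<open>z'\<close> is what later excludes
  that \<open>other z\<close> is mapped to itself.\<close>

lemma pong: "red z t \<Longrightarrow> \<forall>u\<in>X (other z). \<exists>z'\<in>{x, y}. fst t u \<in> X z' - {z'}"
proof (induction rule: red.induct)
  case (base z p)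
  then show ?case using ping by blast
next
  case (step z q p)
  show ?case
  proof
    fix u assume "u \<in> X (other z)"
    then have "fst p u \<in> X (other (other z))" using ping[OF step(1,3,4)] other_in(2)[OF step(1)] by auto
    then show "\<exists>z'\<in>{x, y}. fst (q \<odot> p) u \<in> X z' - {z'}" using step by simp
  qed
qed

lemma red_not_id: "red z t \<Longrightarrow> fst t \<noteq> id"
proof
  assume t: "red z t" "fst t = id"
  note z = red_side[OF t(1)]
  have ne: "other z \<noteq> z" using z xny by auto
  have "d (other z) z \<noteq> 0" using ne by simp
  then have "0 < d (other z) z" by blast
  then have "other z \<in> X (other z)" unfolding X_def using other_in(2)[OF z] by simp
  then obtain z' where z': "z' \<in> {x, y}" "other z \<in> X z' - {z'}" using pong[OF t(1)] t(2) by fastforce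
  then have "z' = z" using z by auto
  then show False using z' other_in(2)[OF z] by (auto simp: X_def)
qed

text \<open>Single-valuedness of the transported map modulo \<open>M\<close>: over \<open>id\<close>
  there are no reduced words, only edge letters.\<close>

lemma \<Gamma>_id: assumes "(id, h) \<in> \<Gamma>" shows "h \<in> M"
  using assms red_not_id P_id by (auto simp: \<Gamma>_def Pe_def) (metis fst_conv)+

text \<open>The two stabilisers generate \<open>J\<close>. Walking out from \<open>x\<close>, every
  vertex is an image, under a first component of \<open>\<Gamma>\<close>, of the end of the edge
  with its parity; an element of \<open>J\<close> is then corrected by one fixing \<open>x\<close>.
  Evenness ensures that \<open>j x\<close> is reached from \<open>x\<close> and not from
  \<open>y\<close>.\<close>

lemma \<Gamma>_surj:
  assumes st: "sphere_transitive adj J" and ev: "even_moving J" and j: "j \<in> J"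
  shows "\<exists>h. (j, h) \<in> \<Gamma>"
proof -
  have *: "\<exists>t\<in>\<Gamma>. fst t (if even (d x v) then x else y) = v" for v
  proof (induction "d x v" arbitrary: v)
    case 0
    have "(id, id) \<in> P x" using JD(2) HD(2) MD(2) by (auto simp: P_def intro!: bexI[of _ id])
    then show ?case using 0 P_in_\<Gamma>[of x] by (intro bexI[of _ "(id, id)"]) auto
  next
    case (Suc k)
    then have "x \<noteq> v" by auto
    then obtain p where p: "adj p v" "d x v = Suc (d x p)" using parent_ex by blast
    define z where "z = (if even (d x p) then x else y)"
    have z: "z \<in> {x, y}" "other z = (if even (d x v) then x else y)" using p(2) by (auto simp: z_def)
    have "k = d x p" using Suc.hyps(2) p(2) by simp
    from Suc.hyps(1)[OF this] obtain t where t: "t \<in> \<Gamma>" "fst t z = p" unfolding z_def by blast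
    have tA: "fst t \<in> Aut adj" using \<Gamma>_sub[OF t(1)] JD(5) by blast
    define w where "w = finv (fst t) v"
    have w: "fst t w = v" using tA by (simp add: w_def)
    have "adj z w" using Aut_adj[OF tA, of z w] p(1) t(2) w by simp
    then have "d z (other z) = d z w" using dist_eq_1 other_in(3)[OF z(1)] by metis
    then obtain k where k: "k \<in> J" "k z = z" "k (other z) = w" using sphere_transitiveD[OF st] by blast
    obtain h where h: "(k, h) \<in> P z" using P_ex[OF z(1) k(1,2)] by blast
    have "t \<odot> (k, h) \<in> \<Gamma>" by (rule \<Gamma>_mult_P[OF t(1) z(1) h])
    moreover have "fst (t \<odot> (k, h)) (other z) = v" using k w by simp
    ultimately show ?case using z(2) by metis
  qed
  have "even (d x (j x))" using ev j by (auto simp: even_moving_def)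
  then obtain t where t: "t \<in> \<Gamma>" "fst t x = j x" using *[of "j x"] by auto
  obtain k g where kg: "t = (k, g)" by (cases t)
  have k: "k \<in> J" using \<Gamma>_sub[OF t(1)] kg by simp
  note kA = JD(5)[OF k]
  let ?j = "finv k \<circ> j"
  have "?j \<in> J" "?j x = x" using JD(3) JD(4) k j t(2) kg kA by (auto, metis Aut_inv_f)
  then obtain h where "(?j, h) \<in> P x" using P_ex[of x] by blast
  then have "t \<odot> (?j, h) \<in> \<Gamma>" using \<Gamma>_mult_P[OF t(1)] by blast
  moreover have "t \<odot> (?j, h) = (j, g \<circ> h)" using kA unfolding kg pair_mult_def by auto
  ultimately show ?thesis by metis
qed

text \<open>\<open>N\<close> is the kernel of the transported map to \<open>H/M\<close>. It contains
  the pointwise stabiliser of a ball, so it is nontrivial and closed; \<open>j0\<close> is sent to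
  the class of \<open>h0\<close>, so it is proper.\<close>

theorem close_not_simple:
  assumes st: "sphere_transitive adj J" and ev: "even_moving J" and cl: "closedin AutT J"
    and h0: "h0 \<in> H" "h0 y = y" "h0 \<notin> M" and j0: "j0 \<in> J" "\<And>a. d y a \<le> n \<Longrightarrow> j0 a = h0 a"
  shows "\<exists>N. normal_in N J \<and> closedin AutT N \<and> N \<noteq> {id} \<and> N \<noteq> J"
proof -
  define N where "N = {j. \<exists>m\<in>M. (j, m) \<in> \<Gamma>}"
  have NJ: "N \<subseteq> J" using \<Gamma>_sub by (force simp: N_def)
  have fixN: "j \<in> N" if "j \<in> J" "\<And>a. d x a \<le> n \<Longrightarrow> j a = a" for j
  proof -
    have "(j, id) \<in> P x" using that HD(2) MD(2) by (auto simp: P_def intro!: bexI[of _ id])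
    then show ?thesis unfolding N_def using P_in_\<Gamma>[of x] MD(2) by blast
  qed
  have NS: "is_subgroup N"
    unfolding is_subgroup_def
  proof (intro conjI ballI)
    show "N \<subseteq> Aut adj" using NJ JD(1) by blast
    show "id \<in> N" using fixN[of id] JD(2) by simp
  next
    fix g h assume "g \<in> N" "h \<in> N"
    then obtain m m' where "m \<in> M" "(g, m) \<in> \<Gamma>" "m' \<in> M" "(h, m') \<in> \<Gamma>" unfolding N_def by blast
    then show "g \<circ> h \<in> N" using \<Gamma>_mult[of "(g, m)" "(h, m')"] MD(3) unfolding N_def by (auto simp: pair_mult_def)
  next
    fix g assume "g \<in> N"
    then obtain m where "m \<in> M" "(g, m) \<in> \<Gamma>" unfolding N_def by blast
    then show "finv g \<in> N" using \<Gamma>_inv[of "(g, m)"] MD(4) unfolding N_def by (auto simp: pair_inv_def)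
  qed
  have "normal_in N J"
    unfolding normal_in_def
  proof (intro conjI ballI NS NJ)
    fix j g assume j: "j \<in> J" and "g \<in> N"
    then obtain m where m: "m \<in> M" "(g, m) \<in> \<Gamma>" unfolding N_def by blast
    obtain h where h: "(j, h) \<in> \<Gamma>" using \<Gamma>_surj[OF st ev j] by blast
    have "(j, h) \<odot> (g, m) \<odot> pair_inv (j, h) \<in> \<Gamma>" using \<Gamma>_mult \<Gamma>_inv h m by blast
    moreover have "h \<circ> m \<circ> finv h \<in> M" using Mconj m \<Gamma>_sub[OF h] by simp
    ultimately show "j \<circ> g \<circ> finv j \<in> N" unfolding N_def by (auto simp: pair_mult_def pair_inv_def)
  qed
  moreover have "closedin AutT N"
    unfolding closedin_aut_iff
  proof (intro conjI ballI impI)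
    show "N \<subseteq> Aut adj" using NJ JD(1) by blast
    fix g assume g: "g \<in> Aut adj" "\<forall>A. finite A \<longrightarrow> (\<exists>h\<in>N. \<forall>a\<in>A. h a = g a)"
    have gJ: "g \<in> J"
      by (rule cl[unfolded closedin_aut_iff, THEN conjunct2, rule_format, OF g(1)]) (use g(2) NJ in blast)
    obtain k where k: "k \<in> N" "\<And>a. d x a \<le> n \<Longrightarrow> k a = g a" using g(2) finite_ball[of x n] by blast
    note kA = is_subgroupD(5)[OF NS k(1)]
    have "finv k \<circ> g \<in> N"
    proof (rule fixN)
      show "finv k \<circ> g \<in> J" using gJ k(1) NJ JD(3) JD(4) by blast
      fix a assume "d x a \<le> n"
      then have "g a = k a" using k(2) by simp
      then show "(finv k \<circ> g) a = a" using kA by simp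
    qed
    then have "k \<circ> (finv k \<circ> g) \<in> N" using is_subgroupD(3)[OF NS k(1)] by blast
    moreover have "k \<circ> (finv k \<circ> g) = g" using kA by auto
    ultimately show "g \<in> N" by simp
  qed
  moreover have "N \<noteq> {id}" using fix_ball_nontrivial[OF J st, of x n] fixN by blast
  moreover have "N \<noteq> J"
  proof
    assume "N = J"
    then obtain m where m: "m \<in> M" "(j0, m) \<in> \<Gamma>" using j0(1) unfolding N_def by blast
    have "j0 y = y" using j0(2)[of y] h0(2) by simp
    then have "(j0, h0) \<in> P y" using j0 h0 MD(2) by (auto simp: P_def intro!: bexI[of _ id])
    then have "pair_inv (j0, m) \<odot> (j0, h0) \<in> \<Gamma>" using \<Gamma>_mult \<Gamma>_inv[OF m(2)] P_in_\<Gamma>[of y] by blast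
    moreover have "pair_inv (j0, m) \<odot> (j0, h0) = (id, finv m \<circ> h0)"
      using JD(5)[OF j0(1)] by (auto simp: pair_inv_def pair_mult_def)
    ultimately have "finv m \<circ> h0 \<in> M" using \<Gamma>_id by simp
    then have "m \<circ> (finv m \<circ> h0) \<in> M" using MD(3) m(1) by blast
    moreover have "m \<circ> (finv m \<circ> h0) = h0" using MD(5)[OF m(1)] by auto
    ultimately show False using h0(3) by simp
  qed
  ultimately show ?thesis by blast
qed

end

section \<open>The Chabauty space of closed subgroups\<close>

text \<open>\<open>P\<close> is a partial map given by its graph. For finite \<open>P\<close> the
  groups realizing it, and those that do not, form a subbase of the Chabauty topology
  (\<open>openin_Chab_iff\<close>).\<close>

definition realizes :: "('v \<Rightarrow> 'v) set \<Rightarrow> ('v \<times> 'v) set \<Rightarrow> bool" where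
  "realizes H P \<longleftrightarrow> (\<exists>h\<in>H. \<forall>(a, b)\<in>P. h a = b)"

context thick_tree
begin

abbreviation Sub :: "('v \<Rightarrow> 'v) set set" where
  "Sub \<equiv> closed_subgroups (aut_group adj) (aut_topology adj)"

abbreviation Chab :: "('v \<Rightarrow> 'v) set topology" where
  "Chab \<equiv> chabauty (aut_group adj) (aut_topology adj)"

lemma Sub_iff: "H \<in> Sub \<longleftrightarrow> is_subgroup H \<and> closedin AutT H"
  by (simp add: closed_subgroups_def subgroup_aut_iff is_subgroup_def)

abbreviation nbhd where
  "nbhd \<equiv> chabauty_nbhd (aut_group adj) (aut_topology adj)"

abbreviation same_germs ("_ \<approx>[_] _" [51, 0, 51] 50) where
  "J \<approx>[\<P>] H \<equiv> (\<forall>P\<in>\<P>. realizes J P \<longleftrightarrow> realizes H P)"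

lemma topspace_Chab: "topspace Chab = Sub"
  by (rule topspace_chabauty[OF topological_group_aut])

lemma set_mult_aut: "g \<in> H <#>\<^bsub>aut_group adj\<^esub> U \<longleftrightarrow> (\<exists>h\<in>H. \<exists>u\<in>U. g = h \<circ> u)"
  by (auto simp: set_mult_def aut_group_def)

lemma one_aut: "\<one>\<^bsub>aut_group adj\<^esub> = id"
  by (simp add: aut_group_def)

lemma chabauty_nbhd_in_open:
  assumes "K \<subseteq> Aut adj" "compactin AutT K" "finite A" "\<A> \<subseteq> Sub"
    and "\<And>J. J \<in> nbhd H K {g \<in> Aut adj. \<forall>a\<in>A. g a = id a} \<Longrightarrow> J \<in> \<A>"
  shows "\<exists>K U. compactin AutT K \<and> openin AutT U \<and> \<one>\<^bsub>aut_group adj\<^esub> \<in> U \<and>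
    nbhd H K U \<subseteq> \<A>"
proof (intro exI conjI)
  show "compactin AutT K" by fact
  show "openin AutT {g \<in> Aut adj. \<forall>a\<in>A. g a = id a}" by (rule open_aut_agree) fact
  show "\<one>\<^bsub>aut_group adj\<^esub> \<in> {g \<in> Aut adj. \<forall>a\<in>A. g a = id a}" by (simp add: one_aut Aut_id)
  show "nbhd H K {g \<in> Aut adj. \<forall>a\<in>A. g a = id a} \<subseteq> \<A>"
    using assms(5) by blast
qed

text \<open>Take \<open>K\<close> to be the single element realizing \<open>P\<close> and
  \<open>U\<close> the pointwise stabiliser of the domain: an element of \<open>J\<close> in the
  same \<open>U\<close>-coset takes the same values.\<close>

lemma open_realizes:
  assumes P: "finite P" shows "openin Chab {H \<in> Sub. realizes H P}"
  unfolding openin_chabauty chabauty_open_def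
proof (intro conjI ballI)
  fix H assume "H \<in> {H \<in> Sub. realizes H P}"
  then obtain h where h: "h \<in> H" "\<forall>(a, b)\<in>P. h a = b" and HS: "H \<in> Sub" by (auto simp: realizes_def)
  have hA: "h \<in> Aut adj" using HS h(1) is_subgroupD(5) by (auto simp: Sub_iff)
  show "\<exists>K U. compactin AutT K \<and> openin AutT U \<and> \<one>\<^bsub>aut_group adj\<^esub> \<in> U \<and>
    nbhd H K U \<subseteq> {H \<in> Sub. realizes H P}"
  proof (rule chabauty_nbhd_in_open[of "{h}" "fst ` P"])
    fix J assume J: "J \<in> nbhd H {h} {g \<in> Aut adj. \<forall>a\<in>fst ` P. g a = id a}"
    then have "h \<in> J <#>\<^bsub>aut_group adj\<^esub> {g \<in> Aut adj. \<forall>a\<in>fst ` P. g a = id a}"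
      using h(1) by (auto simp: chabauty_nbhd_def)
    then obtain j u where "j \<in> J" "h = j \<circ> u" "\<forall>a\<in>fst ` P. u a = a" unfolding set_mult_aut by auto
    then have "j \<in> J" "\<forall>(a, b)\<in>P. j a = b" using h(2) by force+
    then show "J \<in> {H \<in> Sub. realizes H P}" using J unfolding realizes_def chabauty_nbhd_def by blast
  qed (use hA P in \<open>auto simp: topspace_aut_topology\<close>)
qed auto

lemma open_not_realizes:
  assumes P: "finite P" shows "openin Chab {H \<in> Sub. \<not> realizes H P}"
\<comment> \<open>The empty map is realized by \<open>id\<close>. Otherwise one pair of
  \<open>P\<close> yields a compact \<open>K\<close> containing every automorphism that extends
  \<open>P\<close>.\<close>
proof (cases "P = {}")
  case True
  have "realizes H P" if "H \<in> Sub" for H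
    using that is_subgroupD(2) by (auto simp: realizes_def True Sub_iff)
  then have "{H \<in> Sub. \<not> realizes H P} = {}" by blast
  then show ?thesis by (metis openin_empty)
next
  case False
  then obtain v w where vw: "(v, w) \<in> P" by auto
  show ?thesis
    unfolding openin_chabauty chabauty_open_def
  proof (intro conjI ballI)
    fix H assume H: "H \<in> {H \<in> Sub. \<not> realizes H P}"
    let ?U = "{g \<in> Aut adj. \<forall>a\<in>fst ` P. g a = id a}"
    show "\<exists>K U. compactin AutT K \<and> openin AutT U \<and> \<one>\<^bsub>aut_group adj\<^esub> \<in> U \<and>
      nbhd H K U \<subseteq> {H \<in> Sub. \<not> realizes H P}"
    proof (rule chabauty_nbhd_in_open[of "{g \<in> Aut adj. g v = w}" "fst ` P"])
      fix J assume J: "J \<in> nbhd H {g \<in> Aut adj. g v = w} ?U"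
      then have JS: "J \<in> Sub" by (simp add: chabauty_nbhd_def)
      have "\<not> realizes J P"
      proof
        assume "realizes J P"
        then obtain j where j: "j \<in> J" "\<forall>(a, b)\<in>P. j a = b" by (auto simp: realizes_def)
        have "j \<in> Aut adj" using j(1) JS is_subgroupD(5) by (auto simp: Sub_iff)
        then have "j \<in> J \<inter> {g \<in> Aut adj. g v = w}" using j vw by auto
        then have "j \<in> H <#>\<^bsub>aut_group adj\<^esub> ?U"
          using J unfolding chabauty_nbhd_def by blast
        then obtain h u where "h \<in> H" "j = h \<circ> u" "\<forall>a\<in>fst ` P. u a = a" unfolding set_mult_aut by auto
        then have "h \<in> H" "\<forall>(a, b)\<in>P. h a = b" using j(2) by force+
        then show False using H by (auto simp: realizes_def)
      qed
      then show "J \<in> {H \<in> Sub. \<not> realizes H P}" using JS by blast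
    qed (use P compact_aut_coset in auto)
  qed auto
qed

text \<open>Finitely many cosets of the pointwise stabiliser of a finite set \<open>A\<close> cover
  \<open>K\<close>, and only the restrictions of their representatives to \<open>A\<close>
  matter.\<close>

lemma chabauty_nbhd_realizes:
  assumes H: "H \<in> Sub" and K: "compactin AutT K" and U: "openin AutT U" "id \<in> U"
  shows "\<exists>\<P>. finite \<P> \<and> (\<forall>P\<in>\<P>. finite P) \<and>
    (\<forall>J\<in>Sub. J \<approx>[\<P>] H \<longrightarrow> J \<in> nbhd H K U)"
proof -
  obtain A where A: "finite A" "\<And>g. g \<in> Aut adj \<Longrightarrow> (\<And>a. a \<in> A \<Longrightarrow> g a = a) \<Longrightarrow> g \<in> U"
    using U unfolding openin_aut_iff by (metis id_apply)
  define V where "V k = {g \<in> Aut adj. \<forall>a\<in>A. g a = k a}" for k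
  have KA: "K \<subseteq> Aut adj" using compactin_subset_topspace[OF K] by (simp add: topspace_aut_topology)
  have "\<forall>W\<in>V ` K. openin AutT W" unfolding V_def using open_aut_agree[OF A(1)] by blast
  moreover have "K \<subseteq> \<Union>(V ` K)" using KA by (auto simp: V_def)
  ultimately obtain \<F> where \<F>: "finite \<F>" "\<F> \<subseteq> V ` K" "K \<subseteq> \<Union>\<F>"
    using K unfolding compactin_def by (meson)
  obtain L where L: "L \<subseteq> K" "finite L" "\<F> = V ` L" using finite_subset_image[OF \<F>(1,2)] by blast
  define \<P> where "\<P> = (\<lambda>k. (\<lambda>a. (a, k a)) ` A) ` L"
  have one: "J \<inter> K \<subseteq> H' <#>\<^bsub>aut_group adj\<^esub> U"
    if J: "J \<in> Sub" and H': "H' \<in> Sub" and eq: "\<forall>P\<in>\<P>. realizes J P \<longrightarrow> realizes H' P" for J H'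
  proof
    fix j assume j: "j \<in> J \<inter> K"
    then obtain k where k: "k \<in> L" "j \<in> V k" using \<F>(3) L(3) by blast
    then have jk: "\<And>a. a \<in> A \<Longrightarrow> j a = k a" "j \<in> Aut adj" by (auto simp: V_def)
    have "realizes J ((\<lambda>a. (a, k a)) ` A)" unfolding realizes_def using j jk by (intro bexI[of _ j]) auto
    then have "realizes H' ((\<lambda>a. (a, k a)) ` A)" using eq k(1) unfolding \<P>_def by blast
    then obtain h where h: "h \<in> H'" "\<And>a. a \<in> A \<Longrightarrow> h a = k a" by (auto simp: realizes_def)
    have hA: "h \<in> Aut adj" using h(1) H' is_subgroupD(5) by (auto simp: Sub_iff)
    have "finv h \<circ> j \<in> U"
    proof (rule A(2))
      show "finv h \<circ> j \<in> Aut adj" using hA jk(2) Aut_comp Aut_inv by blast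
      show "(finv h \<circ> j) a = a" if "a \<in> A" for a
        using jk(1)[OF that] h(2)[OF that, symmetric] hA by simp
    qed
    moreover have "j = h \<circ> (finv h \<circ> j)" using hA by auto
    ultimately show "j \<in> H' <#>\<^bsub>aut_group adj\<^esub> U" unfolding set_mult_aut using h(1) by blast
  qed
  have "J \<in> nbhd H K U"
    if "J \<in> Sub" "\<forall>P\<in>\<P>. realizes J P \<longleftrightarrow> realizes H P" for J
    unfolding chabauty_nbhd_def using one[OF that(1) H] one[OF H that(1)] that by blast
  moreover have "finite \<P>" "\<forall>P\<in>\<P>. finite P" using L(2) A(1) by (auto simp: \<P>_def)
  ultimately show ?thesis by blast
qed

text \<open>Replaces the compact sets and identity neighbourhoods of the Chabauty topology by finite
  combinatorial data in all that follows.\<close>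

lemma openin_Chab_iff:
  "openin Chab \<A> \<longleftrightarrow> \<A> \<subseteq> Sub \<and> (\<forall>H\<in>\<A>. \<exists>\<P>. finite \<P> \<and> (\<forall>P\<in>\<P>. finite P) \<and>
    (\<forall>J\<in>Sub. J \<approx>[\<P>] H \<longrightarrow> J \<in> \<A>))" (is "?L \<longleftrightarrow> ?R")
proof
  assume L: ?L
  then have sub: "\<A> \<subseteq> Sub" unfolding openin_chabauty chabauty_open_def by blast
  have "\<exists>\<P>. finite \<P> \<and> (\<forall>P\<in>\<P>. finite P) \<and>
    (\<forall>J\<in>Sub. J \<approx>[\<P>] H \<longrightarrow> J \<in> \<A>)" if H: "H \<in> \<A>" for H
  proof -
    obtain K U where KU: "compactin AutT K" "openin AutT U" "\<one>\<^bsub>aut_group adj\<^esub> \<in> U"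
      "nbhd H K U \<subseteq> \<A>"
      using L H unfolding openin_chabauty chabauty_open_def by metis
    have "H \<in> Sub" using sub H by blast
    from chabauty_nbhd_realizes[OF this KU(1,2) KU(3)[unfolded one_aut]]
    obtain \<P> where "finite \<P>" "\<forall>P\<in>\<P>. finite P"
      "\<And>J. J \<in> Sub \<Longrightarrow> J \<approx>[\<P>] H \<Longrightarrow> J \<in> nbhd H K U"
      by metis
    then show ?thesis using KU(4) by (intro exI[of _ \<P>]) auto
  qed
  then show ?R using sub by blast
next
  assume R: ?R
  show ?L
  proof (subst openin_subopen, intro ballI)
    fix H assume H: "H \<in> \<A>"
    then obtain \<P> where \<P>: "finite \<P>" "\<forall>P\<in>\<P>. finite P"
      "\<And>J. J \<in> Sub \<Longrightarrow> J \<approx>[\<P>] H \<Longrightarrow> J \<in> \<A>" using R by metis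
    define T where "T = {J \<in> Sub. \<forall>P\<in>\<P>. realizes J P \<longleftrightarrow> realizes H P}"
    have "openin Chab {J \<in> Sub. \<forall>P\<in>\<Q>. realizes J P \<longleftrightarrow> realizes H P}" if "finite \<Q>" "\<Q> \<subseteq> \<P>" for \<Q>
      using that
    proof (induction \<Q> rule: finite_induct)
      case empty then show ?case using openin_topspace[of Chab] by (simp add: topspace_Chab)
    next
      case (insert P \<Q>)
      have "{J \<in> Sub. \<forall>P\<in>insert P \<Q>. realizes J P \<longleftrightarrow> realizes H P} =
        {J \<in> Sub. \<forall>P\<in>\<Q>. realizes J P \<longleftrightarrow> realizes H P} \<inter>
        (if realizes H P then {J \<in> Sub. realizes J P} else {J \<in> Sub. \<not> realizes J P})" by auto
      moreover have "openin Chab (if realizes H P then {J \<in> Sub. realizes J P} else {J \<in> Sub. \<not> realizes J P})"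
        using open_realizes[of P] open_not_realizes[of P] insert.prems \<P>(2) by auto
      moreover have "openin Chab {J \<in> Sub. \<forall>P\<in>\<Q>. realizes J P \<longleftrightarrow> realizes H P}"
        using insert.IH insert.prems by blast
      ultimately show ?case by (simp only: openin_Int)
    qed
    then have "openin Chab T" unfolding T_def using \<P>(1) by blast
    moreover have "H \<in> T" "T \<subseteq> \<A>" using H R \<P>(3) by (auto simp: T_def)
    ultimately show "\<exists>T. openin Chab T \<and> H \<in> T \<and> T \<subseteq> \<A>" by blast
  qed
qed

lemma separate_closed:
  assumes "J \<in> Sub" "h \<in> Aut adj" "h \<notin> J"
  shows "\<exists>P. finite P \<and> (\<forall>(a, b)\<in>P. h a = b) \<and> \<not> realizes J P"
proof -
  have "\<not> (\<forall>A. finite A \<longrightarrow> (\<exists>j\<in>J. \<forall>a\<in>A. j a = h a))"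
    using assms(1)[unfolded Sub_iff closedin_aut_iff, THEN conjunct2, THEN conjunct2, rule_format, OF assms(2)] assms(3)
    by metis
  then obtain A where A: "finite A" "\<not> (\<exists>j\<in>J. \<forall>a\<in>A. j a = h a)" by blast
  then show ?thesis by (intro exI[of _ "(\<lambda>a. (a, h a)) ` A"]) (auto simp: realizes_def)
qed

lemma Hausdorff_Chab: "Hausdorff_space Chab"
  unfolding Hausdorff_space_def topspace_Chab
proof (intro allI impI)
  have *: "\<exists>U V. openin Chab U \<and> openin Chab V \<and> H \<in> U \<and> J \<in> V \<and> disjnt U V"
    if HJ: "H \<in> Sub" "J \<in> Sub" "\<not> H \<subseteq> J" for H J
  proof -
    obtain h where h: "h \<in> H" "h \<notin> J" using HJ by blast
    then obtain P where P: "finite P" "\<forall>(a, b)\<in>P. h a = b" "\<not> realizes J P"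
      using separate_closed[of J h] HJ is_subgroupD(5) by (auto simp: Sub_iff)
    have "realizes H P" using h(1) P(2) by (auto simp: realizes_def)
    then show ?thesis using open_realizes[OF P(1)] open_not_realizes[OF P(1)] P(3) HJ
      by (intro exI[of _ "{H \<in> Sub. realizes H P}"] exI[of _ "{H \<in> Sub. \<not> realizes H P}"]) (auto simp: disjnt_def)
  qed
  fix H J assume HJ: "H \<in> Sub \<and> J \<in> Sub \<and> H \<noteq> J"
  then have "\<not> H \<subseteq> J \<or> \<not> J \<subseteq> H" by blast
  then show "\<exists>U V. openin Chab U \<and> openin Chab V \<and> H \<in> U \<and> J \<in> V \<and> disjnt U V"
  proof
    assume "\<not> J \<subseteq> H"
    then obtain U V where "openin Chab U" "openin Chab V" "J \<in> U" "H \<in> V" "disjnt U V" using *[of J H] HJ by blast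
    then show ?thesis by (intro exI[of _ V] exI[of _ U]) (auto simp: disjnt_sym)
  qed (use * HJ in blast)
qed

text \<open>A closed subgroup is determined by the finite partial maps that its elements realize, so this
  closedness statement reduces compactness to Tychonoff's theorem.\<close>

lemma Sub_limit:
  assumes approx: "\<And>\<P>. finite \<P> \<Longrightarrow> \<exists>H\<in>Sub. \<forall>P\<in>\<P>. F P \<longleftrightarrow> finite P \<and> realizes H P"
  shows "\<exists>H\<in>Sub. \<forall>P. F P \<longleftrightarrow> finite P \<and> realizes H P"
proof -
  define L where "L = {g \<in> Aut adj. \<forall>P. finite P \<longrightarrow> (\<forall>(a, b)\<in>P. g a = b) \<longrightarrow> F P}"
  have Ffin: "finite P" if "F P" for P using approx[of "{P}"] that by auto
  have LS: "is_subgroup L"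
    unfolding is_subgroup_def
  proof (intro conjI ballI)
    show "L \<subseteq> Aut adj" by (auto simp: L_def)
    have "F P" if "finite P" "\<forall>(a, b)\<in>P. id a = b" for P
    proof -
      obtain H where H: "H \<in> Sub" "F P \<longleftrightarrow> finite P \<and> realizes H P" using approx[of "{P}"] by auto
      then show ?thesis using that is_subgroupD(2)[of H] unfolding Sub_iff realizes_def by blast
    qed
    then show "id \<in> L" by (auto simp: L_def Aut_id)
  next
    fix g h assume g: "g \<in> L" and h: "h \<in> L"
    have "F P" if P: "finite P" "\<forall>(a, b)\<in>P. (g \<circ> h) a = b" for P
    proof -
      \<comment> \<open>A group realizing both the restriction of \<open>h\<close> to the domain of
        \<open>P\<close> and that of \<open>g\<close> to its image realizes the composite, so three
        finite maps suffice for \<open>approx\<close>.\<close>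
      define Q where "Q = (\<lambda>a. (a, h a)) ` fst ` P"
      define R where "R = (\<lambda>a. (h a, g (h a))) ` fst ` P"
      have "F Q" "F R" using g h P(1) unfolding L_def Q_def R_def by auto
      moreover obtain H where H: "H \<in> Sub" "\<forall>P\<in>{P, Q, R}. F P \<longleftrightarrow> finite P \<and> realizes H P"
        using approx[of "{P, Q, R}"] by auto
      ultimately obtain h' g' where hg: "h' \<in> H" "\<forall>(a, b)\<in>Q. h' a = b" "g' \<in> H" "\<forall>(a, b)\<in>R. g' a = b"
        by (auto simp: realizes_def)
      have "(g' \<circ> h') a = b" if "(a, b) \<in> P" for a b
      proof -
        have "a \<in> fst ` P" using that by force
        then have "h' a = h a" "g' (h a) = g (h a)" using hg by (auto simp: Q_def R_def)
        then show ?thesis using P(2) that by auto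
      qed
      moreover have "g' \<circ> h' \<in> H" using hg H(1) is_subgroupD(3)[of H] unfolding Sub_iff by blast
      ultimately have "realizes H P" unfolding realizes_def by blast
      then show ?thesis using H(2) P(1) by blast
    qed
    then show "g \<circ> h \<in> L" using g h Aut_comp unfolding L_def by blast
  next
    fix g assume g: "g \<in> L"
    then have gA: "g \<in> Aut adj" by (auto simp: L_def)
    have "F P" if P: "finite P" "\<forall>(a, b)\<in>P. finv g a = b" for P
    proof -
      have "finite (P\<inverse>)" using P(1) by simp
      moreover have "\<forall>(a, b)\<in>P\<inverse>. g a = b" using P(2) gA by auto
      ultimately have "F (P\<inverse>)" using g unfolding L_def by blast
      moreover obtain H where H: "H \<in> Sub" "\<forall>P\<in>{P, P\<inverse>}. F P \<longleftrightarrow> finite P \<and> realizes H P"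
        using approx[of "{P, P\<inverse>}"] by auto
      ultimately obtain h where h: "h \<in> H" "\<forall>(a, b)\<in>P\<inverse>. h a = b" by (auto simp: realizes_def)
      have HS: "is_subgroup H" using H(1) by (simp add: Sub_iff)
      have "finv h \<in> H" using is_subgroupD(4)[OF HS h(1)] .
      moreover have "finv h a = b" if "(a, b) \<in> P" for a b
      proof -
        have "h b = a" using bspec[OF h(2), of "(b, a)"] that by simp
        then show ?thesis using Aut_inv_f[OF is_subgroupD(5)[OF HS h(1)], of b] by simp
      qed
      ultimately have "realizes H P" unfolding realizes_def by blast
      then show ?thesis using H(2) P(1) by blast
    qed
    then show "finv g \<in> L" using Aut_inv[OF gA] unfolding L_def by blast
  qed
  have "closedin AutT L"
    unfolding closedin_aut_iff
  proof (intro conjI ballI impI)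
    show "L \<subseteq> Aut adj" by (auto simp: L_def)
    fix g assume g: "g \<in> Aut adj" "\<forall>A. finite A \<longrightarrow> (\<exists>h\<in>L. \<forall>a\<in>A. h a = g a)"
    have "F P" if P: "finite P" "\<forall>(a, b)\<in>P. g a = b" for P
    proof -
      obtain h where h: "h \<in> L" "\<forall>a\<in>fst ` P. h a = g a" using g(2) P(1) by blast
      then have "\<forall>(a, b)\<in>P. h a = b" using P(2) by force
      then show ?thesis using h(1) P(1) unfolding L_def by blast
    qed
    then show "g \<in> L" using g(1) unfolding L_def by blast
  qed
  then have LSub: "L \<in> Sub" using LS by (simp add: Sub_iff)
  have "realizes L P" if FP: "F P" for P
  proof (cases "P = {}")
    case True then show ?thesis using is_subgroupD(2)[OF LS] by (auto simp: realizes_def)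
  next
    case False
    then obtain v w where vw: "(v, w) \<in> P" by auto
    define gr where "gr A g = (\<lambda>a. (a, g a)) ` A" for A and g :: "'v \<Rightarrow> 'v"
    define \<phi> where "\<phi> A g \<longleftrightarrow> (\<forall>(a, b)\<in>P. a \<in> A \<longrightarrow> g a = b) \<and> (\<forall>A'\<subseteq>A. finite A' \<longrightarrow> F (gr A' g))" for A g
    have "\<exists>g\<in>Aut adj. g v = w \<and> (\<forall>A. finite A \<longrightarrow> \<phi> A g)"
    proof (rule aut_compactness)
      fix A :: "'v set" assume A: "finite A"
      \<comment> \<open>An automorphism with \<open>g v = w\<close> sends \<open>A\<close> into the
        ball of radius \<open>R\<close> about \<open>w\<close>. All possible graphs over subsets of
        \<open>A\<close> thus form a finite family, to which \<open>approx\<close> applies before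
        \<open>g\<close> is known.\<close>
      define R where "R = (\<Sum>a\<in>A. d v a)"
      let ?B = "{b. d w b \<le> R}"
      obtain H where H: "H \<in> Sub" "\<forall>P\<in>insert P (Pow (A \<times> ?B)). F P \<longleftrightarrow> finite P \<and> realizes H P"
        using approx[of "insert P (Pow (A \<times> ?B))"] A finite_ball by auto
      have HS: "is_subgroup H" using H(1) by (simp add: Sub_iff)
      obtain g where g: "g \<in> H" "\<forall>(a, b)\<in>P. g a = b" using H(2) FP by (auto simp: realizes_def)
      note gA = is_subgroupD(5)[OF HS g(1)]
      have gv: "g v = w" using g(2) vw by auto
      have "F (gr A' g)" if A': "A' \<subseteq> A" for A'
      proof -
        have "d v a \<le> R" if "a \<in> A" for a unfolding R_def using A that by (simp add: member_le_sum)
        then have "d w (g a) \<le> R" if "a \<in> A" for a using Aut_dist[OF gA, of v a] gv that by simp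
        then have "gr A' g \<in> Pow (A \<times> ?B)" using A' by (auto simp: gr_def)
        moreover have "realizes H (gr A' g)" using g(1) by (auto simp: gr_def realizes_def)
        moreover have "finite (gr A' g)" using A A' finite_subset by (auto simp: gr_def)
        ultimately show ?thesis using H(2) by blast
      qed
      then have "\<phi> A g" using g(2) by (auto simp: \<phi>_def)
      then show "\<exists>g\<in>Aut adj. g v = w \<and> \<phi> A g" using gA gv by blast
    next
      fix A B g assume AB: "A \<subseteq> B" and \<phi>: "\<phi> B g"
      have "\<forall>A'\<subseteq>A. finite A' \<longrightarrow> F (gr A' g)" using \<phi> subset_trans[OF _ AB] unfolding \<phi>_def by simp
      moreover have "\<forall>(a, b)\<in>P. a \<in> A \<longrightarrow> g a = b" using \<phi> AB unfolding \<phi>_def by auto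
      ultimately show "\<phi> A g" unfolding \<phi>_def by simp
    next
      fix A g g' assume \<phi>: "\<phi> A g" and eq: "\<And>a. a \<in> A \<Longrightarrow> g a = g' a"
      have "gr A' g' = gr A' g" if "A' \<subseteq> A" for A'
        unfolding gr_def using that eq by (intro image_cong) auto
      then show "\<phi> A g'" using \<phi> eq unfolding \<phi>_def by fastforce
    qed
    then obtain g where g: "g \<in> Aut adj" "\<And>A. finite A \<Longrightarrow> \<phi> A g" by blast
    have "F Q" if Q: "finite Q" "\<forall>(a, b)\<in>Q. g a = b" for Q
    proof -
      have "Q = gr (fst ` Q) g" using Q(2) by (force simp: gr_def image_image)
      moreover have "F (gr (fst ` Q) g)" using g(2)[of "fst ` Q"] Q(1) unfolding \<phi>_def by blast
      ultimately show ?thesis by simp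
    qed
    then have "g \<in> L" using g(1) unfolding L_def by blast
    moreover have "\<forall>(a, b)\<in>P. g a = b" using g(2)[of "fst ` P"] Ffin[OF FP] unfolding \<phi>_def by force
    ultimately show ?thesis unfolding realizes_def by blast
  qed
  moreover have "F P" if "finite P" "realizes L P" for P
    using that unfolding L_def realizes_def by blast
  ultimately show ?thesis using LSub Ffin by blast
qed

text \<open>\<open>\<kappa>\<close> embeds the closed subgroups in a product of two-point spaces.
  Its image is closed by \<open>Sub_limit\<close>, hence compact, and the inverse map is continuous
  by \<open>openin_Chab_iff\<close>.\<close>

lemma compact_Chab: "compact_space Chab"
proof -
  let ?Y = "product_topology (\<lambda>_. discrete_topology UNIV) UNIV :: (('v \<times> 'v) set \<Rightarrow> bool) topology"
  define \<kappa> where "\<kappa> H P \<longleftrightarrow> finite P \<and> realizes H P" for H :: "('v \<Rightarrow> 'v) set" and P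
  have cY: "compact_space ?Y"
    by (simp add: compact_space_product_topology compact_space_discrete_topology)
  have basic: "openin ?Y {G. \<forall>P\<in>\<P>. G P = F P}" if "finite \<P>" for \<P> and F :: "('v \<times> 'v) set \<Rightarrow> bool"
  proof -
    have [simp]: "c \<in> (if b then {e} else UNIV) \<longleftrightarrow> (b \<longrightarrow> c = e)" for b c and e :: bool by simp
    have "{G. \<forall>P\<in>\<P>. G P = F P} = Pi\<^sub>E UNIV (\<lambda>P. if P \<in> \<P> then {F P} else UNIV)"
      by (auto simp: PiE_iff)
    moreover have "openin ?Y (Pi\<^sub>E UNIV (\<lambda>P. if P \<in> \<P> then {F P} else UNIV))"
      by (rule product_topology_basis) (auto intro: finite_subset[OF _ that])
    ultimately show ?thesis by simp
  qed
  have inj: "H = J" if HJ: "H \<in> Sub" "J \<in> Sub" "\<kappa> H = \<kappa> J" for H J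
  proof -
    have "H' \<subseteq> J'" if sub: "H' \<in> Sub" "J' \<in> Sub" "\<kappa> H' = \<kappa> J'" for H' J'
    proof
      fix h assume h: "h \<in> H'"
      show "h \<in> J'"
      proof (rule ccontr)
        assume "h \<notin> J'"
        moreover have "h \<in> Aut adj" using sub(1) h is_subgroupD(5) by (auto simp: Sub_iff)
        ultimately obtain P where P: "finite P" "\<forall>(a, b)\<in>P. h a = b" "\<not> realizes J' P"
          using separate_closed[OF sub(2)] by blast
        then have "\<kappa> H' P" "\<not> \<kappa> J' P" using h by (auto simp: \<kappa>_def realizes_def)
        then show False using sub(3) by simp
      qed
    qed
    then show ?thesis using HJ by (metis subset_antisym)
  qed
  have "closedin ?Y (\<kappa> ` Sub)"
    unfolding closedin_def
  proof
    show "openin ?Y (topspace ?Y - \<kappa> ` Sub)"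
    proof (subst openin_subopen, intro ballI)
      fix F assume F: "F \<in> topspace ?Y - \<kappa> ` Sub"
      have "\<exists>\<P>. finite \<P> \<and> (\<forall>H\<in>Sub. \<exists>P\<in>\<P>. \<not> (F P \<longleftrightarrow> finite P \<and> realizes H P))"
      proof (rule ccontr)
        assume "\<not> ?thesis"
        then have "\<exists>H\<in>Sub. \<forall>P. F P \<longleftrightarrow> finite P \<and> realizes H P" by (intro Sub_limit) blast
        then have "F \<in> \<kappa> ` Sub" by (auto simp: \<kappa>_def fun_eq_iff image_iff)
        then show False using F by blast
      qed
      then obtain \<P> where \<P>: "finite \<P>" "\<And>H. H \<in> Sub \<Longrightarrow> \<exists>P\<in>\<P>. F P \<noteq> \<kappa> H P" unfolding \<kappa>_def by blast
      have "{G. \<forall>P\<in>\<P>. G P = F P} \<inter> \<kappa> ` Sub = {}" using \<P>(2) by fastforce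
      then show "\<exists>T. openin ?Y T \<and> F \<in> T \<and> T \<subseteq> topspace ?Y - \<kappa> ` Sub"
        using basic[OF \<P>(1), of F] by (intro exI[of _ "{G. \<forall>P\<in>\<P>. G P = F P}"]) auto
    qed
  qed simp
  then have cS: "compactin ?Y (\<kappa> ` Sub)" using cY closedin_compact_space by blast
  define g where "g = inv_into Sub \<kappa>"
  have g\<kappa>: "g (\<kappa> H) = H" if "H \<in> Sub" for H
    unfolding g_def using inj that by (intro inv_into_f_f) (auto simp: inj_on_def)
  have "continuous_map (subtopology ?Y (\<kappa> ` Sub)) Chab g"
    unfolding continuous_map_def
  proof (intro conjI allI impI)
    show "g \<in> topspace (subtopology ?Y (\<kappa> ` Sub)) \<rightarrow> topspace Chab"
      using g\<kappa> by (auto simp: topspace_Chab)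
    fix \<A> assume \<A>: "openin Chab \<A>"
    show "openin (subtopology ?Y (\<kappa> ` Sub)) {F \<in> topspace (subtopology ?Y (\<kappa> ` Sub)). g F \<in> \<A>}"
    proof (subst openin_subopen, intro ballI)
      fix F assume "F \<in> {F \<in> topspace (subtopology ?Y (\<kappa> ` Sub)). g F \<in> \<A>}"
      then obtain H where H: "H \<in> Sub" "F = \<kappa> H" "H \<in> \<A>" using g\<kappa> by auto
      obtain \<P> where \<P>: "finite \<P>" "\<forall>P\<in>\<P>. finite P"
        "\<And>J. J \<in> Sub \<Longrightarrow> J \<approx>[\<P>] H \<Longrightarrow> J \<in> \<A>"
        using \<A> H(3) unfolding openin_Chab_iff by metis
      let ?T = "{G. \<forall>P\<in>\<P>. G P = F P}"
      have "openin (subtopology ?Y (\<kappa> ` Sub)) (?T \<inter> \<kappa> ` Sub)"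
        using basic[OF \<P>(1)] by (auto simp: openin_subtopology)
      moreover have "F \<in> ?T \<inter> \<kappa> ` Sub" using H by auto
      moreover have "?T \<inter> \<kappa> ` Sub \<subseteq> {F \<in> topspace (subtopology ?Y (\<kappa> ` Sub)). g F \<in> \<A>}"
      proof
        fix G assume G: "G \<in> ?T \<inter> \<kappa> ` Sub"
        then obtain J where J: "J \<in> Sub" "G = \<kappa> J" by blast
        then have "\<forall>P\<in>\<P>. realizes J P \<longleftrightarrow> realizes H P" using G \<P>(2) H(2) by (auto simp: \<kappa>_def)
        then have "J \<in> \<A>" using \<P>(3) J(1) by blast
        then show "G \<in> {F \<in> topspace (subtopology ?Y (\<kappa> ` Sub)). g F \<in> \<A>}" using J g\<kappa> by auto
      qed
      ultimately show "\<exists>T. openin (subtopology ?Y (\<kappa> ` Sub)) T \<and> F \<in> T \<and>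
        T \<subseteq> {F \<in> topspace (subtopology ?Y (\<kappa> ` Sub)). g F \<in> \<A>}" by blast
    qed
  qed
  then have "compactin Chab (g ` \<kappa> ` Sub)"
    by (rule image_compactin[rotated]) (use cS in \<open>simp add: compactin_subtopology\<close>)
  moreover have "g ` \<kappa> ` Sub = Sub" using g\<kappa> by (force simp: image_image)
  ultimately show ?thesis by (simp add: compact_space_def topspace_Chab)
qed

end

section \<open>Chabauty limits of simple groups\<close>

lemma topologically_simple_iso:
  assumes G: "group G" "topspace X = carrier G" and K: "group K" "topspace Y = carrier K"
    and iso: "topologically_isomorphic G X K Y" and simple: "topologically_simple G X"
  shows "topologically_simple K Y"
proof -
  obtain f where f: "f \<in> iso G K" "homeomorphic_map X Y f" using iso unfolding topologically_isomorphic_def by blast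
  have bij: "bij_betw f (carrier G) (carrier K)" and hom: "f \<in> hom G K" using f(1) by (auto simp: iso_def)
  interpret f: group_hom G K f using G K hom by (simp add: group_hom_def group_hom_axioms_def)
  have surj: "f ` carrier G = carrier K" and inj: "inj_on f (carrier G)" using bij by (auto simp: bij_betw_def)
  show ?thesis
    unfolding topologically_simple_def
  proof (intro conjI allI impI)
    show "carrier K \<noteq> {\<one>\<^bsub>K\<^esub>}"
    proof
      assume K1: "carrier K = {\<one>\<^bsub>K\<^esub>}"
      have "g = \<one>\<^bsub>G\<^esub>" if "g \<in> carrier G" for g
        using inj_onD[OF inj, of g "\<one>\<^bsub>G\<^esub>"] that f.hom_closed[OF that] K1 by simp
      then have "carrier G = {\<one>\<^bsub>G\<^esub>}" by auto
      then show False using simple by (simp add: topologically_simple_def)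
    qed
    fix N assume N: "N \<lhd> K" "closedin Y N"
    have NK: "subgroup N K" using N(1) normal_imp_subgroup by blast
    let ?N = "{g \<in> carrier G. f g \<in> N}"
    have "subgroup ?N G"
    proof (rule f.G.subgroupI)
      show "?N \<noteq> {}" using subgroup.one_closed[OF NK] f.G.one_closed by (metis (mono_tags, lifting) empty_Collect_eq f.hom_one)
    qed (use subgroup.m_closed[OF NK] subgroup.m_inv_closed[OF NK] in auto)
    then have "?N \<lhd> G"
      unfolding f.G.normal_inv_iff using normal.inv_op_closed2[OF N(1)] by auto
    moreover have "closedin X ?N"
      using closedin_continuous_map_preimage[OF homeomorphic_imp_continuous_map[OF f(2)] N(2)] G(2) by simp
    ultimately have "?N = {\<one>\<^bsub>G\<^esub>} \<or> ?N = carrier G" using simple by (simp add: topologically_simple_def)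
    moreover have "f ` ?N = N"
    proof
      show "N \<subseteq> f ` ?N"
      proof
        fix k assume k: "k \<in> N"
        then have "k \<in> f ` carrier G" using surj subgroup.subset[OF NK] by auto
        then show "k \<in> f ` ?N" using k by auto
      qed
    qed auto
    ultimately show "N = {\<one>\<^bsub>K\<^esub>} \<or> N = carrier K" using surj f.hom_one by auto
  qed
qed

context thick_tree
begin

abbreviation (input) sgroup :: "('v \<Rightarrow> 'v) set \<Rightarrow> ('v \<Rightarrow> 'v) monoid" where
  "sgroup H \<equiv> aut_group adj\<lparr>carrier := H\<rparr>"

abbreviation (input) subtop :: "('v \<Rightarrow> 'v) set \<Rightarrow> ('v \<Rightarrow> 'v) topology" where
  "subtop H \<equiv> subtopology AutT H"

abbreviation \<C> :: "('v \<Rightarrow> 'v) set set" where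
  "\<C> \<equiv> simple_boundary_2_transitive adj"

lemma sgroup_Sub:
  assumes "H \<in> Sub"
  shows "group (sgroup H)" "topspace (subtop H) = carrier (sgroup H)"
proof -
  have H: "subgroup H (aut_group adj)" "closedin AutT H" using assms by (auto simp: closed_subgroups_def)
  show "group (sgroup H)" by (rule subgroup.subgroup_is_group[OF H(1) group_aut_group])
  show "topspace (subtop H) = carrier (sgroup H)" using closedin_subset[OF H(2)] by (simp add: Int_absorb1)
qed

definition simple_aut :: "('v \<Rightarrow> 'v) set \<Rightarrow> bool" where
  "simple_aut H \<longleftrightarrow> H \<noteq> {id} \<and> (\<forall>N. normal_in N H \<longrightarrow> closedin AutT N \<longrightarrow> N = {id} \<or> N = H)"

lemma simple_aut_iff:
  assumes "H \<in> Sub" shows "topologically_simple (sgroup H) (subtop H) \<longleftrightarrow> simple_aut H"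
proof -
  have H: "subgroup H (aut_group adj)" "closedin AutT H" using assms by (auto simp: closed_subgroups_def)
  have "N \<lhd> sgroup H \<and> closedin (subtop H) N \<longleftrightarrow> normal_in N H \<and> closedin AutT N" for N
    unfolding normal_aut_iff[OF H(1)] normal_in_def closedin_closed_subtopology[OF H(2)]
      subgroup_aut_iff[of N, folded is_subgroup_def]
    by (rule iffI; elim conjE; intro conjI; assumption)
  then have "(\<forall>N. N \<lhd> sgroup H \<longrightarrow> closedin (subtop H) N \<longrightarrow> N = {id} \<or> N = H) \<longleftrightarrow>
      (\<forall>N. normal_in N H \<longrightarrow> closedin AutT N \<longrightarrow> N = {id} \<or> N = H)"
    by (simp only: imp_conjL[symmetric])
  moreover have "carrier (sgroup H) = H" "\<one>\<^bsub>sgroup H\<^esub> = id" by (simp_all add: aut_group_def)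
  ultimately show ?thesis
    unfolding topologically_simple_def simple_aut_def by (simp only:)
qed

lemma C_iff: "H \<in> \<C> \<longleftrightarrow> H \<in> Sub \<and> simple_aut H \<and> sphere_transitive adj H"
proof -
  have "two_transitive_on_ends adj H \<longleftrightarrow> sphere_transitive adj H" if "H \<in> Sub"
    using sphere_transitive_of_two_transitive[of H] two_transitive_of_sphere_transitive[of H] that
    unfolding Sub_iff by blast
  then show ?thesis
    unfolding simple_boundary_2_transitive_def using simple_aut_iff by auto
qed

text \<open>The type-preserving elements form a closed normal subgroup. It contains the vertex
  stabilisers, so it is nontrivial, and simplicity makes it all of \<open>H\<close>.\<close>

lemma C_even:
  assumes "H \<in> \<C>" shows "even_moving H"
proof -
  have HS: "is_subgroup H" and cl: "closedin AutT H" and s: "simple_aut H" and st: "sphere_transitive adj H"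
    using assms by (auto simp: C_iff Sub_iff)
  note HD = is_subgroupD[OF HS]
  define N where "N = {h \<in> H. \<forall>v. even (d v (h v))}"
  have NH: "N \<subseteq> H" by (auto simp: N_def)
  have comp: "even (d v (g (h v)))" if "even (d v (h v))" "even (d (h v) (g (h v)))" for g h v
    using that dist_parity[of v "h v" "g (h v)"] by simp
  have NS: "is_subgroup N"
    unfolding is_subgroup_def
  proof (intro conjI ballI)
    show "N \<subseteq> Aut adj" using HD(1) NH by blast
    show "id \<in> N" using HD(2) by (simp add: N_def)
    show "g \<circ> h \<in> N" if "g \<in> N" "h \<in> N" for g h using that HD(3) comp by (auto simp: N_def)
    show "finv g \<in> N" if "g \<in> N" for g
    proof -
      have g: "g \<in> H" "\<And>v. even (d v (g v))" using that by (auto simp: N_def)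
      have "even (d v (finv g v))" for v
        using g(2)[of "finv g v"] HD(5)[OF g(1)] by (simp add: dist_sym)
      then show ?thesis using HD(4)[OF g(1)] by (simp add: N_def)
    qed
  qed
  have "normal_in N H"
    unfolding normal_in_def
  proof (intro conjI ballI NS NH)
    fix h g assume h: "h \<in> H" and "g \<in> N"
    then have g: "g \<in> H" "\<And>v. even (d v (g v))" by (auto simp: N_def)
    have "even (d v ((h \<circ> g \<circ> finv h) v))" for v
    proof -
      have "d v (h (g (finv h v))) = d (finv h v) (g (finv h v))"
        using Aut_dist[OF HD(5)[OF h], of "finv h v" "g (finv h v)"] HD(5)[OF h] by simp
      then show ?thesis using g(2) by simp
    qed
    moreover have "h \<circ> g \<circ> finv h \<in> H" using HD(3)[OF HD(3)[OF h g(1)] HD(4)[OF h]] .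
    ultimately show "h \<circ> g \<circ> finv h \<in> N" by (simp add: N_def)
  qed
  moreover have "closedin AutT N"
    unfolding closedin_aut_iff
  proof (intro conjI ballI impI)
    show "N \<subseteq> Aut adj" using HD(1) NH by blast
    fix g assume g: "g \<in> Aut adj" "\<forall>A. finite A \<longrightarrow> (\<exists>h\<in>N. \<forall>a\<in>A. h a = g a)"
    have "g \<in> H"
      by (rule cl[unfolded closedin_aut_iff, THEN conjunct2, rule_format, OF g(1)]) (use g(2) NH in blast)
    moreover have "even (d v (g v))" for v
      using g(2)[rule_format, of "{v}"] by (auto simp: N_def) (metis)
    ultimately show "g \<in> N" by (simp add: N_def)
  qed
  moreover have "N \<noteq> {id}"
  proof -
    fix x
    obtain j where j: "j \<in> H" "j \<noteq> id" "j x = x" using fix_ball_nontrivial[OF HS st, of x 0] by auto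
    have "even (d v (j v))" for v using Aut_parity[OF HD(5)[OF j(1)], of x v] j(3) by simp
    then show ?thesis using j by (auto simp: N_def)
  qed
  ultimately have "N = H" using s unfolding simple_aut_def by blast
  then show ?thesis by (auto simp: N_def even_moving_def)
qed

text \<open>Each way of leaving \<open>\<C>\<close> has a finite witness: a pair on a sphere that
  cannot be moved, an odd displacement (excluded by \<open>C_even\<close>), or the action on two
  balls, from which \<open>close_not_simple\<close> refutes simplicity of \<open>J\<close>.\<close>

lemma C_isolated:
  assumes HS: "H \<in> Sub" and HC: "H \<notin> \<C>"
  shows "\<exists>\<P>. finite \<P> \<and> (\<forall>P\<in>\<P>. finite P) \<and>
    (\<forall>J\<in>Sub. J \<approx>[\<P>] H \<longrightarrow> J \<notin> \<C>)"
proof -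
  have H: "is_subgroup H" using HS by (simp add: Sub_iff)
  note HD = is_subgroupD[OF H]
  consider (a) "\<not> sphere_transitive adj H" | (b) "sphere_transitive adj H" "\<not> even_moving H"
    | (c) "sphere_transitive adj H" "even_moving H" "\<not> simple_aut H" using HS HC C_iff by blast
  then show ?thesis
  proof cases
    case a
    then obtain v a b where vab: "d v a = d v b" "\<not> (\<exists>h\<in>H. h v = v \<and> h a = b)" unfolding sphere_transitive_def by blast
    have "J \<notin> \<C>" if "realizes J {(v, v), (a, b)} \<longleftrightarrow> realizes H {(v, v), (a, b)}" for J
      using that vab unfolding C_iff sphere_transitive_def realizes_def by auto
    then show ?thesis by (intro exI[of _ "{{(v, v), (a, b)}}"]) auto
  next
    case b
    then obtain h v where h: "h \<in> H" "odd (d v (h v))" unfolding even_moving_def by blast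
    have "J \<notin> \<C>" if "realizes J {(v, h v)} \<longleftrightarrow> realizes H {(v, h v)}" for J
    proof
      assume "J \<in> \<C>"
      then have "even_moving J" by (rule C_even)
      moreover have "realizes H {(v, h v)}" using h by (auto simp: realizes_def)
      ultimately show False using that h(2) by (auto simp: even_moving_def realizes_def) (metis)
    qed
    then show ?thesis by (intro exI[of _ "{{(v, h v)}}"]) auto
  next
    case c
    have "H \<noteq> {id}" using fix_ball_nontrivial[OF H c(1)] by blast
    then obtain N where N: "normal_in N H" "closedin AutT N" "N \<noteq> {id}" "N \<noteq> H"
      using c(3) unfolding simple_aut_def by blast
    obtain M y r h0 where M: "normal_in M H" "\<And>u. u \<in> H \<Longrightarrow> (\<And>a. d y a \<le> r \<Longrightarrow> u a = a) \<Longrightarrow> u \<in> M"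
      and h0: "h0 \<in> H" "h0 y = y" "h0 \<notin> M"
      using open_normal_proper[OF H c(1,2) N(1,3,2,4)] by metis
    obtain x where xy: "adj x y" using third_nbr adj_sym by metis
    \<comment> \<open>The extra unit makes the \<open>r\<close>-ball about \<open>y\<close> lie in
      the \<open>n\<close>-ball about the neighbour \<open>x\<close> too, as \<open>fixM\<close>
      requires.\<close>
    define n where "n = Suc r"
    define B where "B = {a. d x a \<le> n} \<union> {a. d y a \<le> n}"
    have B: "finite B" unfolding B_def using finite_ball by blast
    \<comment> \<open>The subsets of \<open>B \<times> B\<close> include all restrictions to the two
      balls of elements fixing their centre.\<close>
    have "J \<notin> \<C>" if J: "J \<in> Sub" and eq: "\<forall>P\<in>Pow (B \<times> B). realizes J P \<longleftrightarrow> realizes H P" for J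
    proof
      assume JC: "J \<in> \<C>"
      have JS: "is_subgroup J" "closedin AutT J" "sphere_transitive adj J" "simple_aut J" "even_moving J"
        using JC C_even by (auto simp: C_iff Sub_iff)
      have match: "\<exists>h\<in>H'. \<forall>a. d z a \<le> n \<longrightarrow> h a = j a"
        if J': "is_subgroup J'" and j: "j \<in> J'" "j z = z" and z: "z \<in> {x, y}"
          and eq: "\<forall>P\<in>Pow (B \<times> B). realizes J' P \<longrightarrow> realizes H' P" for J' H' j z
      proof -
        let ?P = "(\<lambda>a. (a, j a)) ` {a. d z a \<le> n}"
        have "d z (j a) = d z a" for a using Aut_dist[OF is_subgroupD(5)[OF J' j(1)], of z a] j(2) by simp
        then have "?P \<in> Pow (B \<times> B)" using z by (auto simp: B_def)
        moreover have "realizes J' ?P" using j(1) by (auto simp: realizes_def)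
        ultimately have "realizes H' ?P" using eq by blast
        then show ?thesis by (auto simp: realizes_def)
      qed
      interpret close_groups adj H J M x y n
      proof
        show "is_subgroup H" "is_subgroup J" "normal_in M H" "adj x y" by fact+
        show "u \<in> M" if u: "u \<in> H" "\<And>a. d x a \<le> n \<Longrightarrow> d y a \<le> n \<Longrightarrow> u a = a" for u
        proof (rule M(2)[OF u(1)])
          fix a assume "d y a \<le> r"
          then show "u a = a" using u(2)[of a] dist_triangle[of x a y] dist_eq_1[of x y] xy by (simp add: n_def)
        qed
        show "\<exists>h\<in>H. \<forall>a. d z a \<le> n \<longrightarrow> h a = j a" if "j \<in> J" "z \<in> {x, y}" "j z = z" for j z
          using match[OF JS(1) that(1,3,2)] eq by blast
      qed
      obtain j0 where "j0 \<in> J" "\<And>a. d y a \<le> n \<Longrightarrow> j0 a = h0 a"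
        using match[OF H h0(1,2), of J] eq by blast
      then obtain N' where "normal_in N' J" "closedin AutT N'" "N' \<noteq> {id}" "N' \<noteq> J"
        using close_not_simple[OF JS(3,5,2) h0] by blast
      then show False using JS(4) unfolding simple_aut_def by blast
    qed
    then show ?thesis using B finite_subset by (intro exI[of _ "Pow (B \<times> B)"]) fastforce
  qed
qed

lemma C_closed: "closedin Chab \<C>"
proof -
  have "\<C> \<subseteq> Sub" using C_iff by blast
  moreover have "openin Chab (Sub - \<C>)"
    unfolding openin_Chab_iff
  proof (intro conjI ballI)
    fix H assume "H \<in> Sub - \<C>"
    then obtain \<P> where "finite \<P>" "\<forall>P\<in>\<P>. finite P"
      "\<forall>J\<in>Sub. J \<approx>[\<P>] H \<longrightarrow> J \<notin> \<C>" using C_isolated[of H] by auto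
    then show "\<exists>\<P>. finite \<P> \<and> (\<forall>P\<in>\<P>. finite P) \<and>
      (\<forall>J\<in>Sub. J \<approx>[\<P>] H \<longrightarrow> J \<in> Sub - \<C>)" by (intro exI[of _ \<P>]) auto
  qed blast
  ultimately show ?thesis by (simp add: closedin_def topspace_Chab)
qed

section \<open>Topological isomorphisms\<close>

definition stab :: "('v \<Rightarrow> 'v) set \<Rightarrow> 'v \<Rightarrow> ('v \<Rightarrow> 'v) set" where
  "stab H v = {h \<in> H. h v = v}"

lemma stab_subgroup:
  assumes "is_subgroup H" shows "is_subgroup (stab H v)"
  unfolding is_subgroup_def stab_def
  using is_subgroupD[OF assms] by (auto, metis Aut_inv_f)

text \<open>Compactness makes orbits on the discrete vertex set finite, and evenness turns the
  centre of an orbit into a fixed vertex.\<close>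

lemma compact_subgroup_fixes:
  assumes K: "is_subgroup K" and c: "compactin AutT K" and ev: "even_moving K"
  shows "\<exists>w. \<forall>k\<in>K. k w = w"
proof -
  note KD = is_subgroupD[OF K]
  fix x
  let ?F = "(\<lambda>k. k x) ` K"
  have "continuous_map AutT (discrete_topology UNIV) (\<lambda>g. g x)"
    unfolding aut_topology_def
    by (intro continuous_map_from_subtopology continuous_map_product_projection) simp
  from image_compactin[OF c this] have "finite ?F" by (simp add: compactin_discrete_topology)
  moreover have "?F \<noteq> {}" using KD(2) by blast
  moreover have "g ` ?F = ?F" if g: "g \<in> K" for g
  proof
    show "g ` ?F \<subseteq> ?F"
    proof clarify
      fix k assume "k \<in> K"
      from KD(3)[OF g this] show "g (k x) \<in> ?F" by (intro image_eqI[of _ _ "g \<circ> k"]) simp_all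
    qed
    show "?F \<subseteq> g ` ?F"
    proof
      fix y assume "y \<in> ?F"
      then obtain k where k: "k \<in> K" "y = k x" by blast
      have "finv g \<circ> k \<in> K" using KD(3)[OF KD(4)[OF g] k(1)] .
      moreover have "y = g ((finv g \<circ> k) x)" using k KD(5)[OF g] by simp
      ultimately show "y \<in> g ` ?F" by blast
    qed
  qed
  ultimately show ?thesis using fixed_vertex[of K ?F] KD(1) ev unfolding even_moving_def by blast
qed

text \<open>The stabiliser of \<open>v\<close> fixes no other vertex: it moves \<open>w\<close> to a
  sibling, as seen from \<open>v\<close>. With \<open>compact_subgroup_fixes\<close> this makes
  stabilisers maximal compact in groups that preserve types.\<close>

lemma stab_unique:
  assumes H: "is_subgroup H" and st: "sphere_transitive adj H" and sub: "stab H v \<subseteq> stab H w"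
  shows "v = w"
proof (rule ccontr)
  assume "v \<noteq> w"
  then obtain p where p: "adj p w" "d v w = Suc (d v p)" using parent_ex by blast
  obtain a b where ab: "adj p a" "adj p b" "a \<noteq> b" "d v a = Suc (d v p)" "d v b = Suc (d v p)"
    using two_children by blast
  obtain c where c: "adj p c" "c \<noteq> w" "d v c = Suc (d v p)" using ab by metis
  obtain h where "h \<in> H" "h v = v" "h w = c"
    using move_child[OF is_subgroupD(1)[OF H] st p(1) c(1) p(2) c(3)] by blast
  then show False using sub c(2) by (auto simp: stab_def)
qed

lemma stab_compact: "H \<in> Sub \<Longrightarrow> compactin AutT (stab H v)"
proof -
  assume "H \<in> Sub"
  then have H: "closedin AutT H" by (simp add: Sub_iff)
  have "stab H v = H \<inter> {g \<in> Aut adj. g v = v}" using closedin_subset[OF H] by (auto simp: stab_def topspace_aut_topology)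
  then show ?thesis using closed_Int_compactin[OF H compact_aut_coset] by simp
qed

text \<open>The image of a stabiliser is a compact subgroup of the type-preserving group
  \<open>J\<close> and so fixes a vertex.\<close>

lemma iso_stab:
  assumes H: "H \<in> \<C>" and J: "J \<in> \<C>" and hom: "\<And>g h. g \<in> H \<Longrightarrow> h \<in> H \<Longrightarrow> f (g \<circ> h) = f g \<circ> f h"
    and f: "homeomorphic_map (subtop H) (subtop J) f"
  shows "\<exists>w. f ` stab H v \<subseteq> stab J w"
proof -
  have HS: "H \<in> Sub" "is_subgroup H" and JS: "J \<in> Sub" "is_subgroup J" "even_moving J"
    using H J C_even by (auto simp: C_iff Sub_iff)
  have top: "topspace (subtop H) = H" "topspace (subtop J) = J"
    using sgroup_Sub(2)[OF HS(1)] sgroup_Sub(2)[OF JS(1)] by simp_all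
  have fH: "f h \<in> J" if "h \<in> H" for h using homeomorphic_imp_surjective_map[OF f] that unfolding top by blast
  note HD = is_subgroupD[OF HS(2)] and JD = is_subgroupD[OF JS(2)]
  let ?S = "stab H v"
  note SS = stab_subgroup[OF HS(2), of v]
  note SD = is_subgroupD[OF SS]
  have SH: "?S \<subseteq> H" by (auto simp: stab_def)
  have fid: "f id = id"
  proof -
    have "f id \<circ> f id = f id" using hom[OF HD(2) HD(2)] by simp
    then have "f id (f id x) = f id x" for x by (metis comp_apply)
    then have "f id x = x" for x using JD(5)[OF fH[OF HD(2)]] Aut_eq_iff by metis
    then show ?thesis by auto
  qed
  have finv: "finv (f h) = f (finv h)" if h: "h \<in> H" for h
  proof -
    have "h \<circ> finv h = id" using HD(5)[OF h] by auto
    then have "f h \<circ> f (finv h) = id" using hom[OF h HD(4)[OF h]] fid by simp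
    then have "f h (f (finv h) x) = x" for x by (metis comp_apply id_apply)
    then show ?thesis using JD(5)[OF fH[OF h]] by (metis Aut_inv_f ext)
  qed
  have fS: "is_subgroup (f ` ?S)"
    unfolding is_subgroup_def
  proof (intro conjI ballI)
    show "f ` ?S \<subseteq> Aut adj" using fH SH JD(1) by blast
    show "id \<in> f ` ?S" using fid SD(2) by (metis imageI)
  next
    fix g h assume "g \<in> f ` ?S" "h \<in> f ` ?S"
    then obtain g' h' where gh: "g' \<in> ?S" "h' \<in> ?S" "g = f g'" "h = f h'" by blast
    have "f (g' \<circ> h') = f g' \<circ> f h'" by (rule hom) (use gh(1,2) SH in blast)+
    then have "g \<circ> h = f (g' \<circ> h')" unfolding gh(3,4) by (rule sym)
    then show "g \<circ> h \<in> f ` ?S" using SD(3)[OF gh(1,2)] by blast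
  next
    fix g assume "g \<in> f ` ?S"
    then obtain g' where g': "g' \<in> ?S" "g = f g'" by blast
    then have "finv g = f (finv g')" using finv[of g'] SH by auto
    then show "finv g \<in> f ` ?S" using SD(4)[OF g'(1)] by blast
  qed
  have "compactin (subtop H) ?S" using stab_compact[OF HS(1)] SH by (simp add: compactin_subtopology)
  then have "compactin (subtop J) (f ` ?S)"
    using image_compactin homeomorphic_imp_continuous_map[OF f] by blast
  then have "compactin AutT (f ` ?S)" by (simp add: compactin_subtopology)
  moreover have "even_moving (f ` ?S)" using JS(3) fH SH unfolding even_moving_def by blast
  ultimately obtain w where "\<forall>k\<in>f ` ?S. k w = w" using compact_subgroup_fixes[OF fS] by blast
  then show ?thesis using fH SH by (intro exI[of _ w]) (auto simp: stab_def)
qed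

text \<open>Spheres are orbits of stabilisers, and equivariance transports orbits. At this stage
  \<open>\<alpha>\<close> might still change the radius.\<close>

lemma sphere_image:
  assumes J: "is_subgroup J" "sphere_transitive adj J"
    and H: "is_subgroup H" "sphere_transitive adj H"
    and f: "\<And>v. f ` stab H v = stab J (\<alpha> v)" and eq: "\<And>h v. h \<in> H \<Longrightarrow> f h (\<alpha> v) = \<alpha> (h v)"
  shows "\<alpha> ` {s. d v s = d v w} = {t. d (\<alpha> v) t = d (\<alpha> v) (\<alpha> w)}"
proof
  show "\<alpha> ` {s. d v s = d v w} \<subseteq> {t. d (\<alpha> v) t = d (\<alpha> v) (\<alpha> w)}"
  proof
    fix t assume "t \<in> \<alpha> ` {s. d v s = d v w}"
    then obtain s where s: "d v s = d v w" "t = \<alpha> s" by auto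
    obtain h where h: "h \<in> H" "h v = v" "h w = s" using sphere_transitiveD[OF H(2) s(1)[symmetric]] by blast
    have "f h \<in> stab J (\<alpha> v)" using f[of v] h by (auto simp: stab_def)
    then have fh: "f h \<in> J" "f h (\<alpha> v) = \<alpha> v" by (auto simp: stab_def)
    show "t \<in> {t. d (\<alpha> v) t = d (\<alpha> v) (\<alpha> w)}"
      using Aut_dist[OF is_subgroupD(5)[OF J(1) fh(1)], of "\<alpha> v" "\<alpha> w"] fh(2) eq[OF h(1), of w] h(3) s(2) by simp
  qed
  show "{t. d (\<alpha> v) t = d (\<alpha> v) (\<alpha> w)} \<subseteq> \<alpha> ` {s. d v s = d v w}"
  proof
    fix t assume "t \<in> {t. d (\<alpha> v) t = d (\<alpha> v) (\<alpha> w)}"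
    then obtain k where k: "k \<in> J" "k (\<alpha> v) = \<alpha> v" "k (\<alpha> w) = t"
      using sphere_transitiveD[OF J(2), of "\<alpha> v" "\<alpha> w" t] by auto
    then have "k \<in> f ` stab H v" unfolding f by (simp add: stab_def)
    then obtain h where h: "h \<in> H" "h v = v" "k = f h" by (auto simp: stab_def)
    have "d v (h w) = d v w" using Aut_dist[OF is_subgroupD(5)[OF H(1) h(1)], of v w] h(2) by simp
    moreover have "t = \<alpha> (h w)" using eq[OF h(1), of w] k(3) h(3) by simp
    ultimately show "t \<in> \<alpha> ` {s. d v s = d v w}" by blast
  qed
qed

definition conj_by :: "('v \<Rightarrow> 'v) \<Rightarrow> ('v \<Rightarrow> 'v) \<Rightarrow> ('v \<Rightarrow> 'v)" where
  "conj_by \<alpha> h = \<alpha> \<circ> h \<circ> finv \<alpha>"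

text \<open>The vertex stabilisers are the maximal compact subgroups, so an isomorphism permutes them;
  adjacency is recovered from the index of \<open>H\<^sub>v \<inter> H\<^sub>w\<close> in \<open>H\<^sub>v\<close>, a sphere size.\<close>

lemma iso_is_conjugation:
  assumes HC: "H \<in> \<C>" and JC: "J \<in> \<C>"
    and iso: "topologically_isomorphic (sgroup H) (subtop H) (sgroup J) (subtop J)"
  shows "\<exists>\<alpha>\<in>Aut adj. J = conj_by \<alpha> ` H"
proof -
  have HS: "H \<in> Sub" "is_subgroup H" "sphere_transitive adj H"
    and JS: "J \<in> Sub" "is_subgroup J" "sphere_transitive adj J"
    using HC JC by (auto simp: C_iff Sub_iff)
  note HD = is_subgroupD[OF HS(2)] and JD = is_subgroupD[OF JS(2)]
  obtain f where f: "f \<in> iso (sgroup H) (sgroup J)" "homeomorphic_map (subtop H) (subtop J) f"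
    using iso unfolding topologically_isomorphic_def by blast
  have bij: "bij_betw f H J" and hom: "\<And>g h. g \<in> H \<Longrightarrow> h \<in> H \<Longrightarrow> f (g \<circ> h) = f g \<circ> f h"
    using f(1) by (auto simp: iso_def hom_def aut_group_def)
  have top: "topspace (subtop H) = H" "topspace (subtop J) = J"
    using sgroup_Sub(2)[OF HS(1)] sgroup_Sub(2)[OF JS(1)] by simp_all
  have fJ: "f h \<in> J" if "h \<in> H" for h using bij that by (auto simp: bij_betw_def)
  obtain g where g: "homeomorphic_maps (subtop H) (subtop J) f g" using f(2) homeomorphic_map_maps by blast
  have gf: "g (f h) = h" if "h \<in> H" for h using g that top unfolding homeomorphic_maps_def by auto
  have fg: "f (g j) = j" "g j \<in> H" if "j \<in> J" for j
    using g that top unfolding homeomorphic_maps_def continuous_map_def by auto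
  have ghom: "g (a \<circ> b) = g a \<circ> g b" if "a \<in> J" "b \<in> J" for a b
    using hom[of "g a" "g b"] fg that gf[OF HD(3)[of "g a" "g b"]] by simp
  have gh: "homeomorphic_map (subtop J) (subtop H) g"
    using g homeomorphic_map_maps homeomorphic_maps_sym by blast
  obtain \<alpha> where \<alpha>: "\<And>v. f ` stab H v \<subseteq> stab J (\<alpha> v)"
    using iso_stab[OF HC JC hom f(2)] by metis
  obtain \<beta> where \<beta>: "\<And>w. g ` stab J w \<subseteq> stab H (\<beta> w)"
    using iso_stab[OF JC HC ghom gh] by metis
  have \<beta>\<alpha>: "\<beta> (\<alpha> v) = v" for v
  proof -
    have "stab H v \<subseteq> stab H (\<beta> (\<alpha> v))"
    proof
      fix h assume h: "h \<in> stab H v"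
      then have "g (f h) \<in> stab H (\<beta> (\<alpha> v))" using \<alpha> \<beta> by blast
      then show "h \<in> stab H (\<beta> (\<alpha> v))" using gf h by (simp add: stab_def)
    qed
    then show ?thesis using stab_unique[OF HS(2,3)] by metis
  qed
  have \<alpha>\<beta>: "\<alpha> (\<beta> w) = w" for w
  proof -
    have "stab J w \<subseteq> stab J (\<alpha> (\<beta> w))"
    proof
      fix h assume h: "h \<in> stab J w"
      then have "f (g h) \<in> stab J (\<alpha> (\<beta> w))" using \<alpha> \<beta> by blast
      then show "h \<in> stab J (\<alpha> (\<beta> w))" using fg h by (simp add: stab_def)
    qed
    then show ?thesis using stab_unique[OF JS(2,3)] by metis
  qed
  have fstab: "f ` stab H v = stab J (\<alpha> v)" for v
  proof
    show "stab J (\<alpha> v) \<subseteq> f ` stab H v"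
    proof
      fix k assume k: "k \<in> stab J (\<alpha> v)"
      then have "g k \<in> stab H v" using \<beta>[of "\<alpha> v"] \<beta>\<alpha> by auto
      moreover have "k = f (g k)" using fg k by (simp add: stab_def)
      ultimately show "k \<in> f ` stab H v" by blast
    qed
  qed (rule \<alpha>)
  have equiv: "f h (\<alpha> v) = \<alpha> (h v)" if h: "h \<in> H" for h v
  proof -
    note hA = HD(5)[OF h] and fA = JD(5)[OF fJ[OF h]]
    \<comment> \<open>Conjugation by \<open>h\<close> takes the stabiliser of \<open>v\<close> to
      that of \<open>h v\<close>. After applying \<open>f\<close>, this says that the stabiliser of
      \<open>\<alpha> v\<close> fixes the vertex on the right, which \<open>stab_unique\<close> then
      identifies with \<open>\<alpha> v\<close>.\<close>
    have "stab J (\<alpha> v) \<subseteq> stab J (finv (f h) (\<alpha> (h v)))"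
    proof
      fix k assume "k \<in> stab J (\<alpha> v)"
      then obtain s where s: "s \<in> H" "s v = v" "k = f s" unfolding fstab[symmetric] by (auto simp: stab_def)
      let ?c = "h \<circ> s \<circ> finv h"
      have c: "?c \<in> stab H (h v)" using HD(3)[OF HD(3)[OF h s(1)] HD(4)[OF h]] s(2) hA by (simp add: stab_def)
      then have "f ?c \<in> stab J (\<alpha> (h v))" using \<alpha> by blast
      then have 1: "f ?c (\<alpha> (h v)) = \<alpha> (h v)" by (simp add: stab_def)
      have "?c \<circ> h = h \<circ> s" using hA by auto
      then have "f ?c \<circ> f h = f h \<circ> f s" using hom[of ?c h] hom[OF h s(1)] c h by (simp add: stab_def)
      then have "f h (k (finv (f h) (\<alpha> (h v)))) = f ?c (f h (finv (f h) (\<alpha> (h v))))"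
        using s(3) by (metis comp_apply)
      also have "\<dots> = \<alpha> (h v)" using fA 1 by simp
      finally have "k (finv (f h) (\<alpha> (h v))) = finv (f h) (\<alpha> (h v))" using fA by (metis Aut_inv_f)
      then show "k \<in> stab J (finv (f h) (\<alpha> (h v)))" using s fJ by (simp add: stab_def)
    qed
    then have "\<alpha> v = finv (f h) (\<alpha> (h v))" using stab_unique[OF JS(2,3)] by blast
    then show ?thesis using fA by simp
  qed
  have inj: "inj \<alpha>" using \<beta>\<alpha> by (metis injI)
  have cards: "card {s. d v s = d v w} = card {t. d (\<alpha> v) t = d (\<alpha> v) (\<alpha> w)}" for v w
  proof -
    have "card (\<alpha> ` {s. d v s = d v w}) = card {s. d v s = d v w}"
      by (rule card_image) (use inj in \<open>auto simp: inj_on_def inj_def\<close>)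
    then show ?thesis using sphere_image[OF JS(2,3) HS(2,3) fstab equiv, of v w] by simp
  qed
  have mono: "m = n" if "card {s. d u s = m} = card {s. d u s = n}" for u m n
    using card_sphere_mono[of m n u] card_sphere_mono[of n m u] that by (metis less_irrefl nat_neq_iff)
  have fwd: "adj (\<alpha> v) (\<alpha> w)" if vw: "adj v w" for v w
  proof -
    define m where "m = d (\<alpha> v) (\<alpha> w)"
    have "\<alpha> v \<noteq> \<alpha> w" using vw adj_irrefl inj by (metis injD)
    then have m: "1 \<le> m" unfolding m_def by (metis dist_eq_0 One_nat_def Suc_leI neq0_conv)
    \<comment> \<open>The preimage \<open>w'\<close> of a neighbour of \<open>\<alpha> v\<close> is
      compared with \<open>w\<close>. Since \<open>\<alpha>\<close> preserves sphere sizes and these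
      grow strictly with the radius, \<open>w'\<close> cannot lie further from \<open>v\<close> than
      1; then the spheres of radius 1 and \<open>m\<close> about \<open>\<alpha> v\<close> have
      equal size.\<close>
    obtain c where c: "adj (\<alpha> v) c" using third_nbr by blast
    define w' where "w' = \<beta> c"
    have w': "d (\<alpha> v) (\<alpha> w') = 1" using c \<alpha>\<beta> dist_eq_1 by (simp add: w'_def)
    then have "w' \<noteq> v" by auto
    then have "1 \<le> d v w'" by (metis dist_eq_0 One_nat_def Suc_leI neq0_conv)
    moreover have "d v w' \<le> 1"
    proof (rule ccontr)
      assume "\<not> d v w' \<le> 1"
      then have "card {s. d v s = 1} < card {s. d v s = d v w'}" by (intro card_sphere_mono) simp
      also have "\<dots> = card {t. d (\<alpha> v) t = 1}" using cards[of v w'] w' by simp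
      also have "\<dots> \<le> card {t. d (\<alpha> v) t = m}" using card_sphere_mono[of 1 m "\<alpha> v"] m by (cases "m = 1") auto
      also have "\<dots> = card {s. d v s = 1}" using cards[of v w] vw dist_eq_1[of v w] by (simp add: m_def)
      finally show False by simp
    qed
    ultimately have "d v w' = 1" by simp
    then have "card {t. d (\<alpha> v) t = 1} = card {t. d (\<alpha> v) t = m}"
      using cards[of v w'] w' cards[of v w] vw dist_eq_1[of v w] by (simp add: m_def)
    then have "m = 1" using mono by metis
    then show ?thesis using dist_eq_1 by (simp add: m_def)
  qed
  have bwd: "adj v w" if vw: "adj (\<alpha> v) (\<alpha> w)" for v w
  proof -
    obtain w1 where w1: "adj v w1" using third_nbr by blast
    have "d (\<alpha> v) (\<alpha> w) = d (\<alpha> v) (\<alpha> w1)" using fwd[OF w1] vw dist_eq_1 by metis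
    then have "d v w = d v w1" using cards[of v w] cards[of v w1] mono by metis
    then show ?thesis using w1 dist_eq_1 by metis
  qed
  have "bij \<alpha>" by (rule o_bij[of \<beta>]) (auto simp: \<alpha>\<beta> \<beta>\<alpha>)
  then have \<alpha>A: "\<alpha> \<in> Aut adj" unfolding Aut_def using fwd bwd by blast
  have "f h = conj_by \<alpha> h" if "h \<in> H" for h
  proof
    fix x
    have "f h (\<alpha> (finv \<alpha> x)) = \<alpha> (h (finv \<alpha> x))" by (rule equiv[OF that])
    then show "f h x = conj_by \<alpha> h x" using \<alpha>A by (simp add: conj_by_def)
  qed
  then have "J = conj_by \<alpha> ` H" using bij by (auto simp: bij_betw_def)
  then show ?thesis using \<alpha>A by blast
qed

section \<open>The conjugation action on closed subgroups\<close>

lemma conj_by_Aut: "\<alpha> \<in> Aut adj \<Longrightarrow> h \<in> Aut adj \<Longrightarrow> conj_by \<alpha> h \<in> Aut adj"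
  unfolding conj_by_def by (intro Aut_comp Aut_inv)

lemma conj_by_inv: "\<alpha> \<in> Aut adj \<Longrightarrow> conj_by (finv \<alpha>) (conj_by \<alpha> h) = h" "\<alpha> \<in> Aut adj \<Longrightarrow> conj_by \<alpha> (conj_by (finv \<alpha>) h) = h"
  by (auto simp: conj_by_def fun_eq_iff inv_inv_Aut)

lemma conj_by_mult: "\<alpha> \<in> Aut adj \<Longrightarrow> conj_by \<alpha> (g \<circ> h) = conj_by \<alpha> g \<circ> conj_by \<alpha> h"
  by (auto simp: conj_by_def fun_eq_iff)

lemma conj_by_homeo:
  assumes \<alpha>: "\<alpha> \<in> Aut adj"
  shows "homeomorphic_maps AutT AutT (conj_by \<alpha>) (conj_by (finv \<alpha>))"
proof -
  have *: "continuous_map AutT AutT (conj_by \<gamma>)" if \<gamma>: "\<gamma> \<in> Aut adj" for \<gamma>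
  proof (rule continuous_map_into_aut_topology)
    fix t assume "t \<in> topspace AutT"
    then show "conj_by \<gamma> t \<in> Aut adj" using conj_by_Aut[OF \<gamma>] by (simp add: topspace_aut_topology)
  next
    fix x y
    have "conj_by \<gamma> t x = y \<longleftrightarrow> t (finv \<gamma> x) \<in> {finv \<gamma> y}" for t
      using Aut_inv_eq[OF \<gamma>, of "t (finv \<gamma> x)" y] by (auto simp: conj_by_def)
    then show "openin AutT {t \<in> topspace AutT. conj_by \<gamma> t x = y}"
      using openin_aut_topology_eval[of adj "finv \<gamma> x" "{finv \<gamma> y}"]
      by (simp only: topspace_aut_topology)
  qed
  show ?thesis unfolding homeomorphic_maps_def using *[OF \<alpha>] *[OF Aut_inv[OF \<alpha>]] conj_by_inv[OF \<alpha>] by blast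
qed

lemma conj_by_Sub:
  assumes \<alpha>: "\<alpha> \<in> Aut adj" and H: "H \<in> Sub" shows "conj_by \<alpha> ` H \<in> Sub"
proof -
  have HS: "is_subgroup H" "closedin AutT H" using H by (auto simp: Sub_iff)
  note HD = is_subgroupD[OF HS(1)]
  have "is_subgroup (conj_by \<alpha> ` H)"
    unfolding is_subgroup_def
  proof (intro conjI ballI)
    show "conj_by \<alpha> ` H \<subseteq> Aut adj" using conj_by_Aut[OF \<alpha>] HD(1) by blast
    have "conj_by \<alpha> id = id" using \<alpha> by (auto simp: conj_by_def)
    then show "id \<in> conj_by \<alpha> ` H" using HD(2) by (metis imageI)
  next
    fix g h assume "g \<in> conj_by \<alpha> ` H" "h \<in> conj_by \<alpha> ` H"
    then obtain g' h' where "g' \<in> H" "h' \<in> H" "g = conj_by \<alpha> g'" "h = conj_by \<alpha> h'" by blast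
    then show "g \<circ> h \<in> conj_by \<alpha> ` H" using conj_by_mult[OF \<alpha>, of g' h', symmetric] HD(3) by simp
  next
    fix g assume "g \<in> conj_by \<alpha> ` H"
    then obtain g' where g': "g' \<in> H" "g = conj_by \<alpha> g'" by blast
    have "finv g = conj_by \<alpha> (finv g')"
      using \<alpha> HD(5)[OF g'(1)] unfolding g'(2) conj_by_def
      by (auto simp: fun_eq_iff inv_comp_apply Aut_comp Aut_inv inv_inv_Aut)
    then show "finv g \<in> conj_by \<alpha> ` H" using HD(4)[OF g'(1)] by blast
  qed
  moreover have "closedin AutT (conj_by \<alpha> ` H)"
    using homeomorphic_map_closedness_eq[of "AutT" "AutT" "conj_by \<alpha>" H] conj_by_homeo[OF \<alpha>] HS(2)
    using homeomorphic_map_maps by blast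
  ultimately show ?thesis by (simp add: Sub_iff)
qed

lemma conj_by_iso:
  assumes \<alpha>: "\<alpha> \<in> Aut adj" and H: "H \<in> Sub"
  shows "topologically_isomorphic (sgroup H) (subtop H) (sgroup (conj_by \<alpha> ` H)) (subtop (conj_by \<alpha> ` H))"
proof -
  have "inj_on (conj_by \<alpha>) H" using conj_by_inv(1)[OF \<alpha>] by (metis inj_onI)
  then have "conj_by \<alpha> \<in> iso (sgroup H) (sgroup (conj_by \<alpha> ` H))"
    using conj_by_mult[OF \<alpha>] by (auto simp: iso_def hom_def bij_betw_def aut_group_def)
  moreover have "homeomorphic_map (subtop H) (subtop (conj_by \<alpha> ` H)) (conj_by \<alpha>)"
  proof (rule homeomorphic_map_subtopologies)
    show "homeomorphic_map AutT AutT (conj_by \<alpha>)" using conj_by_homeo[OF \<alpha>] homeomorphic_map_maps by blast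
    have "H \<subseteq> Aut adj" "conj_by \<alpha> ` H \<subseteq> Aut adj" using H conj_by_Sub[OF \<alpha> H] is_subgroupD(1) by (auto simp: Sub_iff)
    then show "conj_by \<alpha> ` (topspace AutT \<inter> H) = topspace AutT \<inter> conj_by \<alpha> ` H"
      by (simp add: topspace_aut_topology Int_absorb1)
  qed
  ultimately show ?thesis unfolding topologically_isomorphic_def by blast
qed

lemma conj_by_C:
  assumes \<alpha>: "\<alpha> \<in> Aut adj" and H: "H \<in> \<C>" shows "conj_by \<alpha> ` H \<in> \<C>"
proof -
  have HS: "H \<in> Sub" "sphere_transitive adj H" "simple_aut H" using H by (auto simp: C_iff)
  note cS = conj_by_Sub[OF \<alpha> HS(1)]
  have "simple_aut (conj_by \<alpha> ` H)"
    using topologically_simple_iso[OF sgroup_Sub[OF HS(1)] sgroup_Sub[OF cS] conj_by_iso[OF \<alpha> HS(1)]]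
      HS simple_aut_iff[OF HS(1)] simple_aut_iff[OF cS] by blast
  moreover have "sphere_transitive adj (conj_by \<alpha> ` H)"
    unfolding sphere_transitive_def
  proof (intro allI impI)
    fix v a b assume "d v a = d v b"
    then have "d (finv \<alpha> v) (finv \<alpha> a) = d (finv \<alpha> v) (finv \<alpha> b)"
      using Aut_dist[OF Aut_inv[OF \<alpha>]] by simp
    then obtain h where h: "h \<in> H" "h (finv \<alpha> v) = finv \<alpha> v" "h (finv \<alpha> a) = finv \<alpha> b"
      using sphere_transitiveD[OF HS(2)] by blast
    then have "conj_by \<alpha> h v = v" "conj_by \<alpha> h a = b" using \<alpha> by (auto simp: conj_by_def)
    then show "\<exists>h\<in>conj_by \<alpha> ` H. h v = v \<and> h a = b" using h(1) by blast
  qed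
  ultimately show ?thesis using cS C_iff by blast
qed

text \<open>Composing \<open>\<alpha>\<close> with an element of \<open>J\<close> does not change
  the conjugate \<open>J\<close>. As \<open>J\<close> moves \<open>\<alpha> x\<close> to whichever
  of \<open>x\<close> and \<open>y\<close> lies at even distance, \<open>\<alpha>\<close> can be
  taken from a union of two compact cosets.\<close>

lemma top_iso_rel_iff:
  assumes x: "adj x y"
  shows "(H, J) \<in> top_iso_rel adj \<longleftrightarrow> H \<in> \<C> \<and> (\<exists>\<alpha>\<in>Aut adj. \<alpha> x \<in> {x, y} \<and> J = conj_by \<alpha> ` H)"
proof
  assume "(H, J) \<in> top_iso_rel adj"
  then have HJ: "H \<in> \<C>" "J \<in> \<C>" "topologically_isomorphic (sgroup H) (subtop H) (sgroup J) (subtop J)"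
    by (auto simp: top_iso_rel_def)
  obtain \<alpha> where \<alpha>: "\<alpha> \<in> Aut adj" "J = conj_by \<alpha> ` H" using iso_is_conjugation[OF HJ] by blast
  have JS: "is_subgroup J" "sphere_transitive adj J" using HJ(2) by (auto simp: C_iff Sub_iff)
  note JD = is_subgroupD[OF JS(1)]
  have "even (d (\<alpha> x) x) \<or> even (d (\<alpha> x) y)"
    using dist_parity[of "\<alpha> x" x y] x dist_eq_1 by (metis even_add odd_one)
  then obtain j where j: "j \<in> J" "j (\<alpha> x) \<in> {x, y}" using sphere_transitive_even[OF JS(2)] by blast
  note jA = JD(5)[OF j(1)]
  have "conj_by j ` J = J"
  proof
    show 1: "conj_by j ` J \<subseteq> J" using JD(3)[OF JD(3)[OF j(1)] JD(4)[OF j(1)]] by (auto simp: conj_by_def)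
    show "J \<subseteq> conj_by j ` J"
    proof
      fix k assume k: "k \<in> J"
      have "conj_by (finv j) k \<in> J"
        using JD(3)[OF JD(3)[OF JD(4)[OF j(1)] k] JD(4)[OF JD(4)[OF j(1)]]] by (simp add: conj_by_def)
      then show "k \<in> conj_by j ` J" using conj_by_inv(2)[OF jA, of k] by (metis imageI)
    qed
  qed
  moreover have "conj_by (j \<circ> \<alpha>) h = conj_by j (conj_by \<alpha> h)" for h
    by (rule ext) (simp add: conj_by_def inv_comp_apply[OF jA \<alpha>(1)])
  then have "conj_by (j \<circ> \<alpha>) ` H = conj_by j ` conj_by \<alpha> ` H" by (simp add: image_image)
  ultimately have "J = conj_by (j \<circ> \<alpha>) ` H" using \<alpha>(2) by simp
  then show "H \<in> \<C> \<and> (\<exists>\<alpha>\<in>Aut adj. \<alpha> x \<in> {x, y} \<and> J = conj_by \<alpha> ` H)"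
    using HJ(1) Aut_comp[OF jA \<alpha>(1)] j(2) by (auto intro!: bexI[of _ "j \<circ> \<alpha>"])
next
  assume "H \<in> \<C> \<and> (\<exists>\<alpha>\<in>Aut adj. \<alpha> x \<in> {x, y} \<and> J = conj_by \<alpha> ` H)"
  then obtain \<alpha> where \<alpha>: "H \<in> \<C>" "\<alpha> \<in> Aut adj" "J = conj_by \<alpha> ` H" by blast
  moreover have "H \<in> Sub" using \<alpha>(1) C_iff by blast
  ultimately show "(H, J) \<in> top_iso_rel adj"
    using conj_by_C[of \<alpha> H] conj_by_iso[of \<alpha> H] by (simp add: top_iso_rel_def)
qed

lemma conj_by_continuous: "continuous_map (prod_topology AutT Chab) Chab (\<lambda>(\<alpha>, H). conj_by \<alpha> ` H)"
  unfolding continuous_map_def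
proof (intro conjI allI impI)
  show "(\<lambda>(\<alpha>, H). conj_by \<alpha> ` H) \<in> topspace (prod_topology AutT Chab) \<rightarrow> topspace Chab"
    using conj_by_Sub by (auto simp: topspace_aut_topology topspace_Chab)
  fix \<A> assume \<A>: "openin Chab \<A>"
  let ?W = "{p \<in> topspace (prod_topology AutT Chab). (case p of (\<alpha>, H) \<Rightarrow> conj_by \<alpha> ` H) \<in> \<A>}"
  show "openin (prod_topology AutT Chab) ?W"
    unfolding openin_prod_topology_alt
  proof (intro allI impI)
    fix \<alpha> H assume "(\<alpha>, H) \<in> ?W"
    then have \<alpha>: "\<alpha> \<in> Aut adj" and H: "H \<in> Sub" and in\<A>: "conj_by \<alpha> ` H \<in> \<A>"
      by (auto simp: topspace_aut_topology topspace_Chab)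
    obtain \<P> where \<P>: "finite \<P>" "\<forall>P\<in>\<P>. finite P"
      "\<And>J. J \<in> Sub \<Longrightarrow> J \<approx>[\<P>] (conj_by \<alpha> ` H) \<Longrightarrow> J \<in> \<A>"
      using \<A> in\<A> unfolding openin_Chab_iff by metis
    define ai where "ai = finv \<alpha>"
    define pull where "pull P = (\<lambda>(a, b). (ai a, ai b)) ` P" for P
    \<comment> \<open>A conjugate by \<open>\<gamma>\<close> realizes \<open>P\<close> iff the
      original group realizes \<open>P\<close> pulled back by \<open>\<gamma>\<close>. Agreement
      with \<open>\<alpha>\<close> on the finite set \<open>X\<close> already gives all pullbacks
      the value computed from \<open>\<alpha>\<close>.\<close>
    define X where "X = ai ` (\<Union>P\<in>\<P>. fst ` P \<union> snd ` P)"
    have X: "finite X" using \<P>(1,2) by (auto simp: X_def)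
    define U where "U = {\<gamma> \<in> Aut adj. \<forall>a\<in>X. \<gamma> a = \<alpha> a}"
    define V where "V = {J \<in> Sub. \<forall>P\<in>\<P>. realizes J (pull P) \<longleftrightarrow> realizes H (pull P)}"
    have realizes_conj: "realizes (conj_by \<gamma> ` J) P \<longleftrightarrow> realizes J (pull P)" if \<gamma>: "\<gamma> \<in> U" and P: "P \<in> \<P>" for \<gamma> J P
    proof -
      have \<gamma>A: "\<gamma> \<in> Aut adj" using \<gamma> by (simp add: U_def)
      have pt: "finv \<gamma> a = ai a" if "a \<in> fst ` P \<union> snd ` P" for a
      proof -
        have "ai a \<in> X" using that P by (auto simp: X_def)
        then have "\<gamma> (ai a) = a" using \<gamma> \<alpha> by (simp add: U_def ai_def)
        then show ?thesis using \<gamma>A by (metis Aut_inv_f)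
      qed
      have *: "conj_by \<gamma> h a = b \<longleftrightarrow> h (ai a) = ai b" if "(a, b) \<in> P" for h a b
      proof -
        have ab: "a \<in> fst ` P \<union> snd ` P" "b \<in> fst ` P \<union> snd ` P" using that by force+
        show ?thesis using pt[OF ab(1)] pt[OF ab(2)] Aut_inv_eq[OF \<gamma>A, of "h (ai a)" b] by (auto simp: conj_by_def)
      qed
      have "(\<forall>(a, b)\<in>P. conj_by \<gamma> h a = b) \<longleftrightarrow> (\<forall>(a, b)\<in>P. h (ai a) = ai b)" for h
      proof (rule ball_cong[OF refl])
        fix p assume "p \<in> P"
        then show "(case p of (a, b) \<Rightarrow> conj_by \<gamma> h a = b) \<longleftrightarrow> (case p of (a, b) \<Rightarrow> h (ai a) = ai b)"
          using *[of "fst p" "snd p" h] by (simp add: split_beta)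
      qed
      then have "(\<forall>(a, b)\<in>P. conj_by \<gamma> h a = b) \<longleftrightarrow> (\<forall>(a, b)\<in>pull P. h a = b)" for h
        by (simp add: pull_def split_beta)
      then show ?thesis unfolding realizes_def by simp
    qed
    have "\<alpha> \<in> U" using \<alpha> by (simp add: U_def)
    have "openin AutT U" unfolding U_def by (rule open_aut_agree[OF X])
    moreover have "openin Chab V"
      unfolding openin_Chab_iff
    proof (intro conjI ballI)
      fix J assume J: "J \<in> V"
      show "\<exists>\<Q>. finite \<Q> \<and> (\<forall>P\<in>\<Q>. finite P) \<and>
        (\<forall>J'\<in>Sub. J' \<approx>[\<Q>] J \<longrightarrow> J' \<in> V)"
        using J \<P>(1,2) by (intro exI[of _ "pull ` \<P>"]) (auto simp: V_def pull_def)
    qed (auto simp: V_def)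
    moreover have "H \<in> V" using H by (simp add: V_def)
    moreover have "U \<times> V \<subseteq> ?W"
    proof
      fix p assume "p \<in> U \<times> V"
      then obtain \<gamma> J where p: "p = (\<gamma>, J)" "\<gamma> \<in> U" "J \<in> V" by blast
      have \<gamma>J: "\<gamma> \<in> Aut adj" "J \<in> Sub" using p by (auto simp: U_def V_def)
      have "realizes (conj_by \<gamma> ` J) P \<longleftrightarrow> realizes (conj_by \<alpha> ` H) P" if "P \<in> \<P>" for P
        unfolding realizes_conj[OF p(2) that] realizes_conj[OF \<open>\<alpha> \<in> U\<close> that] using p(3) that by (simp add: V_def)
      then have "conj_by \<gamma> ` J \<in> \<A>" using \<P>(3)[OF conj_by_Sub[OF \<gamma>J]] by blast
      then show "p \<in> ?W" using \<gamma>J p(1) by (simp add: topspace_aut_topology topspace_Chab)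
    qed
    ultimately show "\<exists>U V. openin AutT U \<and> openin Chab V \<and> \<alpha> \<in> U \<and> H \<in> V \<and> U \<times> V \<subseteq> ?W"
      using \<open>\<alpha> \<in> U\<close> by blast
  qed
qed

text \<open>The saturation of \<open>\<A>\<close> is the continuous image of a product of two
  compact sets, and the Chabauty space is Hausdorff.\<close>

lemma rel_image_closed:
  assumes "closedin Chab \<A>" "\<A> \<subseteq> \<C>"
  shows "closedin Chab (top_iso_rel adj `` \<A>)"
proof -
  fix x
  obtain y where xy: "adj x y" using third_nbr by blast
  define K where "K = {g \<in> Aut adj. g x = x} \<union> {g \<in> Aut adj. g x = y}"
  have K: "compactin AutT K" unfolding K_def by (intro compactin_Un compact_aut_coset)
  have "compactin Chab \<A>" using compact_Chab assms(1) closedin_compact_space by blast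
  then have "compactin (prod_topology AutT Chab) (K \<times> \<A>)" using K by (simp add: compactin_Times)
  then have "compactin Chab ((\<lambda>(\<alpha>, H). conj_by \<alpha> ` H) ` (K \<times> \<A>))" using image_compactin conj_by_continuous by blast
  moreover have "(\<lambda>(\<alpha>, H). conj_by \<alpha> ` H) ` (K \<times> \<A>) = top_iso_rel adj `` \<A>"
  proof
    show "(\<lambda>(\<alpha>, H). conj_by \<alpha> ` H) ` (K \<times> \<A>) \<subseteq> top_iso_rel adj `` \<A>"
    proof clarify
      fix \<alpha> H assume "\<alpha> \<in> K" "H \<in> \<A>"
      then have "(H, conj_by \<alpha> ` H) \<in> top_iso_rel adj" unfolding top_iso_rel_iff[OF xy] K_def using assms(2) by auto
      then show "conj_by \<alpha> ` H \<in> top_iso_rel adj `` \<A>" using \<open>H \<in> \<A>\<close> by blast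
    qed
    show "top_iso_rel adj `` \<A> \<subseteq> (\<lambda>(\<alpha>, H). conj_by \<alpha> ` H) ` (K \<times> \<A>)"
    proof
      fix J assume "J \<in> top_iso_rel adj `` \<A>"
      then obtain H where H: "H \<in> \<A>" "(H, J) \<in> top_iso_rel adj" by blast
      then obtain \<alpha> where "\<alpha> \<in> K" "J = conj_by \<alpha> ` H" unfolding top_iso_rel_iff[OF xy] K_def by auto
      then show "J \<in> (\<lambda>(\<alpha>, H). conj_by \<alpha> ` H) ` (K \<times> \<A>)" using H(1) by force
    qed
  qed
  ultimately show ?thesis using compactin_imp_closedin[OF Hausdorff_Chab] by metis
qed

section \<open>The quotient by the isomorphism relation\<close>

abbreviation Ctop where "Ctop \<equiv> simple_boundary_2_transitive_topology adj"

lemma closedin_Ctop: "closedin Ctop \<A> \<longleftrightarrow> closedin Chab \<A> \<and> \<A> \<subseteq> \<C>"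
  unfolding simple_boundary_2_transitive_topology_def by (rule closedin_closed_subtopology[OF C_closed])

lemma Hausdorff_Ctop: "Hausdorff_space Ctop"
  unfolding simple_boundary_2_transitive_topology_def by (rule Hausdorff_space_subtopology[OF Hausdorff_Chab])

lemma compact_Ctop: "compact_space Ctop"
  unfolding simple_boundary_2_transitive_topology_def
  using closedin_compact_space[OF compact_Chab C_closed] compact_space_subtopology by blast

lemma rel_closed: "closedin Ctop \<A> \<Longrightarrow> closedin Ctop (top_iso_rel adj `` \<A>)"
  using rel_image_closed unfolding closedin_Ctop by (auto simp: top_iso_rel_def)

lemma classes_closed:
  assumes "c \<in> \<C> // top_iso_rel adj" shows "closedin Ctop c"
proof -
  obtain H where H: "H \<in> \<C>" "c = top_iso_rel adj `` {H}" using assms by (auto elim: quotientE)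
  have "closedin Ctop {H}"
    using H(1) by (intro closedin_Hausdorff_sing_eq[OF Hausdorff_Ctop, THEN iffD2])
      (simp add: topspace_simple_boundary_2_transitive_topology)
  then show ?thesis unfolding H(2) by (rule rel_closed)
qed

text \<open>Saturations of closed sets are closed, so the quotient map is closed, and a closed
  continuous image of a normal Hausdorff space is Hausdorff. Normality comes from compactness of
  \<open>\<C>\<close>.\<close>

lemma quotient_space:
  "compact_space (iso_class_topology adj)" "Hausdorff_space (iso_class_topology adj)"
proof -
  let ?q = "\<lambda>H. top_iso_rel adj `` {H}"
  have q: "quotient_map Ctop (iso_class_topology adj) ?q"
    unfolding iso_class_topology_def by (rule quotient_map_quotient_topology)
  have cont: "continuous_map Ctop (iso_class_topology adj) ?q" using q quotient_imp_continuous_map by blast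
  have surj: "?q ` topspace Ctop = topspace (iso_class_topology adj)" using q quotient_imp_surjective_map by blast
  show "compact_space (iso_class_topology adj)"
    using compact_Ctop cont surj unfolding compact_space_def by (metis image_compactin)
  have "closed_map Ctop (iso_class_topology adj) ?q"
    unfolding closed_map_def
  proof (intro allI impI)
    fix \<A> assume \<A>: "closedin Ctop \<A>"
    then have A: "\<A> \<subseteq> \<C>" by (simp add: closedin_Ctop)
    note eqv = equiv_top_iso_rel[of adj]
    have "{H \<in> topspace Ctop. ?q H \<in> ?q ` \<A>} = top_iso_rel adj `` \<A>"
    proof (rule subset_antisym; rule subsetI)
      fix H assume "H \<in> {H \<in> topspace Ctop. ?q H \<in> ?q ` \<A>}"
      then obtain J where J: "J \<in> \<A>" "?q H = ?q J" "H \<in> \<C>"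
        unfolding topspace_simple_boundary_2_transitive_topology by blast
      then have "(J, H) \<in> top_iso_rel adj" using eq_equiv_class_iff[OF eqv, of J H] A by auto
      then show "H \<in> top_iso_rel adj `` \<A>" using J(1) by blast
    next
      fix H assume "H \<in> top_iso_rel adj `` \<A>"
      then obtain J where J: "J \<in> \<A>" "(J, H) \<in> top_iso_rel adj" by blast
      then have "H \<in> \<C>" by (auto simp: top_iso_rel_def)
      moreover have "?q H = ?q J" using equiv_class_eq[OF eqv J(2)] by simp
      ultimately show "H \<in> {H \<in> topspace Ctop. ?q H \<in> ?q ` \<A>}"
        using J(1) by (auto simp: topspace_simple_boundary_2_transitive_topology)
    qed
    then have "closedin Ctop {H \<in> topspace Ctop. ?q H \<in> ?q ` \<A>}" using rel_closed[OF \<A>] by simp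
    moreover have "?q ` \<A> \<subseteq> topspace (iso_class_topology adj)"
      using surj A by (auto simp: topspace_simple_boundary_2_transitive_topology)
    ultimately show "closedin (iso_class_topology adj) (?q ` \<A>)"
      using q unfolding quotient_map_closedin by blast
  qed
  then show "Hausdorff_space (iso_class_topology adj)"
    using normal_Hausdorff_space_closed_continuous_map_image[OF _ Hausdorff_Ctop _ cont surj]
      compact_Hausdorff_or_regular_imp_normal_space[OF compact_Ctop] Hausdorff_Ctop by blast
qed

section \<open>Abstract groups acting on the tree\<close>

text \<open>Ensures that an action 2-transitive on ends is nontrivial.\<close>

lemma two_ends: "\<exists>\<xi>\<in>ends adj. \<exists>\<eta>\<in>ends adj. \<xi> \<noteq> \<eta>"
proof -
  fix v
  obtain a where a: "adj v a" using third_nbr by blast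
  obtain b where b: "adj v b" "b \<noteq> a" using third_nbr by blast
  obtain r where r: "r \<in> rays adj" "r 0 = v" "r 1 = a" using ray_through[of v a 1] a dist_eq_1 by auto
  obtain s where s: "s \<in> rays adj" "s 0 = v" "s 1 = b" using ray_through[of v b 1] b dist_eq_1 by auto
  have "line r s" using r s b by (simp add: line_def)
  from line_ends_neq[OF this] show ?thesis by (intro bexI[OF _ end_of_in[OF r(1)]] bexI[OF _ end_of_in[OF s(1)]])
qed

text \<open>The kernel is closed and normal, and proper because some end is moved, so simplicity
  makes it trivial. Properness makes the injection a closed map, that is, a homeomorphism onto a
  closed subgroup.\<close>

lemma image_of_action:
  assumes G: "topological_group G X" and simple: "topologically_simple G X"
    and act: "acts_continuously_properly adj G X \<phi>" and two: "two_transitive_on_ends adj (\<phi> ` carrier G)"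
  shows "\<exists>H\<in>\<C>. topologically_isomorphic G X (sgroup H) (subtop H)"
proof -
  let ?A = "AutT" and ?D = "discrete_topology (UNIV :: 'v set)"
  have gG: "group G" and topX: "topspace X = carrier G" using G by (auto simp: topological_group_def)
  have hom: "\<phi> \<in> hom G (aut_group adj)"
    and cont: "continuous_map (prod_topology X ?D) ?D (\<lambda>(g, v). \<phi> g v)"
    and proper: "proper_map (prod_topology X ?D) (prod_topology ?D ?D) (\<lambda>(g, v). (v, \<phi> g v))"
    using act by (auto simp: acts_continuously_properly_def)
  interpret \<phi>: group_hom G "aut_group adj" \<phi>
    using gG group_aut_group hom by (simp add: group_hom_def group_hom_axioms_def)
  have \<phi>A: "\<phi> g \<in> Aut adj" if "g \<in> carrier G" for g using \<phi>.hom_closed[OF that] by (simp add: aut_group_def)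
  have ev: "continuous_map X ?D (\<lambda>g. \<phi> g v)" for v
  proof -
    have "continuous_map X (prod_topology X ?D) (\<lambda>g. (g, v))" by (intro continuous_map_pairedI) auto
    from continuous_map_compose[OF this cont] show ?thesis by (simp add: comp_def)
  qed
  have evo: "openin X {g \<in> topspace X. \<phi> g v = w}" and evc: "closedin X {g \<in> topspace X. \<phi> g v = w}" for v w
    using openin_continuous_map_preimage[OF ev, of "{w}" v] closedin_continuous_map_preimage[OF ev, of "{w}" v] by auto
  have c\<phi>: "continuous_map X ?A \<phi>"
    by (rule continuous_map_into_aut_topology) (use \<phi>A topX evo in auto)
  have cpt: "compactin X {g \<in> topspace X. \<phi> g v = w}" for v w
  proof -
    \<comment> \<open>The fibre of the proper map over \<open>(v, w)\<close>; its projection to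
      \<open>X\<close> is the set in question.\<close>
    let ?P = "{p \<in> topspace (prod_topology X ?D). (case p of (g, u) \<Rightarrow> (u, \<phi> g u)) = (v, w)}"
    have "compactin (prod_topology X ?D) ?P" using proper unfolding proper_map_def by auto
    then have "compactin X (fst ` ?P)" using image_compactin continuous_map_fst by blast
    moreover have "fst ` ?P = {g \<in> topspace X. \<phi> g v = w}" by (force simp: image_iff)
    ultimately show ?thesis by simp
  qed
  have closed: "closedin ?A (\<phi> ` F)" if F: "closedin X F" for F
    unfolding closedin_aut_iff
  proof (intro conjI ballI impI)
    have FX: "F \<subseteq> topspace X" using closedin_subset[OF F] .
    then show "\<phi> ` F \<subseteq> Aut adj" using \<phi>A topX by auto
    fix g assume g: "g \<in> Aut adj" "\<forall>A. finite A \<longrightarrow> (\<exists>h\<in>\<phi> ` F. \<forall>a\<in>A. h a = g a)"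
    fix v
    \<comment> \<open>Approximants of \<open>g\<close> may be chosen to agree with it at
      \<open>v\<close>, so only this compact part of \<open>F\<close> matters, and its image is
      closed.\<close>
    let ?C = "\<phi> ` (F \<inter> {t \<in> topspace X. \<phi> t v = g v})"
    have "compactin ?A ?C" using image_compactin[OF closed_Int_compactin[OF F cpt] c\<phi>] .
    then have cl: "closedin ?A ?C" by (rule compactin_imp_closedin[OF Hausdorff_aut])
    have "g \<in> ?C"
    proof (rule cl[unfolded closedin_aut_iff, THEN conjunct2, rule_format, OF g(1)])
      fix A :: "'v set" assume "finite A"
      then have "finite (insert v A)" by simp
      then obtain t where t: "t \<in> F" "\<forall>a\<in>insert v A. \<phi> t a = g a" using g(2) by blast
      then show "\<exists>h\<in>?C. \<forall>a\<in>A. h a = g a" using FX by (intro bexI[of _ "\<phi> t"]) auto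
    qed
    then show "g \<in> \<phi> ` F" by blast
  qed
  have oneA: "\<one>\<^bsub>aut_group adj\<^esub> = id" by (simp add: aut_group_def)
  let ?N = "kernel G (aut_group adj) \<phi>"
  have "closedin X ?N"
  proof -
    have "closedin ?A {id}" using closedin_Hausdorff_sing_eq[OF Hausdorff_aut] Aut_id by (simp add: topspace_aut_topology)
    from closedin_continuous_map_preimage[OF c\<phi> this] show ?thesis by (simp add: kernel_def oneA topX)
  qed
  moreover have "?N \<lhd> G" by (rule \<phi>.normal_kernel)
  moreover have "?N \<noteq> carrier G"
  proof
    assume "?N = carrier G"
    then have triv: "\<phi> g = id" if "g \<in> carrier G" for g using that oneA by (auto simp: kernel_def)
    obtain \<xi> \<eta> where e: "\<xi> \<in> ends adj" "\<eta> \<in> ends adj" "\<xi> \<noteq> \<eta>" using two_ends by blast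
    then obtain g where "g \<in> carrier G" "end_act (\<phi> g) \<xi> = \<eta>"
      using two[unfolded two_transitive_on_ends_def, rule_format, OF e(1,2) e(2,1) e(3)] by auto
    then show False using triv e(3) by (simp add: end_act_def)
  qed
  ultimately have "?N = {\<one>\<^bsub>G\<^esub>}" using simple unfolding topologically_simple_def by blast
  then have inj: "inj_on \<phi> (carrier G)" using \<phi>.inj_iff_trivial_ker by blast
  define H where "H = \<phi> ` carrier G"
  have HS: "H \<in> Sub"
    using closed[OF closedin_topspace] \<phi>.img_is_subgroup by (simp add: closed_subgroups_def H_def topX)
  have "\<phi> \<in> iso G (sgroup H)"
    using hom inj by (auto simp: iso_def hom_def bij_betw_def H_def aut_group_def)
  moreover have "homeomorphic_map X (subtop H) \<phi>"
  proof (rule bijective_closed_imp_homeomorphic_map)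
    show "continuous_map X (subtop H) \<phi>" using c\<phi> by (auto simp: continuous_map_in_subtopology H_def topX)
    show "closed_map X (subtop H) \<phi>"
      unfolding closed_map_def
    proof (intro allI impI)
      fix F assume "closedin X F"
      then show "closedin (subtop H) (\<phi> ` F)"
        using closed closedin_subset[of X F] HS unfolding H_def
        by (intro closedin_subset_topspace) (auto simp: topX)
    qed
    show "\<phi> ` topspace X = topspace (subtop H)" using sgroup_Sub(2)[OF HS] by (simp add: H_def topX)
    show "inj_on \<phi> (topspace X)" using inj topX by simp
  qed
  ultimately have iso: "topologically_isomorphic G X (sgroup H) (subtop H)" unfolding topologically_isomorphic_def by blast
  then have "topologically_simple (sgroup H) (subtop H)"
    using topologically_simple_iso[OF gG topX sgroup_Sub[OF HS] _ simple] by blast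
  then have "H \<in> \<C>" using HS two by (simp add: simple_boundary_2_transitive_def H_def)
  then show ?thesis using iso by blast
qed

text \<open>The action is \<open>f\<close> itself, viewed as a map into the automorphism group. Its
  fibres over pairs of vertices correspond to the intersections of \<open>H\<close> with the compact
  sets of \<open>compact_aut_coset\<close>.\<close>

lemma action_of_iso:
  assumes G: "topological_group G X" and H: "H \<in> \<C>" and iso: "topologically_isomorphic G X (sgroup H) (subtop H)"
  shows "topologically_simple G X"
    and "\<exists>\<phi>. acts_continuously_properly adj G X \<phi> \<and> two_transitive_on_ends adj (\<phi> ` carrier G)"
proof -
  let ?D = "discrete_topology (UNIV :: 'v set)"
  have gG: "group G" and topX: "topspace X = carrier G" using G by (auto simp: topological_group_def)
  have HS: "H \<in> Sub" and sim: "topologically_simple (sgroup H) (subtop H)" and two: "two_transitive_on_ends adj H"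
    using H by (auto simp: simple_boundary_2_transitive_def)
  show "topologically_simple G X"
    using topologically_simple_iso[OF sgroup_Sub[OF HS] gG topX topologically_isomorphic_sym[OF gG topX iso] sim] .
  obtain f where f: "f \<in> iso G (sgroup H)" "homeomorphic_map X (subtop H) f"
    using iso unfolding topologically_isomorphic_def by blast
  have HA: "H \<subseteq> Aut adj" using HS is_subgroupD(1) by (auto simp: Sub_iff)
  have img: "f ` carrier G = H" using f(1) by (auto simp: iso_def bij_betw_def)
  have hom: "f \<in> hom G (aut_group adj)" using f(1) HA by (auto simp: iso_def hom_def aut_group_def)
  have cf: "continuous_map X AutT f"
    using homeomorphic_imp_continuous_map[OF f(2)] by (simp add: continuous_map_in_subtopology)
  have evo: "openin X {g \<in> topspace X. f g v \<in> S}" for v S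
  proof -
    have "{g \<in> topspace X. f g v \<in> S} = {g \<in> topspace X. f g \<in> {h \<in> Aut adj. h v \<in> S}}"
      using img HA topX by auto
    then show ?thesis using openin_continuous_map_preimage[OF cf openin_aut_topology_eval] by simp
  qed
  have "continuous_map (prod_topology X ?D) ?D (\<lambda>(g, v). f g v)"
    unfolding continuous_map_def
  proof (intro conjI allI impI)
    fix S :: "'v set"
    have "{p \<in> topspace (prod_topology X ?D). (case p of (g, v) \<Rightarrow> f g v) \<in> S} =
        \<Union>(range (\<lambda>v. {g \<in> topspace X. f g v \<in> S} \<times> {v}))" by auto
    moreover have "openin (prod_topology X ?D) (\<Union>(range (\<lambda>v. {g \<in> topspace X. f g v \<in> S} \<times> {v})))"
      using evo by (intro openin_Union) (auto simp: openin_prod_Times_iff)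
    ultimately show "openin (prod_topology X ?D) {p \<in> topspace (prod_topology X ?D). (case p of (g, v) \<Rightarrow> f g v) \<in> S}"
      by simp
  qed auto
  moreover have "proper_map (prod_topology X ?D) (prod_topology ?D ?D) (\<lambda>(g, v). (v, f g v))"
    unfolding proper_map_def
  proof (intro conjI ballI)
    \<comment> \<open>The target is discrete, so only compactness of the fibres has content.\<close>
    show "closed_map (prod_topology X ?D) (prod_topology ?D ?D) (\<lambda>(g, v). (v, f g v))"
      by (simp add: closed_map_def prod_topology_discrete_topology[symmetric])
    fix q assume "q \<in> topspace (prod_topology ?D ?D)"
    obtain v w where q: "q = (v, w)" by (cases q)
    have "{p \<in> topspace (prod_topology X ?D). (case p of (g, v) \<Rightarrow> (v, f g v)) = q} =
        {g \<in> topspace X. f g v = w} \<times> {v}" unfolding q by auto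
    moreover have "compactin X {g \<in> topspace X. f g v = w}"
    proof -
      obtain g where g: "homeomorphic_maps X (subtop H) f g" using f(2) homeomorphic_map_maps by blast
      have topH: "topspace (subtop H) = H" using sgroup_Sub(2)[OF HS] by simp
      let ?K = "H \<inter> {h \<in> Aut adj. h v = w}"
      have "compactin AutT ?K"
        using HS by (intro closed_Int_compactin compact_aut_coset) (simp add: Sub_iff)
      then have "compactin (subtop H) ?K" by (simp add: compactin_subtopology)
      then have "compactin X (g ` ?K)" using g image_compactin unfolding homeomorphic_maps_def by blast
      moreover have "g ` ?K = {t \<in> topspace X. f t v = w}"
      proof
        show "g ` ?K \<subseteq> {t \<in> topspace X. f t v = w}"
          using g topH unfolding homeomorphic_maps_def continuous_map_def by auto
        show "{t \<in> topspace X. f t v = w} \<subseteq> g ` ?K"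
        proof
          fix t assume t: "t \<in> {t \<in> topspace X. f t v = w}"
          then have "f t \<in> ?K" using img HA topX by auto
          moreover have "g (f t) = t" using g t unfolding homeomorphic_maps_def by auto
          ultimately show "t \<in> g ` ?K" by force
        qed
      qed
      ultimately show ?thesis by simp
    qed
    ultimately show "compactin (prod_topology X ?D) {p \<in> topspace (prod_topology X ?D). (case p of (g, v) \<Rightarrow> (v, f g v)) = q}"
      by (simp add: compactin_Times)
  qed
  ultimately have "acts_continuously_properly adj G X f" using hom by (simp add: acts_continuously_properly_def)
  then show "\<exists>\<phi>. acts_continuously_properly adj G X \<phi> \<and> two_transitive_on_ends adj (\<phi> ` carrier G)"
    using two img by metis
qed

end

theorem theorem1p2:
  fixes adj :: "'v \<Rightarrow> 'v \<Rightarrow> bool"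
  assumes "tree adj" and "locally_finite adj" and "thick adj" and "semi_regular adj"
  shows
    "closedin (chabauty (aut_group adj) (aut_topology adj)) (simple_boundary_2_transitive adj) \<and>
     (\<forall>c \<in> simple_boundary_2_transitive adj // top_iso_rel adj.
        closedin (simple_boundary_2_transitive_topology adj) c) \<and>
     (\<forall>(G :: 'g monoid) X. topological_group G X \<longrightarrow>
        (topologically_simple G X \<and>
         (\<exists>\<phi>. acts_continuously_properly adj G X \<phi> \<and>
              two_transitive_on_ends adj (\<phi> ` carrier G))
         \<longleftrightarrow>
         (\<exists>H \<in> simple_boundary_2_transitive adj.
            topologically_isomorphic G X
              (aut_group adj\<lparr>carrier := H\<rparr>) (subtopology (aut_topology adj) H)))) \<and>
     compact_space (iso_class_topology adj) \<and>
     Hausdorff_space (iso_class_topology adj)"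
proof -
  interpret thick_tree adj by unfold_locales fact+
  show ?thesis
    using C_closed classes_closed quotient_space image_of_action action_of_iso by blast
qed

end
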